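(* Let $\alpha\in(0,1)$ be fixed. (i) Let $G\in\mathcal{G}$ and assume (QMD), (Hessian) and (Moment) (defined in the context). Let $\xi=\log p_{\widehat\theta_1}(Z)-\log p_{\theta_G}(Z)$, $\sigma^2_{\theta_G,\widehat\theta_1}=\mathrm{Var}_G[\xi\mid D_1]$, and $$\Delta^{\mathrm{BE}}_{n,G}:=\sup_{t\in\mathbb{R}}\left|\mathbb{P}_G\left(\mathbb{G}_n^\times[\sigma^{-1}_{\theta_G,\widehat\theta_1}\xi]\le t\mid D_1\right)-\Phi(t)\right|.$$ Then the nonasymptotic miscoverage probability of the universal confidence set satisfies $$\left|\mathbb{P}_G(\theta_G\notin \mathrm{CI}^{\mathrm{UI}}_{n,\alpha})-\left(1-\mathbb{E}_G[\Phi(z_\alpha+r^{\mathrm{UI}}_{n,G})]\right)\right|\le\min\left\{1,\ \mathbb{E}_G[\Delta^{\mathrm{BE}}_{n,G}]+\inf_{\delta\in(0,\delta_n]}\left\{\mathcal{R}^{\mathrm{UI}}_{n,G}(\delta)+\tau^{\mathrm{C}}_{n,G}(\delta)\right\}\right\},$$ where $$r^{\mathrm{UI}}_{n,G}:=\frac{\log(1/\alpha)}{n^{1/2}\|\widehat\theta_1-\theta_G\|_{I_G}}+\frac{n^{1/2}\|\widehat\theta_1-\theta_G\|^2_{V_G}}{2\|\widehat\theta_1-\theta_G\|_{I_G}}-z_\alpha$$ and $$\mathcal{R}^{\mathrm{UI}}_{n,G}(\delta):=C_p\left\{\delta^2+\left(\frac{\phi_G(\delta)}{\delta^2}\right)^{1/2}+\frac{\omega_G(\delta)}{\delta^2}+\left(\max\{L_{n,G},1\}\,\nu_{G,p}(\delta)\right)^{1/2}\right\}$$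 with a constant $C_p$ depending only on the exponent $p$ in (Moment). (ii) Suppose additionally that the initial estimator $\widehat\theta_1$ satisfies (Consistency) and that the class $\mathcal{G}$ satisfies (ULC) (defined in the context). Then $$\limsup_{n\to\infty}\ \sup_{G\in\mathcal{G}}\left|\mathbb{P}_G(\theta_G\notin\mathrm{CI}^{\mathrm{UI}}_{n,\alpha})-\left(1-\mathbb{E}_G[\Phi(z_\alpha+r^{\mathrm{UI}}_{n,G})]\right)\right|=0.$$
   Context: **Setting.** $\Theta\subseteq\mathbb{R}^d$; $\mathcal{P}_\Theta=\{P_\theta:\theta\in\Theta\}$ is a statistical model dominated by a $\sigma$-finite measure $\mu$, with densities $p_\theta=dP_\theta/d\mu$. $\mathcal{G}$ is a class of distributions. IID observations $Z_1,\dots,Z_N$ are drawn from $G\in\mathcal{G}$, which need not belong to $\mathcal{P}_\Theta$ (misspecification); $Z\sim G$ denotes a generic independent copy. The target is $\theta_G:=\arg\min_{\theta\in\Theta}\mathrm{KL}(G\|P_\theta)$. $\mathbb{P}_G,\mathbb{E}_G,\mathrm{Var}_G$ are probability, expectation, variance under $G$. The index set $\{1,\dots,N\}$ is split into two disjoint sets $D_1,D_2$ with $|D_2|=n$; $\widehat\theta_1$ is an arbitrary estimator computed from $\{Z_i:i\in D_1\}$; conditioning on $D_1$ means conditioning on $\{Z_i:i\in D_1\}$. **Universal confidence set.** $\mathrm{CI}^{\mathrm{UI}}_{n,\alpha}=\{\theta\in\Theta:\sum_{i\in D_2}\log\frac{p_{\widehat\theta_1}(Z_i)}{p_\theta(Z_i)}\le\log(1/\alpha)\}$.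 **Notation.** $\Phi$ is the standard normal CDF and $z_\alpha$ its $1-\alpha$ quantile. For a positive semidefinite matrix $A$, $\|x\|_A^2=x^\top Ax$. For a function $f$, $\mathbb{G}_n^\times f:=n^{-1/2}\sum_{i\in D_2}(f(Z_i)-\mathbb{E}_G[f(Z)\mid D_1])$. A modulus of continuity is a function $\mathbb{R}_+\to\mathbb{R}_+$ in the usual sense (nondecreasing, tending to $0$ at $0$). $\{\delta_n\}$ is a non-negative sequence with $\delta_n\to0$, shared across all conditions; in suprema over $h$, $\theta_G+h\in\Theta$. Limits "as $n\to\infty$" of expressions in $\delta$ below are for $\delta\le\delta_n$. **(QMD).** There exist a $G$-square-integrable score function $\dot\ell_G$ with values in $\mathbb{R}^d$ and a modulus of continuity $\phi_G$ such that for any $\delta\le\delta_n$, $\sup_{\|h\|_{I_G}\le\delta}\mathbb{E}_G\big[\big(p_{\theta_G+h}^{1/2}/p_{\theta_G}^{1/2}-1-\tfrac12h^\top\dot\ell_G\big)^2\big]\le\phi_G(\delta)$, and $\phi_G(\delta)/\delta^2\to0$ as $n\to\infty$. Here $I_G:=\mathbb{E}_G[\dot\ell_G\dot\ell_G^\top]$. **(Hessian).** $V_G$ is a positive definite matrix and there is a modulus of continuity $\omega_G$ such that for any $\delta\le\delta_n$, $\sup_{\|h\|_{V_G}\le\delta}\big|\mathbb{E}_G\big[\log\frac{p_{\theta_G+h}}{p_{\theta_G}}\mid D_1\big]+\tfrac12h^\top V_Gh\big|\le\omega_G(\delta)$, and $\omega_G(\delta)/\delta^2\to0$ as $n\to\infty$.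 **(Consistency).** With $\tau^{\mathrm{C}}_{n,G}(\delta):=\mathbb{P}_G\Big(\max\Big\{\|\widehat\theta_1-\theta_G\|_{I_G},\|\widehat\theta_1-\theta_G\|_{V_G},\frac{\|\widehat\theta_1-\theta_G\|_{V_G}^2}{\|\widehat\theta_1-\theta_G\|_{I_G}}\Big\}>\delta\Big)$, one has $\limsup_{n\to\infty}\sup_{G\in\mathcal{G}}\tau^{\mathrm{C}}_{n,G}(\delta_n)=0$. **(Moment).** Let $p\ge2$ and let $\{L_{n,G}\}_{n\ge1}$ be a sequence that may grow with $n$. For any $\delta\le\delta_n$, $\sup_{\|h\|_{I_G}\le\delta}\big(\mathbb{E}_G\big[\big|p_{\theta_G+h}^{1/2}/p_{\theta_G}^{1/2}-1-\tfrac12h^\top\dot\ell_G\big|^p\big]\big)^{1/p}\le L_{n,G}\,\delta$. Furthermore there is a modulus of continuity $\nu_{G,p}$ such that for any $\delta\le\delta_n$, $\sup_{\|h\|_{I_G}\le\delta}\big(\mathbb{E}_G\big[\big|\log\frac{p_{\theta_G+h}}{p_{\theta_G}}\big|^{2p/(p-2)}\big]\big)^{(p-2)/(2p)}\le\nu_{G,p}(\delta)$, and $\max\{L_{n,G},1\}\nu_{G,p}(\delta)\to0$ as $n\to\infty$. **(ULC).** The random vector $H=\dot\ell_G(Z)$ has mean zero under each $G\in\mathcal{G}$ and $\lim_{\kappa\to\infty}\sup_{G\in\mathcal{G}}\sup_{t\in\mathbb{R}^d}\mathbb{E}_G\Big[\frac{\langle t,H\rangle^2}{\|\langle t,H\rangle\|_2^2}\min\Big\{1,\frac{|\langle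 t,H\rangle|}{\kappa\|\langle t,H\rangle\|_2}\Big\}\Big]=0$, where $\|X\|_2=(\mathbb{E}_G|X|^2)^{1/2}$. When a statement concerns the whole class $\mathcal{G}$, the conditions (QMD), (Hessian), (Moment) are assumed for every $G\in\mathcal{G}$.
   Formalization: Added, as the claims fail without: in (i) φ_G(δ)/δ² and ω_G(δ)/δ² nondecreasing on (0,δ_n]; in (i),(ii) the L^p(G) norm of h^T score is at most max{L_{n,G},1}‖h‖_{I_G} (automatic if p=2); in (ii) the limits in QMD, Hessian, Moment hold uniformly over G. *)

theory Defs
  imports "HOL-Probability.Probability" "Jordan_Normal_Form.Matrix"
begin

unbundle no inner_syntax
unbundle no vec_syntax

section \<open>Analytic vocabulary\<close>

text \<open>Parameters live in \<open>\<real>\<^sup>d\<close> with \<open>d\<close> a natural number, i.e. in \<^term>\<open>carrier_vec d\<close>; a type-indexed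
  dimension would not allow a constant to be chosen before the dimension.\<close>

definition mnorm :: "real mat \<Rightarrow> real vec \<Rightarrow> real" where
  "mnorm A x = sqrt (x \<bullet> (A *\<^sub>v x))"

definition positive_definite_mat :: "nat \<Rightarrow> real mat \<Rightarrow> bool" where
  "positive_definite_mat d A \<longleftrightarrow>
     A \<in> carrier_mat d d \<and> A\<^sup>T = A \<and> (\<forall>x\<in>carrier_vec d. x \<noteq> 0\<^sub>v d \<longrightarrow> 0 < x \<bullet> (A *\<^sub>v x))"

definition is_modulus :: "(real \<Rightarrow> real) \<Rightarrow> bool" where
  "is_modulus w \<longleftrightarrow> (\<forall>x\<ge>0. 0 \<le> w x) \<and> mono_on {0..} w \<and> (w \<longlongrightarrow> 0) (at_right 0)"

text \<open>\<open>(E|f|\<^sup>q)\<^bsup>1/q\<^esup>\<close>, with the essential supremum for \<open>q = \<infinity>\<close>.\<close>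

definition Lq_norm :: "'z measure \<Rightarrow> ereal \<Rightarrow> ('z \<Rightarrow> real) \<Rightarrow> ennreal" where
  "Lq_norm M q f =
     (if q = \<infinity> then esssup M (\<lambda>z. ennreal \<bar>f z\<bar>)
      else (let I = (\<integral>\<^sup>+ z. ennreal (\<bar>f z\<bar> powr real_of_ereal q) \<partial>M)
            in if I = \<infinity> then \<infinity> else ennreal (enn2real I powr (1 / real_of_ereal q))))"

text \<open>Logarithm on \<open>[0,\<infinity>)\<close> with \<open>log 0 = -\<infinity>\<close> (the library has \<open>ln 0 = 0\<close> on the reals).\<close>

definition eln :: "real \<Rightarrow> ereal" where
  "eln x = (if 0 < x then ereal (ln x) else - \<infinity>)"

text \<open>The standard normal distribution function on \<open>[-\<infinity>,\<infinity>]\<close>; on reals it is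
  \<^term>\<open>cdf std_normal_distribution\<close>.\<close>

definition Phi :: "ereal \<Rightarrow> real" where
  "Phi x = measure std_normal_distribution {y. ereal y \<le> x}"

lemma Phi_ereal [simp]: "Phi (ereal t) = cdf std_normal_distribution t"
  by (simp add: Phi_def cdf_def atMost_def)

definition z_quantile :: "real \<Rightarrow> real" where
  "z_quantile \<alpha> = Inf {t. 1 - \<alpha> \<le> cdf std_normal_distribution t}"

text \<open>\<open>KL(G\<parallel>P)\<close> in \<open>[0,\<infinity>]\<close>. The library's real-valued \<^const>\<open>KL_divergence\<close> is meaningful only if
  \<open>G \<lless> P\<close> and the log-density is \<open>G\<close>-integrable; since its negative part always is, the
  divergence is \<open>\<infinity>\<close> in the remaining cases.\<close>

definition KL :: "'z measure \<Rightarrow> 'z measure \<Rightarrow> ereal" where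
  "KL G P =
     (if absolutely_continuous P G \<and> integrable G (entropy_density (exp 1) P G)
      then ereal (KL_divergence (exp 1) P G) else \<infinity>)"


section \<open>Conditioning one block of an independent sample on another\<close>

text \<open>For a sample \<open>(Z\<^sub>i)\<^sub>i\<close>, \<open>i \<in> I \<union> J\<close>, that is iid from \<open>G\<close>, the regular conditional law given
  \<open>(Z\<^sub>i)\<^sub>i\<close>, \<open>i \<in> I\<close>, freezes the first block and leaves the product law on the second one.
  The lemma \<open>cond_expect_version\<close> below says that this is a version of the library's conditional
  expectation.\<close>

definition cond_expect ::
    "nat set \<Rightarrow> nat set \<Rightarrow> 'z measure \<Rightarrow> ((nat \<Rightarrow> 'z) \<Rightarrow> real) \<Rightarrow> (nat \<Rightarrow> 'z) \<Rightarrow> real" where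
  "cond_expect I J G f x = (\<integral>y. f (merge I J (x, y)) \<partial>PiM J (\<lambda>_. G))"

definition cond_prob_given ::
    "nat set \<Rightarrow> nat set \<Rightarrow> 'z measure \<Rightarrow> ((nat \<Rightarrow> 'z) \<Rightarrow> bool) \<Rightarrow> (nat \<Rightarrow> 'z) \<Rightarrow> real" where
  "cond_prob_given I J G A x =
     measure (PiM J (\<lambda>_. G)) {y \<in> space (PiM J (\<lambda>_. G)). A (merge I J (x, y))}"

lemma cond_expect_version:
  fixes I J :: "nat set" and G :: "'z measure" and f :: "(nat \<Rightarrow> 'z) \<Rightarrow> real"
  defines "S \<equiv> PiM (I \<union> J) (\<lambda>_. G)"
  defines "F \<equiv> vimage_algebra (space S) (\<lambda>\<omega>. restrict \<omega> I) (PiM I (\<lambda>_. G))"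
  assumes G: "prob_space G" and fin: "finite I" "finite J" and disj: "I \<inter> J = {}"
    and f: "integrable S f"
  shows "AE \<omega> in S. real_cond_exp S F f \<omega> = cond_expect I J G f (restrict \<omega> I)"
proof -
  interpret G: prob_space G by (rule G)
  interpret P: product_sigma_finite "\<lambda>_::nat. G" by unfold_locales
  interpret S: prob_space S unfolding S_def by (intro prob_space_PiM G)
  define A1 where "A1 = PiM I (\<lambda>_. G)"
  define A2 where "A2 = PiM J (\<lambda>_. G)"
  interpret A1: prob_space A1 unfolding A1_def by (intro prob_space_PiM G)
  interpret A2: prob_space A2 unfolding A2_def by (intro prob_space_PiM G)
  interpret pair: pair_prob_space A1 A2 ..
  have restr [measurable]: "(\<lambda>\<omega>. restrict \<omega> I) \<in> measurable S A1"
    unfolding S_def A1_def by (rule measurable_restrict_subset) auto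
  have merge [measurable]: "merge I J \<in> measurable (A1 \<Otimes>\<^sub>M A2) S"
    unfolding S_def A1_def A2_def by (rule measurable_merge)
  have distr: "distr (A1 \<Otimes>\<^sub>M A2) S (merge I J) = S"
    unfolding S_def A1_def A2_def by (rule P.distr_merge[OF disj fin])
  have sub: "subalgebra S F"
    unfolding subalgebra_def F_def A1_def[symmetric]
    using measurable_sets[OF restr]
    by (auto simp: sets_vimage_algebra2 measurable_space[OF restr])
  interpret fin: finite_measure_subalgebra S F
    by unfold_locales (fact sub)
  have f' [measurable]: "f \<in> borel_measurable S" using f by auto
  have int2: "integrable (A1 \<Otimes>\<^sub>M A2) (\<lambda>p. f (merge I J p))"
    using f by (subst (asm) distr[symmetric]) (simp add: integrable_distr_eq)
  define c where "c x = (\<integral>y. f (merge I J (x, y)) \<partial>A2)" for x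
  have intc: "integrable A1 c"
    unfolding c_def using pair.integrable_fst'[OF int2] by simp
  have c_meas [measurable]: "c \<in> borel_measurable A1" using intc by auto
  have rm: "restrict (merge I J (x, y)) I = x" if "x \<in> space A1" for x y
    using that unfolding A1_def space_PiM by (auto simp: merge_def PiE_def extensional_def fun_eq_iff)
  have restrF: "(\<lambda>\<omega>. restrict \<omega> I) \<in> measurable F A1"
    unfolding F_def A1_def[symmetric]
    by (rule measurable_vimage_algebra1) (use measurable_space[OF restr] in auto)
  interpret PS: product_prob_space "\<lambda>_::nat. G" "I \<union> J" by unfold_locales
  have A1_eq: "A1 = distr S A1 (\<lambda>\<omega>. restrict \<omega> I)"
    using PS.distr_restrict[of I "I \<union> J"] fin unfolding S_def A1_def by simp
  have transfer: "(\<integral>\<omega>. h (restrict \<omega> I) \<partial>S) = (\<integral>x. h x \<partial>A1)"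
    and transfer_int: "integrable S (\<lambda>\<omega>. h (restrict \<omega> I))"
    if h: "integrable A1 h" for h :: "(nat \<Rightarrow> 'z) \<Rightarrow> real"
  proof -
    have [measurable]: "h \<in> borel_measurable A1" using h by auto
    show "(\<integral>\<omega>. h (restrict \<omega> I) \<partial>S) = (\<integral>x. h x \<partial>A1)"
      using arg_cong[OF A1_eq, of "\<lambda>M. integral\<^sup>L M h"] by (simp add: integral_distr)
    show "integrable S (\<lambda>\<omega>. h (restrict \<omega> I))"
      using h arg_cong[OF A1_eq, of "\<lambda>M. integrable M h"] by (simp add: integrable_distr_eq)
  qed
  have "AE \<omega> in S. real_cond_exp S F f \<omega> = c (restrict \<omega> I)"
  proof (rule fin.real_cond_exp_charact)
    show "integrable S f" by (rule f)
    show "integrable S (\<lambda>\<omega>. c (restrict \<omega> I))" by (rule transfer_int[OF intc])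
    show "(\<lambda>\<omega>. c (restrict \<omega> I)) \<in> borel_measurable F"
      using restrF c_meas by (rule measurable_compose)
    fix A assume "A \<in> sets F"
    then obtain B where B [measurable]: "B \<in> sets A1" and A: "A = (\<lambda>\<omega>. restrict \<omega> I) -` B \<inter> space S"
      unfolding F_def A1_def[symmetric]
      using measurable_space[OF restr] by (auto simp: sets_vimage_algebra2)
    have [measurable]: "A \<in> sets S" unfolding A by measurable
    have iA: "integrable S (\<lambda>\<omega>. indicator A \<omega> * f \<omega>)"
      using integrable_mult_indicator[OF \<open>A \<in> sets S\<close> f] by simp
    have "(\<integral>\<omega>\<in>A. f \<omega> \<partial>S) = (\<integral>\<omega>. indicator A \<omega> * f \<omega> \<partial>S)"
      by (simp add: set_lebesgue_integral_def)
    also have "\<dots> = (\<integral>x. (\<integral>y. indicator A (merge I J (x, y)) * f (merge I J (x, y)) \<partial>A2) \<partial>A1)"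
      using P.product_integral_fold[OF disj fin, of "\<lambda>\<omega>. indicator A \<omega> * f \<omega>"] iA
      unfolding S_def A1_def A2_def by simp
    also have "\<dots> = (\<integral>x. (\<integral>y. indicator B x * f (merge I J (x, y)) \<partial>A2) \<partial>A1)"
    proof (intro Bochner_Integration.integral_cong refl)
      fix x y assume x: "x \<in> space A1" and y: "y \<in> space A2"
      have "merge I J (x, y) \<in> space S"
        using measurable_space[OF merge, of "(x, y)"] x y by (simp add: space_pair_measure)
      then show "indicator A (merge I J (x, y)) * f (merge I J (x, y)) = indicator B x * f (merge I J (x, y))"
        using rm[OF x, of y] by (simp add: A indicator_def)
    qed
    also have "\<dots> = (\<integral>x. indicator B x * c x \<partial>A1)"
      unfolding c_def by simp
    also have "\<dots> = (\<integral>\<omega>. indicator B (restrict \<omega> I) * c (restrict \<omega> I) \<partial>S)"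
      using integrable_mult_indicator[OF B intc] by (intro transfer[symmetric]) simp
    also have "\<dots> = (\<integral>\<omega>\<in>A. c (restrict \<omega> I) \<partial>S)"
      unfolding set_lebesgue_integral_def
      by (intro Bochner_Integration.integral_cong) (auto simp: A indicator_def)
    finally show "(\<integral>\<omega>\<in>A. f \<omega> \<partial>S) = (\<integral>\<omega>\<in>A. c (restrict \<omega> I) \<partial>S)" .
  qed
  then show ?thesis unfolding c_def cond_expect_def A2_def .
qed


section \<open>Model, class of distributions and split sample\<close>

text \<open>Entries indexed by \<open>n\<close> describe the stage at which \<open>|D\<^sub>2| = n\<close>; only \<open>n \<ge> 1\<close> is ever used.
  The estimator \<open>est1 n\<close> is a function of the data in \<open>D\<^sub>1\<close> only.\<close>

record 'z ui_problem =
  pdim :: nat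
  Theta :: "real vec set"
  base :: "'z measure"
  dens :: "real vec \<Rightarrow> 'z \<Rightarrow> real"
  dists :: "'z measure set"
  target :: "'z measure \<Rightarrow> real vec"
  nobs :: "nat \<Rightarrow> nat"
  fold1 :: "nat \<Rightarrow> nat set"
  fold2 :: "nat \<Rightarrow> nat set"
  est1 :: "nat \<Rightarrow> (nat \<Rightarrow> 'z) \<Rightarrow> real vec"
  rad :: "nat \<Rightarrow> real"  \<comment> \<open>the sequence \<open>\<delta>\<^sub>n\<close>\<close>

definition is_model :: "'z ui_problem \<Rightarrow> bool" where
  "is_model S \<longleftrightarrow>
     Theta S \<subseteq> carrier_vec (pdim S) \<and> sigma_finite_measure (base S) \<and>
     (\<forall>\<theta>\<in>Theta S. dens S \<theta> \<in> borel_measurable (base S) \<and> (\<forall>z\<in>space (base S). 0 \<le> dens S \<theta> z) \<and>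
        prob_space (density (base S) (\<lambda>z. ennreal (dens S \<theta> z))))"

definition are_distributions :: "'z ui_problem \<Rightarrow> bool" where
  "are_distributions S \<longleftrightarrow>
     (\<forall>G\<in>dists S. prob_space G \<and> sets G = sets (base S) \<and>
        is_arg_min (\<lambda>\<theta>. KL G (density (base S) (\<lambda>z. ennreal (dens S \<theta> z))))
          (\<lambda>\<theta>. \<theta> \<in> Theta S) (target S G))"

text \<open>Last clause: measurability of \<open>(x, z) \<mapsto> p\<^bsub>est1(x)\<^esub>(z)\<close>; it holds for a measurable estimator
  whenever \<open>(\<theta>, z) \<mapsto> p\<^sub>\<theta>(z)\<close> is jointly measurable, and is what makes the plug-in log-likelihood
  ratios random variables.\<close>

definition is_estimator :: "'z ui_problem \<Rightarrow> nat \<Rightarrow> bool" where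
  "is_estimator S n \<longleftrightarrow>
     (let X = PiM (fold1 S n) (\<lambda>_. base S) in
        (\<forall>x\<in>space X. est1 S n x \<in> Theta S) \<and>
        (\<forall>i<pdim S. (\<lambda>x. est1 S n x $ i) \<in> borel_measurable X) \<and>
        (\<lambda>(x, z). dens S (est1 S n x) z) \<in> borel_measurable (X \<Otimes>\<^sub>M base S))"

definition valid_problem :: "'z ui_problem \<Rightarrow> bool" where
  "valid_problem S \<longleftrightarrow>
     is_model S \<and> are_distributions S \<and>
     (\<forall>n\<ge>1. fold1 S n \<inter> fold2 S n = {} \<and> fold1 S n \<union> fold2 S n = {1..nobs S n} \<and>
        card (fold2 S n) = n \<and> is_estimator S n) \<and>
     (\<forall>n\<ge>1. 0 \<le> rad S n) \<and> rad S \<longlonglongrightarrow> 0"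

definition sample :: "'z ui_problem \<Rightarrow> nat \<Rightarrow> 'z measure \<Rightarrow> (nat \<Rightarrow> 'z) measure" where
  "sample S n G = PiM {1..nobs S n} (\<lambda>_. G)"

abbreviation data1 :: "'z ui_problem \<Rightarrow> nat \<Rightarrow> (nat \<Rightarrow> 'z) \<Rightarrow> (nat \<Rightarrow> 'z)" where
  "data1 S n \<omega> \<equiv> restrict \<omega> (fold1 S n)"

text \<open>The displacement of the initial estimator from the target, for a realisation \<open>\<omega>\<close> of the sample.\<close>

definition est_err :: "'z ui_problem \<Rightarrow> nat \<Rightarrow> 'z measure \<Rightarrow> (nat \<Rightarrow> 'z) \<Rightarrow> real vec" where
  "est_err S n G \<omega> = est1 S n (data1 S n \<omega>) - target S G"


section \<open>Universal confidence set and the quantities in the bound\<close>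

text \<open>Log-ratios are differences of extended logarithms, so \<open>log(p/0) = \<infinity>\<close> and \<open>log(0/p) = -\<infinity>\<close> for
  \<open>p > 0\<close>. Ambiguous sums \<open>\<infinity> - \<infinity>\<close> are \<open>\<infinity>\<close> in \<^typ>\<open>ereal\<close>.\<close>

definition CI_UI :: "'z ui_problem \<Rightarrow> nat \<Rightarrow> real \<Rightarrow> (nat \<Rightarrow> 'z) \<Rightarrow> real vec set" where
  "CI_UI S n \<alpha> \<omega> =
     {\<theta> \<in> Theta S.
        (\<Sum>i\<in>fold2 S n. eln (dens S (est1 S n (data1 S n \<omega>)) (\<omega> i)) - eln (dens S \<theta> (\<omega> i)))
          \<le> ereal (ln (1 / \<alpha>))}"

definition miscoverage :: "'z ui_problem \<Rightarrow> nat \<Rightarrow> real \<Rightarrow> 'z measure \<Rightarrow> real" where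
  "miscoverage S n \<alpha> G =
     measure (sample S n G) {\<omega> \<in> space (sample S n G). target S G \<notin> CI_UI S n \<alpha> \<omega>}"

definition log_lik_ratio :: "'z ui_problem \<Rightarrow> 'z measure \<Rightarrow> real vec \<Rightarrow> 'z \<Rightarrow> real" where
  "log_lik_ratio S G \<theta> z = ln (dens S \<theta> z) - ln (dens S (target S G) z)"

text \<open>A generic copy \<open>Z \<sim> G\<close> is independent of \<open>D\<^sub>1\<close>, so the conditional variance of
  \<open>log p\<^sub>\<theta>(Z) - log p\<^bsub>target\<^esub>(Z)\<close> at \<open>\<theta> = est1\<close> is the \<open>G\<close>-variance with \<open>\<theta>\<close> frozen; likewise for the
  conditional mean in \<open>emp_cross\<close>.\<close>

definition llr_sd :: "'z ui_problem \<Rightarrow> 'z measure \<Rightarrow> real vec \<Rightarrow> real" where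
  "llr_sd S G \<theta> =
     sqrt (\<integral>z. (log_lik_ratio S G \<theta> z - (\<integral>z'. log_lik_ratio S G \<theta> z' \<partial>G))\<^sup>2 \<partial>G)"

definition emp_cross :: "'z ui_problem \<Rightarrow> nat \<Rightarrow> 'z measure \<Rightarrow> ('z \<Rightarrow> real) \<Rightarrow> (nat \<Rightarrow> 'z) \<Rightarrow> real" where
  "emp_cross S n G f \<omega> = (\<Sum>i\<in>fold2 S n. f (\<omega> i) - (\<integral>z. f z \<partial>G)) / sqrt (real n)"

text \<open>\<open>\<Delta>\<^sup>B\<^sup>E\<close> as a function of the \<open>D\<^sub>1\<close>-data \<open>x\<close>.\<close>

definition Delta_BE :: "'z ui_problem \<Rightarrow> nat \<Rightarrow> 'z measure \<Rightarrow> (nat \<Rightarrow> 'z) \<Rightarrow> ennreal" where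
  "Delta_BE S n G x =
     (SUP t::real. ennreal \<bar>cond_prob_given (fold1 S n) (fold2 S n) G
          (\<lambda>\<omega>. let \<theta> = est1 S n (data1 S n \<omega>) in
             emp_cross S n G (\<lambda>z. inverse (llr_sd S G \<theta>) * log_lik_ratio S G \<theta> z) \<omega> \<le> t) x
        - cdf std_normal_distribution t\<bar>)"

text \<open>\<open>I\<^sub>G\<close>, for a score function \<open>l\<close>.\<close>

definition info_mat :: "nat \<Rightarrow> 'z measure \<Rightarrow> ('z \<Rightarrow> real vec) \<Rightarrow> real mat" where
  "info_mat d G l = mat d d (\<lambda>(i, j). \<integral>z. l z $ i * l z $ j \<partial>G)"

text \<open>Quotients by \<open>\<parallel>est1 - \<theta>\<^sub>G\<parallel>\<^bsub>I\<^esub>\<close> are taken in \<^typ>\<open>ereal\<close>, where \<open>c/0 = \<infinity>\<close> for \<open>c > 0\<close> and \<open>0/0 = 0\<close>.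
  If \<open>est1 = \<theta>\<^sub>G\<close>, this gives \<open>r = \<infinity>\<close> and \<open>\<Phi>(z + r) = 1\<close>, in accordance with the fact that \<open>\<theta>\<^sub>G\<close> is
  then covered with certainty.\<close>

definition r_UI :: "'z ui_problem \<Rightarrow> nat \<Rightarrow> real \<Rightarrow> 'z measure \<Rightarrow> real mat \<Rightarrow> real mat \<Rightarrow> (nat \<Rightarrow> 'z) \<Rightarrow> ereal" where
  "r_UI S n \<alpha> G I V \<omega> =
     (let h = est_err S n G \<omega> in
        ereal (ln (1 / \<alpha>)) / ereal (sqrt (real n) * mnorm I h)
        + ereal (sqrt (real n) * (mnorm V h)\<^sup>2) / ereal (2 * mnorm I h)
        - ereal (z_quantile \<alpha>))"

definition miscoverage_approx ::
    "'z ui_problem \<Rightarrow> nat \<Rightarrow> real \<Rightarrow> 'z measure \<Rightarrow> real mat \<Rightarrow> real mat \<Rightarrow> real" where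
  "miscoverage_approx S n \<alpha> G I V =
     1 - (\<integral>\<omega>. Phi (ereal (z_quantile \<alpha>) + r_UI S n \<alpha> G I V \<omega>) \<partial>sample S n G)"

definition tau_C :: "'z ui_problem \<Rightarrow> nat \<Rightarrow> 'z measure \<Rightarrow> real mat \<Rightarrow> real mat \<Rightarrow> real \<Rightarrow> real" where
  "tau_C S n G I V \<delta> =
     measure (sample S n G)
       {\<omega> \<in> space (sample S n G).
          (let h = est_err S n G \<omega> in
             Max {ereal (mnorm I h), ereal (mnorm V h), ereal ((mnorm V h)\<^sup>2) / ereal (mnorm I h)}
               > ereal \<delta>)}"

definition remainder_UI ::
    "real \<Rightarrow> real \<Rightarrow> (real \<Rightarrow> real) \<Rightarrow> (real \<Rightarrow> real) \<Rightarrow> (real \<Rightarrow> real) \<Rightarrow> real \<Rightarrow> real" where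
  "remainder_UI C L \<phi> w \<nu> \<delta> =
     C * (\<delta>\<^sup>2 + sqrt (\<phi> \<delta> / \<delta>\<^sup>2) + w \<delta> / \<delta>\<^sup>2 + sqrt (max L 1 * \<nu> \<delta>))"


section \<open>Conditions\<close>

text \<open>Each condition is stated for a class \<open>K\<close> of distributions: the bounds hold for every
  \<open>G \<in> K\<close>, and the limits in \<open>n\<close> are uniform over \<open>\<delta> \<in> (0,\<delta>\<^sub>n]\<close> and over \<open>K\<close>. For
  \<open>K = {G}\<close> this is the condition for a single \<open>G\<close>.\<close>

definition vanishes_below ::
    "'z ui_problem \<Rightarrow> 'z measure set \<Rightarrow> (nat \<Rightarrow> 'z measure \<Rightarrow> real \<Rightarrow> real) \<Rightarrow> bool" where
  "vanishes_below S K F \<longleftrightarrow>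
     (\<forall>\<epsilon>>0. \<forall>\<^sub>F n in sequentially. \<forall>G\<in>K. \<forall>\<delta>. 0 < \<delta> \<and> \<delta> \<le> rad S n \<longrightarrow> \<bar>F n G \<delta>\<bar> < \<epsilon>)"

definition shifts :: "'z ui_problem \<Rightarrow> 'z measure \<Rightarrow> real mat \<Rightarrow> real \<Rightarrow> real vec set" where
  "shifts S G A \<delta> = {h \<in> carrier_vec (pdim S). target S G + h \<in> Theta S \<and> mnorm A h \<le> \<delta>}"

definition root_remainder ::
    "'z ui_problem \<Rightarrow> 'z measure \<Rightarrow> ('z \<Rightarrow> real vec) \<Rightarrow> real vec \<Rightarrow> 'z \<Rightarrow> real" where
  "root_remainder S G l h z =
     sqrt (dens S (target S G + h) z) / sqrt (dens S (target S G) z) - 1 - (h \<bullet> l z) / 2"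

text \<open>The log-ratio is \<open>G\<close>-almost surely a well-defined real number.\<close>

definition llr_defined :: "'z ui_problem \<Rightarrow> 'z measure \<Rightarrow> real vec \<Rightarrow> bool" where
  "llr_defined S G \<theta> \<longleftrightarrow> (AE z in G. 0 < dens S \<theta> z \<and> 0 < dens S (target S G) z)"

definition QMD ::
    "'z ui_problem \<Rightarrow> 'z measure set \<Rightarrow> ('z measure \<Rightarrow> 'z \<Rightarrow> real vec) \<Rightarrow> ('z measure \<Rightarrow> real \<Rightarrow> real) \<Rightarrow> bool" where
  "QMD S K l \<phi> \<longleftrightarrow>
     (\<forall>G\<in>K.
        (\<forall>z\<in>space G. l G z \<in> carrier_vec (pdim S)) \<and>
        (\<forall>i<pdim S. (\<lambda>z. l G z $ i) \<in> borel_measurable G \<and> integrable G (\<lambda>z. (l G z $ i)\<^sup>2)) \<and>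
        is_modulus (\<phi> G) \<and>
        (\<forall>n\<ge>1. \<forall>\<delta>. 0 \<le> \<delta> \<and> \<delta> \<le> rad S n \<longrightarrow>
           (SUP h\<in>shifts S G (info_mat (pdim S) G (l G)) \<delta>.
              \<integral>\<^sup>+ z. ennreal ((root_remainder S G (l G) h z)\<^sup>2) \<partial>G) \<le> ennreal (\<phi> G \<delta>))) \<and>
     vanishes_below S K (\<lambda>n G \<delta>. \<phi> G \<delta> / \<delta>\<^sup>2)"

definition Hessian ::
    "'z ui_problem \<Rightarrow> 'z measure set \<Rightarrow> ('z measure \<Rightarrow> real mat) \<Rightarrow> ('z measure \<Rightarrow> real \<Rightarrow> real) \<Rightarrow> bool" where
  "Hessian S K V w \<longleftrightarrow>
     (\<forall>G\<in>K.
        positive_definite_mat (pdim S) (V G) \<and> is_modulus (w G) \<and>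
        (\<forall>n\<ge>1. \<forall>\<delta>. 0 \<le> \<delta> \<and> \<delta> \<le> rad S n \<longrightarrow>
           (\<forall>h\<in>shifts S G (V G) \<delta>. llr_defined S G (target S G + h) \<and>
              integrable G (log_lik_ratio S G (target S G + h))) \<and>
           (SUP h\<in>shifts S G (V G) \<delta>.
              ennreal \<bar>(\<integral>z. log_lik_ratio S G (target S G + h) z \<partial>G) + (h \<bullet> (V G *\<^sub>v h)) / 2\<bar>)
             \<le> ennreal (w G \<delta>))) \<and>
     vanishes_below S K (\<lambda>n G \<delta>. w G \<delta> / \<delta>\<^sup>2)"

text \<open>The exponent \<open>2p/(p-2)\<close> is computed in \<^typ>\<open>ereal\<close>; it is \<open>\<infinity>\<close> for \<open>p = 2\<close>.\<close>

definition Moment ::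
    "'z ui_problem \<Rightarrow> real \<Rightarrow> 'z measure set \<Rightarrow> ('z measure \<Rightarrow> 'z \<Rightarrow> real vec) \<Rightarrow>
      (nat \<Rightarrow> 'z measure \<Rightarrow> real) \<Rightarrow> ('z measure \<Rightarrow> real \<Rightarrow> real) \<Rightarrow> bool" where
  "Moment S p K l L \<nu> \<longleftrightarrow>
     (\<forall>G\<in>K.
        is_modulus (\<nu> G) \<and>
        (\<forall>n\<ge>1. \<forall>\<delta>. 0 \<le> \<delta> \<and> \<delta> \<le> rad S n \<longrightarrow>
           (SUP h\<in>shifts S G (info_mat (pdim S) G (l G)) \<delta>.
              Lq_norm G (ereal p) (root_remainder S G (l G) h)) \<le> ennreal (L n G * \<delta>) \<and>
           (\<forall>h\<in>shifts S G (info_mat (pdim S) G (l G)) \<delta>. llr_defined S G (target S G + h)) \<and>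
           (SUP h\<in>shifts S G (info_mat (pdim S) G (l G)) \<delta>.
              Lq_norm G (ereal (2 * p) / ereal (p - 2)) (log_lik_ratio S G (target S G + h)))
             \<le> ennreal (\<nu> G \<delta>))) \<and>
     vanishes_below S K (\<lambda>n G \<delta>. max (L n G) 1 * \<nu> G \<delta>)"

text \<open>A companion of \<^const>\<open>Moment\<close> for the linear term: together they bound the \<open>L\<^sup>p\<close>-norm of
  the full increment \<open>sqrt (p\<^bsub>\<theta>+h\<^esub> / p\<^bsub>\<theta>\<^esub>) - 1\<close> by a multiple of \<open>max L 1 * \<parallel>h\<parallel>\<^bsub>I\<^esub>\<close>, which for \<open>p > 2\<close>
  the bound on the remainder alone does not give. For \<open>p = 2\<close> it holds automatically, because the
  \<open>L\<^sup>2\<close>-norm of \<open>\<langle>h, l\<rangle>\<close> is \<open>\<parallel>h\<parallel>\<^bsub>I\<^esub>\<close>.\<close>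

definition Score_moment ::
    "'z ui_problem \<Rightarrow> real \<Rightarrow> 'z measure set \<Rightarrow> ('z measure \<Rightarrow> 'z \<Rightarrow> real vec) \<Rightarrow>
      (nat \<Rightarrow> 'z measure \<Rightarrow> real) \<Rightarrow> bool" where
  "Score_moment S p K l L \<longleftrightarrow>
     (\<forall>G\<in>K. \<forall>n\<ge>1. \<forall>h\<in>shifts S G (info_mat (pdim S) G (l G)) (rad S n).
        Lq_norm G (ereal p) (\<lambda>z. h \<bullet> l G z)
          \<le> ennreal (max (L n G) 1 * mnorm (info_mat (pdim S) G (l G)) h))"

definition Consistency ::
    "'z ui_problem \<Rightarrow> ('z measure \<Rightarrow> 'z \<Rightarrow> real vec) \<Rightarrow> ('z measure \<Rightarrow> real mat) \<Rightarrow> bool" where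
  "Consistency S l V \<longleftrightarrow>
     limsup (\<lambda>n. SUP G\<in>dists S.
       ennreal (tau_C S n G (info_mat (pdim S) G (l G)) (V G) (rad S n))) = 0"

text \<open>For \<open>t\<close> with \<open>\<parallel>\<langle>t,H\<rangle>\<parallel>\<^sub>2 = 0\<close> the normalised integrand is \<open>0\<close>, by \<open>x / 0 = 0\<close>.\<close>

definition ULC :: "'z ui_problem \<Rightarrow> ('z measure \<Rightarrow> 'z \<Rightarrow> real vec) \<Rightarrow> bool" where
  "ULC S l \<longleftrightarrow>
     (\<forall>G\<in>dists S. \<forall>i<pdim S. integrable G (\<lambda>z. l G z $ i) \<and> (\<integral>z. l G z $ i \<partial>G) = 0) \<and>
     ((\<lambda>\<kappa>::real. SUP G\<in>dists S. SUP t\<in>carrier_vec (pdim S).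
         (let s = sqrt (\<integral>z. (t \<bullet> l G z)\<^sup>2 \<partial>G) in
            \<integral>\<^sup>+ z. ennreal ((t \<bullet> l G z)\<^sup>2 / s\<^sup>2 * min 1 (\<bar>t \<bullet> l G z\<bar> / (\<kappa> * s))) \<partial>G))
       \<longlongrightarrow> 0) at_top"

end

theory Submission
  imports Defs
begin

text \<open>Condition on the data in \<open>D\<^sub>1\<close> and put \<open>h = est1 - \<theta>\<^sub>G\<close>, \<open>a = \<parallel>h\<parallel>\<^sub>I\<close>, \<open>v = \<parallel>h\<parallel>\<^sub>V\<close> and
  \<open>W = log (p\<^bsub>\<theta>+h\<^esub> / p\<^bsub>\<theta>\<^esub>)\<close>. With \<open>R = exp (W/2) - 1\<close> one has \<open>\<bar>W - 2R\<bar> \<le> \<bar>R\<bar> \<bar>W\<bar>\<close>, so Hoelder's inequality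
  and the moment condition make \<open>W\<close> close in \<open>L\<^sup>2\<close> to \<open>2R\<close>, and quadratic mean differentiability makes \<open>2R\<close>
  close to the linear term \<open>\<langle>h, l\<rangle>\<close>, whose \<open>L\<^sup>2\<close>-norm is \<open>a\<close>. Since the mean of \<open>W\<close> is about \<open>-v\<^sup>2/2\<close>, which is
  of smaller order than \<open>a\<close> off an event of probability \<open>\<tau>\<^sup>C\<close>, the standard deviation of \<open>W\<close> is \<open>a\<close> up to a
  factor close to \<open>1\<close>. The target is missed iff the studentised sum of the \<open>W(Z\<^sub>i)\<close> exceeds a cut-off
  which is therefore \<open>T = z\<^sub>\<alpha> + r\<close> up to a factor close to \<open>1\<close>, and the normal distribution function
  is insensitive to relative perturbations of \<open>T\<close>, uniformly in \<open>T > 0\<close>.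

  For the asymptotic part, \<open>L\<^sup>2\<close>-closeness transfers the uniform Lindeberg condition from \<open>\<langle>h, l\<rangle>/a\<close> to the
  standardised \<open>W\<close>, and a central limit theorem that is uniform under this condition applies.\<close>

section \<open>A uniform central limit theorem\<close>

text \<open>On the good event a is at most \<delta>, so the standard deviation of W shrinks along
  with the estimation error. Every error must therefore be controlled relative to a, since
  studentisation divides by it. This is why Hoelder's inequality needs L^p bounds proportional to a
  for both parts of R: the remainder (\<open>Moment\<close>) and the linear term
  (\<open>Score_moment\<close>). The conditions are read off at the random radii a and v, while the
  bound is stated at a fixed \<delta> above them. In part (i) monotonicity of
  \<phi>(\<delta>)/\<delta>^2 and w(\<delta>)/\<delta>^2 carries the ratios from the random radius
  to \<delta>; in part (ii) the limits are uniform over all radii up to \<open>rad\<close>.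
  \<open>Delta_BE\<close> is a supremum over uncountably many t whose measurability is not
  established, so its integral is handled as a lower integral. The square root on the moment term of
  the remainder costs nothing: the argument yields that term to the first power, which is smaller
  whenever the claimed bound is below 1.\<close>

lemma real_distribution_normalized_sum:
  fixes G :: "'a measure" and X :: "'a \<Rightarrow> real"
  assumes G: "prob_space G" and X [measurable]: "X \<in> borel_measurable G"
  shows "real_distribution (distr (PiM J (\<lambda>_. G)) borel (\<lambda>y. (\<Sum>i\<in>J. X (y i)) / c))"
proof -
  interpret P: prob_space "PiM J (\<lambda>_. G)" by (intro prob_space_PiM G)
  show ?thesis by (rule P.real_distribution_distr) measurable
qed

text \<open>The truncated second moment stays explicit, so the bound is uniform in the law.
  Independence makes the characteristic function the n-th power of \<psi>, a Taylor expansion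
  compares \<psi> with 1 - t^2/(2n), and n-th powers of two numbers in the unit disc differ by at
  most n times their distance. The assumption t^2/4 \<le> n puts 1 - t^2/(2n) into [-1,1].\<close>

lemma char_normalized_sum:
  fixes G :: "'a measure" and X :: "'a \<Rightarrow> real" and J :: "'i set"
  defines "n \<equiv> card J"
  assumes G: "prob_space G" and X [measurable]: "X \<in> borel_measurable G"
    and X2: "integrable G (\<lambda>z. (X z)\<^sup>2)" and mean: "(\<integral>z. X z \<partial>G) = 0" and var: "(\<integral>z. (X z)\<^sup>2 \<partial>G) = 1"
    and J: "finite J" "0 < n" and n: "t\<^sup>2 / 4 \<le> real n"
  shows "cmod (char (distr (PiM J (\<lambda>_. G)) borel (\<lambda>y. (\<Sum>i\<in>J. X (y i)) / sqrt n)) t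
             - complex_of_real ((1 + (- (t\<^sup>2) / 2) / n) ^ n))
         \<le> t\<^sup>2 * (\<integral>z. (X z)\<^sup>2 * min 1 (\<bar>X z\<bar> * \<bar>t\<bar> / sqrt n) \<partial>G)"
proof -
  interpret G: prob_space G by (rule G)
  interpret P: prob_space "PiM J (\<lambda>_. G)" by (intro prob_space_PiM G)
  define s where "s = t / sqrt n"
  define \<psi> where "\<psi> = char (distr G borel X) s"
  interpret D: real_distribution "distr G borel X" by (rule G.real_distribution_distr) simp
  have X1: "integrable G X" by (rule G.square_integrable_imp_integrable) (use X2 in auto)
  have ind: "P.indep_vars (\<lambda>_. borel) (\<lambda>i y. X (y i) / sqrt n) J"
  proof -
    have "P.indep_vars (\<lambda>_. G) (\<lambda>i y. y i) J"
    proof (subst P.indep_vars_iff_distr_eq_PiM')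
      show "J \<noteq> {}" using J by (auto simp: n_def)
      \<comment> \<open>Restriction to J is the identity on the product space, so the joint law of
        the coordinates is the product measure itself.\<close>
      have "distr (PiM J (\<lambda>_. G)) (PiM J (\<lambda>_. G)) (\<lambda>x. \<lambda>i\<in>J. x i)
          = distr (PiM J (\<lambda>_. G)) (PiM J (\<lambda>_. G)) (\<lambda>x. x)"
        by (intro distr_cong) (auto simp: space_PiM PiE_restrict)
      also have "\<dots> = PiM J (\<lambda>i. distr (PiM J (\<lambda>_. G)) G (\<lambda>x. x i))"
        by (simp add: distr_PiM_component[OF G] cong: PiM_cong)
      finally show "distr (PiM J (\<lambda>_. G)) (PiM J (\<lambda>_. G)) (\<lambda>x. \<lambda>i\<in>J. x i)
          = PiM J (\<lambda>i. distr (PiM J (\<lambda>_. G)) G (\<lambda>x. x i))" .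
    qed simp
    then show ?thesis by (rule P.indep_vars_compose2[where Y="\<lambda>_ z. X z / sqrt n"]) simp
  qed
  have "char (distr (PiM J (\<lambda>_. G)) borel (\<lambda>y. (\<Sum>i\<in>J. X (y i)) / sqrt n)) t
      = char (distr (PiM J (\<lambda>_. G)) borel (\<lambda>y. \<Sum>i\<in>J. X (y i) / sqrt n)) t"
    by (simp add: sum_divide_distrib)
  also have "\<dots> = (\<Prod>i\<in>J. char (distr (PiM J (\<lambda>_. G)) borel (\<lambda>y. X (y i) / sqrt n)) t)"
    by (rule P.char_distr_sum[OF ind])
  also have "\<dots> = (\<Prod>i\<in>J. \<psi>)"
  proof (rule prod.cong[OF refl])
    fix i assume i: "i \<in> J"
    have "char (distr (PiM J (\<lambda>_. G)) borel (\<lambda>y. X (y i) / sqrt n)) t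
        = (CLINT y|PiM J (\<lambda>_. G). iexp (s * X (y i)))"
      using i by (simp add: char_def integral_distr s_def ac_simps)
    also have "\<dots> = (CLINT z|distr (PiM J (\<lambda>_. G)) G (\<lambda>y. y i). iexp (s * X z))"
      using i by (subst integral_distr) auto
    also have "distr (PiM J (\<lambda>_. G)) G (\<lambda>y. y i) = G"
      by (rule distr_PiM_component[OF G i])
    also have "(CLINT z|G. iexp (s * X z)) = \<psi>"
      by (simp add: \<psi>_def char_def integral_distr)
    finally show "char (distr (PiM J (\<lambda>_. G)) borel (\<lambda>y. X (y i) / sqrt n)) t = \<psi>" .
  qed
  also have "\<dots> = \<psi> ^ n" by (simp add: n_def)
  finally have eq: "char (distr (PiM J (\<lambda>_. G)) borel (\<lambda>y. (\<Sum>i\<in>J. X (y i)) / sqrt n)) t = \<psi> ^ n" .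
  have s2: "s\<^sup>2 = t\<^sup>2 / n" using J by (simp add: s_def power_divide)
  have "cmod (\<psi> - (1 - s\<^sup>2 * 1 / 2)) \<le> (s\<^sup>2 / 6) * (\<integral>z. min (6 * (X z)\<^sup>2) (\<bar>s\<bar> * \<bar>X z\<bar> ^ 3) \<partial>G)"
    unfolding \<psi>_def
    by (rule G.char_approx3'[OF X X1 X2 mean _ refl]) (simp add: mean var)
  \<comment> \<open>With w = |s| |X| the Taylor remainder is X^2 min(6, w), at most 6 X^2 min(1, w);
    the 6 cancels the prefactor 1/6.\<close>
  also have "\<dots> \<le> (s\<^sup>2 / 6) * (\<integral>z. 6 * ((X z)\<^sup>2 * min 1 (\<bar>X z\<bar> * \<bar>t\<bar> / sqrt n)) \<partial>G)"
  proof (intro mult_left_mono integral_mono)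
    show "integrable G (\<lambda>z. min (6 * (X z)\<^sup>2) (\<bar>s\<bar> * \<bar>X z\<bar> ^ 3))"
      by (rule Bochner_Integration.integrable_bound[of _ "\<lambda>z. 6 * (X z)\<^sup>2"]) (use X2 in auto)
    show "integrable G (\<lambda>z. 6 * ((X z)\<^sup>2 * min 1 (\<bar>X z\<bar> * \<bar>t\<bar> / sqrt n)))"
      by (rule Bochner_Integration.integrable_bound[of _ "\<lambda>z. 6 * (X z)\<^sup>2"])
        (use X2 in \<open>auto simp: abs_mult mult_left_le\<close>)
    fix z
    have "\<bar>s\<bar> * \<bar>X z\<bar> ^ 3 = (X z)\<^sup>2 * (\<bar>X z\<bar> * \<bar>t\<bar> / sqrt n)"
      by (simp add: s_def abs_divide power3_eq_cube power2_eq_square)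
    moreover have le: "min (6 * x) (x * w) \<le> 6 * (x * min 1 w)" if "0 \<le> x" "0 \<le> w" for x w :: real
    proof (cases "w \<le> 1")
      case True
      have "min (6 * x) (x * w) \<le> x * w" by simp
      also have "\<dots> \<le> 6 * (x * w)" using mult_nonneg_nonneg[OF that] by linarith
      finally show ?thesis using True by (simp add: min_absorb2)
    qed (simp add: min_absorb1)
    ultimately show "min (6 * (X z)\<^sup>2) (\<bar>s\<bar> * \<bar>X z\<bar> ^ 3) \<le> 6 * ((X z)\<^sup>2 * min 1 (\<bar>X z\<bar> * \<bar>t\<bar> / sqrt n))"
      using le[of "(X z)\<^sup>2" "\<bar>X z\<bar> * \<bar>t\<bar> / sqrt n"] by simp
  qed simp
  also have "\<dots> = s\<^sup>2 * (\<integral>z. (X z)\<^sup>2 * min 1 (\<bar>X z\<bar> * \<bar>t\<bar> / sqrt n) \<partial>G)" by simp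
  finally have "cmod (\<psi> - (1 - s\<^sup>2 * 1 / 2)) \<le> s\<^sup>2 * (\<integral>z. (X z)\<^sup>2 * min 1 (\<bar>X z\<bar> * \<bar>t\<bar> / sqrt n) \<partial>G)" .
  moreover have "1 - complex_of_real (s\<^sup>2) * 1 / 2 = complex_of_real (1 + (- (t\<^sup>2) / 2) / n)"
    by (simp add: s2 mult.commute[of 2])
  ultimately have psi: "cmod (\<psi> - complex_of_real (1 + (- (t\<^sup>2) / 2) / n))
      \<le> s\<^sup>2 * (\<integral>z. (X z)\<^sup>2 * min 1 (\<bar>X z\<bar> * \<bar>t\<bar> / sqrt n) \<partial>G)"
    by (simp add: ac_simps)
  have "cmod (\<psi> ^ n - (complex_of_real (1 + (- (t\<^sup>2) / 2) / n)) ^ n)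
      \<le> n * cmod (\<psi> - complex_of_real (1 + (- (t\<^sup>2) / 2) / n))"
    using n J by (intro norm_power_diff)
      (auto intro!: D.cmod_char_le_1 abs_leI
            simp del: of_real_diff simp: of_real_diff[symmetric] divide_le_eq \<psi>_def)
  also have "\<dots> \<le> n * (s\<^sup>2 * (\<integral>z. (X z)\<^sup>2 * min 1 (\<bar>X z\<bar> * \<bar>t\<bar> / sqrt n) \<partial>G))"
    by (rule mult_left_mono[OF psi]) simp
  also have "\<dots> = t\<^sup>2 * (\<integral>z. (X z)\<^sup>2 * min 1 (\<bar>X z\<bar> * \<bar>t\<bar> / sqrt n) \<partial>G)"
    using J by (simp add: s2)
  finally show ?thesis by (simp add: eq)
qed

section \<open>Regularity of the normal distribution function and uniform convergence to it\<close>

lemma cdf_std_normal_diff: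
  assumes "a \<le> b"
  shows "cdf std_normal_distribution b - cdf std_normal_distribution a
           = (LBINT x:{a<..b}. std_normal_density x)"
proof -
  interpret real_distribution std_normal_distribution by (rule real_dist_normal_dist)
  have "cdf std_normal_distribution b - cdf std_normal_distribution a
      = measure std_normal_distribution {a<..b}"
    using assms by (cases "a = b") (auto simp: cdf_diff_eq)
  also have "\<dots> = (\<integral>x. indicator {a<..b} x \<partial>std_normal_distribution)"
    by simp
  also have "\<dots> = (LBINT x:{a<..b}. std_normal_density x)"
    unfolding set_lebesgue_integral_def
    by (subst integral_density) (auto simp: ac_simps)
  finally show ?thesis .
qed

text \<open>Used with two choices of K: 1 everywhere, for the Lipschitz bound, and 1/T to the right
  of T/2, where the density has decayed.\<close>

lemma cdf_std_normal_diff_le: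
  assumes ab: "a \<le> b" and K: "\<And>x. a \<le> x \<Longrightarrow> std_normal_density x \<le> K"
  shows "cdf std_normal_distribution b - cdf std_normal_distribution a \<le> K * (b - a)"
proof -
  have "(LBINT x:{a<..b}. std_normal_density x) \<le> (LBINT x:{a<..b}. K)"
  proof (rule set_integral_mono)
    show "set_integrable lborel {a<..b} std_normal_density"
      unfolding set_integrable_def
      by (rule integrable_mult_indicator) (auto simp: integrable_normal_density)
    show "set_integrable lborel {a<..b} (\<lambda>x. K)"
      unfolding set_integrable_def by (use ab in \<open>simp add: integrable_indicator_iff\<close>)
  qed (use K in auto)
  also have "\<dots> = K * (b - a)"
    using ab unfolding set_lebesgue_integral_def by simp
  finally show ?thesis by (simp add: cdf_std_normal_diff[OF ab])
qed

lemma std_normal_density_le_1: "std_normal_density x \<le> 1"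
proof -
  have "1 \<le> sqrt (2 * pi)" using pi_gt3 by (simp add: real_le_rsqrt)
  then have "1 / sqrt (2 * pi) * exp (- (x\<^sup>2) / 2) \<le> 1 * 1"
    by (intro mult_mono) auto
  then show ?thesis by (simp add: std_normal_density_def)
qed

lemma isCont_cdf_std_normal: "isCont (cdf std_normal_distribution) x"
proof -
  interpret real_distribution std_normal_distribution by (rule real_dist_normal_dist)
  have "measure std_normal_distribution {x} = 0"
    by (simp add: measure_def emeasure_density nn_integral_indicator_singleton')
  then show ?thesis by (simp add: isCont_cdf)
qed

text \<open>Both distribution functions are monotone and the limit is 1-Lipschitz, so closeness on a finite
  grid suffices.\<close>

lemma weak_conv_std_normal_uniform:
  fixes M :: "nat \<Rightarrow> real measure"
  assumes M: "\<And>k. real_distribution (M k)" and conv: "weak_conv_m M std_normal_distribution"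
    and \<epsilon>: "0 < \<epsilon>"
  shows "\<forall>\<^sub>F k in sequentially. \<forall>u. \<bar>cdf (M k) u - cdf std_normal_distribution u\<bar> \<le> \<epsilon>"
proof -
  interpret N: real_distribution std_normal_distribution by (rule real_dist_normal_dist)
  let ?F = "cdf std_normal_distribution"
  have lim: "(\<lambda>k. cdf (M k) u) \<longlonglongrightarrow> ?F u" for u
    using conv isCont_cdf_std_normal by (auto simp: weak_conv_m_def weak_conv_def)
  \<comment> \<open>One half of \<epsilon> pays for the distance at a grid point, the other for the
    limit law: its increment over one cell, or its mass in a tail.\<close>
  define e where "e = \<epsilon> / 2"
  have e: "0 < e" using \<epsilon> by (simp add: e_def)
  obtain A where A: "\<And>x. A \<le> x \<Longrightarrow> 1 - e < ?F x"
    using order_tendstoD(1)[OF N.cdf_lim_at_top_prob, of "1 - e"] e by (auto simp: eventually_at_top_linorder)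
  obtain B where B: "\<And>x. x \<le> B \<Longrightarrow> ?F x < e"
    using order_tendstoD(2)[OF N.cdf_lim_at_bot, of e] e by (auto simp: eventually_at_bot_linorder)
  define N where "N = nat \<lceil>(max A B - B) / e\<rceil>"
  define g where "g j = B + e * real j" for j
  have gN: "A \<le> g N"
  proof -
    have "(max A B - B) / e \<le> real N" unfolding N_def by linarith
    then have "max A B - B \<le> e * real N" using e by (simp add: field_simps)
    then show ?thesis by (simp add: g_def)
  qed
  have "\<forall>\<^sub>F k in sequentially. \<forall>j\<in>{..N}. \<bar>cdf (M k) (g j) - ?F (g j)\<bar> < e"
  proof (intro eventually_ball_finite ballI)
    fix j
    show "\<forall>\<^sub>F k in sequentially. \<bar>cdf (M k) (g j) - ?F (g j)\<bar> < e"
      using tendstoD[OF lim e] by (simp add: dist_real_def)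
  qed simp
  then show ?thesis
  proof eventually_elim
    case (elim k)
    interpret Mk: real_distribution "M k" by (rule M)
    show ?case
    proof
      fix u
      have bd: "0 \<le> cdf (M k) u" "cdf (M k) u \<le> 1" "0 \<le> ?F u" "?F u \<le> 1"
        using Mk.cdf_nonneg Mk.cdf_bounded_prob N.cdf_nonneg N.cdf_bounded_prob by auto
      consider "u \<le> g 0" | "g N \<le> u" | "g 0 < u" "u < g N" by linarith
      then show "\<bar>cdf (M k) u - ?F u\<bar> \<le> \<epsilon>"
      proof cases
        case 1
        then have "?F u < e" "?F (g 0) < e" using B by (auto simp: g_def)
        moreover have "cdf (M k) u \<le> cdf (M k) (g 0)" by (rule Mk.cdf_nondecreasing[OF 1])
        moreover have "\<bar>cdf (M k) (g 0) - ?F (g 0)\<bar> < e" using elim by simp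
        ultimately show ?thesis using bd unfolding e_def by linarith
      next
        case 2
        then have "1 - e < ?F u" "1 - e < ?F (g N)" using A gN by auto
        moreover have "cdf (M k) (g N) \<le> cdf (M k) u" by (rule Mk.cdf_nondecreasing[OF 2])
        moreover have "\<bar>cdf (M k) (g N) - ?F (g N)\<bar> < e" using elim by simp
        ultimately show ?thesis using bd unfolding e_def by linarith
      next
        case 3
        \<comment> \<open>The grid cell that contains u; j < N ensures that its right end is still a
          grid point at which closeness is known.\<close>
        define j where "j = nat \<lfloor>(u - B) / e\<rfloor>"
        have pos: "0 \<le> (u - B) / e" using 3 e by (simp add: g_def)
        have j: "real j \<le> (u - B) / e" "(u - B) / e < real j + 1"
          using pos unfolding j_def by linarith+
        have gj: "g j \<le> u" "u \<le> g (Suc j)"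
          using j e by (simp_all add: g_def field_simps)
        have "j < N" using 3 gj e by (simp add: g_def) (smt (verit) mult_less_cancel_left_pos of_nat_less_iff)
        then have cl: "\<bar>cdf (M k) (g j) - ?F (g j)\<bar> < e" "\<bar>cdf (M k) (g (Suc j)) - ?F (g (Suc j))\<bar> < e"
          using elim by auto
        have mono: "cdf (M k) (g j) \<le> cdf (M k) u" "cdf (M k) u \<le> cdf (M k) (g (Suc j))"
          "?F (g j) \<le> ?F u" "?F u \<le> ?F (g (Suc j))"
          using gj Mk.cdf_nondecreasing N.cdf_nondecreasing by auto
        have "?F (g (Suc j)) - ?F (g j) \<le> 1 * (g (Suc j) - g j)"
          using e by (intro cdf_std_normal_diff_le std_normal_density_le_1) (simp add: g_def)
        also have "\<dots> = e" by (simp add: g_def algebra_simps)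
        finally show ?thesis using cl mono unfolding e_def by linarith
      qed
    qed
  qed
qed

text \<open>The threshold \<open>\<eta>\<close> is obtained by contradiction: a sequence of counterexamples for \<open>\<eta> = 1/k\<close>
  would converge weakly to the normal law by Levy's continuity theorem.\<close>

lemma uniform_central_limit:
  assumes \<epsilon>: "0 < (\<epsilon>::real)"
  shows "\<exists>\<eta>>0. \<forall>(G :: 'a measure) X (J :: 'i set) u.
     prob_space G \<longrightarrow> X \<in> borel_measurable G \<longrightarrow> integrable G (\<lambda>z. (X z)\<^sup>2) \<longrightarrow>
     (\<integral>z. X z \<partial>G) = 0 \<longrightarrow> (\<integral>z. (X z)\<^sup>2 \<partial>G) = 1 \<longrightarrow> finite J \<longrightarrow> 1 / \<eta> \<le> real (card J) \<longrightarrow>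
     (\<integral>z. (X z)\<^sup>2 * min 1 (\<bar>X z\<bar> / (\<eta> * sqrt (card J))) \<partial>G) \<le> \<eta> \<longrightarrow>
     \<bar>measure (PiM J (\<lambda>_. G)) {y \<in> space (PiM J (\<lambda>_. G)). (\<Sum>i\<in>J. X (y i)) / sqrt (card J) \<le> u}
        - cdf std_normal_distribution u\<bar> \<le> \<epsilon>"
proof (rule ccontr)
  define Bad where "Bad \<eta> G X J u \<longleftrightarrow>
     prob_space G \<and> X \<in> borel_measurable G \<and> integrable G (\<lambda>z. (X z)\<^sup>2) \<and>
     (\<integral>z. X z \<partial>G) = 0 \<and> (\<integral>z. (X z)\<^sup>2 \<partial>G) = 1 \<and> finite J \<and> 1 / \<eta> \<le> real (card J) \<and>
     (\<integral>z. (X z)\<^sup>2 * min 1 (\<bar>X z\<bar> / (\<eta> * sqrt (card J))) \<partial>G) \<le> \<eta> \<and>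
     \<not> \<bar>measure (PiM J (\<lambda>_. G)) {y \<in> space (PiM J (\<lambda>_. G)). (\<Sum>i\<in>J. X (y i)) / sqrt (card J) \<le> u}
        - cdf std_normal_distribution u\<bar> \<le> \<epsilon>"
    for \<eta> u and G :: "'a measure" and X and J :: "'i set"
  assume "\<not> ?thesis"
  then have "\<exists>G X J u. Bad \<eta> G X J u" if "0 < \<eta>" for \<eta>
    using that unfolding Bad_def by blast
  then have "\<forall>k::nat. \<exists>G X J u. Bad (1 / real (Suc k)) G X J u" by simp
  then obtain G X J u where bad: "\<And>k. Bad (1 / real (Suc k)) (G k) (X k) (J k) (u k)"
    by metis
  note b = bad[unfolded Bad_def]
  have G: "\<And>k. prob_space (G k)" and X: "\<And>k. X k \<in> borel_measurable (G k)"
    and X2: "\<And>k. integrable (G k) (\<lambda>z. (X k z)\<^sup>2)" and mean: "\<And>k. (\<integral>z. X k z \<partial>G k) = 0"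
    and var: "\<And>k. (\<integral>z. (X k z)\<^sup>2 \<partial>G k) = 1" and J: "\<And>k. finite (J k)"
    and n: "\<And>k. 1 / (1 / real (Suc k)) \<le> real (card (J k))"
    and lind: "\<And>k. (\<integral>z. (X k z)\<^sup>2 * min 1 (\<bar>X k z\<bar> / (1 / real (Suc k) * sqrt (card (J k)))) \<partial>G k) \<le> 1 / real (Suc k)"
    and bad: "\<And>k. \<not> \<bar>measure (PiM (J k) (\<lambda>_. G k)) {y \<in> space (PiM (J k) (\<lambda>_. G k)). (\<Sum>i\<in>J k. X k (y i)) / sqrt (card (J k)) \<le> u k}
        - cdf std_normal_distribution (u k)\<bar> \<le> \<epsilon>"
    using b by auto
  define n' where "n' k = card (J k)" for k
  have n': "real (Suc k) \<le> real (n' k)" for k using n[of k] by (simp add: n'_def)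
  have n'_top: "filterlim n' at_top sequentially"
  proof (rule filterlim_at_top_mono[OF filterlim_Suc])
    show "\<forall>\<^sub>F k in sequentially. Suc k \<le> n' k"
      using n' by (intro always_eventually) (simp only: of_nat_le_iff simp_thms)
  qed
  define M where "M k = distr (PiM (J k) (\<lambda>_. G k)) borel (\<lambda>y. (\<Sum>i\<in>J k. X k (y i)) / sqrt (n' k))" for k
  have M: "real_distribution (M k)" for k
    unfolding M_def by (rule real_distribution_normalized_sum[OF G X])
  have "weak_conv_m M std_normal_distribution"
  proof (rule levy_continuity[OF M real_dist_normal_dist])
    fix t :: real
    let ?L = "\<lambda>k. \<integral>z. (X k z)\<^sup>2 * min 1 (\<bar>X k z\<bar> * \<bar>t\<bar> / sqrt (n' k)) \<partial>G k"
    \<comment> \<open>Once k+1 \<ge> |t|, the truncation in \<open>char_normalized_sum\<close> is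
      dominated by that of the k-th counterexample, whose functional is at most 1/(k+1). The bound
      t^2/4 \<le> k+1, with k+1 at most the block size, supplies the size condition of that
      lemma.\<close>
    have "\<forall>\<^sub>F k in sequentially. max \<bar>t\<bar> (t\<^sup>2 / 4) \<le> real (Suc k)"
      using filterlim_real_sequentially[THEN filterlim_compose, OF filterlim_Suc]
      unfolding filterlim_at_top by blast
    then have ev: "\<forall>\<^sub>F k in sequentially. norm (char (M k) t - complex_of_real ((1 + (- (t\<^sup>2) / 2) / n' k) ^ n' k))
        \<le> t\<^sup>2 * (1 / real (Suc k))"
    proof eventually_elim
      case (elim k)
      have pos: "0 < n' k" using n'[of k] by linarith
      have int: "integrable (G k) (\<lambda>z. (X k z)\<^sup>2 * min 1 (\<bar>X k z\<bar> * c))" if "0 \<le> c" for c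
        using X[of k] X2[of k] that
        by (intro Bochner_Integration.integrable_bound[OF X2[of k]]) (auto simp: abs_mult mult_left_le)
      have "?L k \<le> (\<integral>z. (X k z)\<^sup>2 * min 1 (\<bar>X k z\<bar> / (1 / real (Suc k) * sqrt (n' k))) \<partial>G k)"
      proof (rule integral_mono)
        show "integrable (G k) (\<lambda>z. (X k z)\<^sup>2 * min 1 (\<bar>X k z\<bar> * \<bar>t\<bar> / sqrt (n' k)))"
          using int[of "\<bar>t\<bar> / sqrt (n' k)"] by simp
        show "integrable (G k) (\<lambda>z. (X k z)\<^sup>2 * min 1 (\<bar>X k z\<bar> / (1 / real (Suc k) * sqrt (n' k))))"
          using int[of "1 / (1 / real (Suc k) * sqrt (n' k))"] by simp
        fix z
        have "\<bar>X k z\<bar> * \<bar>t\<bar> / sqrt (n' k) \<le> \<bar>X k z\<bar> * real (Suc k) / sqrt (n' k)"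
          using elim by (intro divide_right_mono mult_left_mono) auto
        then show "(X k z)\<^sup>2 * min 1 (\<bar>X k z\<bar> * \<bar>t\<bar> / sqrt (n' k))
            \<le> (X k z)\<^sup>2 * min 1 (\<bar>X k z\<bar> / (1 / real (Suc k) * sqrt (n' k)))"
          by (intro mult_left_mono min.mono) auto
      qed
      also have "\<dots> \<le> 1 / real (Suc k)" using lind[of k] by (simp add: n'_def)
      finally have L: "?L k \<le> 1 / real (Suc k)" .
      have "norm (char (M k) t - complex_of_real ((1 + (- (t\<^sup>2) / 2) / n' k) ^ n' k)) \<le> t\<^sup>2 * ?L k"
        unfolding M_def n'_def
        by (rule char_normalized_sum[OF G X X2 mean var J])
          (use pos elim n'[of k] in \<open>auto simp: n'_def\<close>)
      also have "\<dots> \<le> t\<^sup>2 * (1 / real (Suc k))" by (rule mult_left_mono[OF L]) simp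
      finally show ?case .
    qed
    have "(\<lambda>k. t\<^sup>2 * (1 / real (Suc k))) \<longlonglongrightarrow> t\<^sup>2 * 0"
      by (intro tendsto_mult tendsto_const) (rule LIMSEQ_Suc[OF lim_1_over_n])
    then have null: "(\<lambda>k. char (M k) t - complex_of_real ((1 + (- (t\<^sup>2) / 2) / n' k) ^ n' k)) \<longlonglongrightarrow> 0"
      by (intro Lim_null_comparison[OF ev]) simp
    have "(\<lambda>n. complex_of_real ((1 + (- (t\<^sup>2) / 2) / real n) ^ n)) \<longlonglongrightarrow> complex_of_real (exp (- (t\<^sup>2) / 2))"
      by (rule isCont_tendsto_compose[OF _ tendsto_exp_limit_sequentially]) auto
    from filterlim_compose[OF this n'_top]
    have "(\<lambda>k. complex_of_real ((1 + (- (t\<^sup>2) / 2) / n' k) ^ n' k)) \<longlonglongrightarrow> complex_of_real (exp (- (t\<^sup>2) / 2))"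
      by simp
    then have "(\<lambda>k. char (M k) t) \<longlonglongrightarrow> complex_of_real (exp (- (t\<^sup>2) / 2))"
      by (rule Lim_transform) (rule null)
    then show "(\<lambda>k. char (M k) t) \<longlonglongrightarrow> char std_normal_distribution t"
      by (simp add: char_std_normal_distribution)
  qed
  from weak_conv_std_normal_uniform[OF M this \<epsilon>]
  obtain k where "\<forall>u. \<bar>cdf (M k) u - cdf std_normal_distribution u\<bar> \<le> \<epsilon>"
    using eventually_happens by force
  moreover have "cdf (M k) (u k) = measure (PiM (J k) (\<lambda>_. G k))
      {y \<in> space (PiM (J k) (\<lambda>_. G k)). (\<Sum>i\<in>J k. X k (y i)) / sqrt (card (J k)) \<le> u k}"
  proof -
    note [measurable] = X[of k]
    show ?thesis unfolding cdf_def M_def n'_def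
      by (subst measure_distr) (auto intro!: arg_cong[where f="measure _"])
  qed
  ultimately show False using bad[of k] by metis
qed

section \<open>Square-integrable approximation of the log-likelihood ratio\<close>

lemma nn_integral_powr_le_Lq_norm:
  assumes p: "0 < p" and c: "0 \<le> c" and le: "Lq_norm M (ereal p) f \<le> ennreal c"
  shows "(\<integral>\<^sup>+ z. ennreal (\<bar>f z\<bar> powr p) \<partial>M) \<le> ennreal (c powr p)"
proof -
  define I where "I = (\<integral>\<^sup>+ z. ennreal (\<bar>f z\<bar> powr p) \<partial>M)"
  have eq: "Lq_norm M (ereal p) f = (if I = \<infinity> then \<infinity> else ennreal (enn2real I powr (1 / p)))"
    by (simp add: Lq_norm_def I_def)
  have fin: "I \<noteq> \<infinity>" using le by (auto simp: eq top_unique)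
  then have "enn2real I powr (1 / p) \<le> c" using le c by (simp add: eq)
  then have "(enn2real I powr (1 / p)) powr p \<le> c powr p" using p by (intro powr_mono2) auto
  then have "enn2real I \<le> c powr p" using p by (simp add: powr_powr)
  then have "ennreal (enn2real I) \<le> ennreal (c powr p)" by (rule ennreal_leI)
  moreover have "ennreal (enn2real I) = I" using fin by (intro ennreal_enn2real) (simp add: less_top)
  ultimately show ?thesis unfolding I_def[symmetric] by metis
qed

text \<open>Hoelder's inequality for 1/2 = 1/p + (p-2)/(2p), with constant 1. For p > 2 the
  functions are scaled by A and B, and Young's inequality with the conjugate exponents p/2 and
  p/(p-2) is applied to their squares, pointwise; the two integrals then contribute 1/r + 1/s = 1.
  For p = 2 the second norm is the essential supremum.\<close>

lemma nn_integral_power2_mult_le_Lq_norm: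
  fixes f g :: "'a \<Rightarrow> real"
  assumes p: "2 \<le> p" and [measurable]: "f \<in> borel_measurable M" "g \<in> borel_measurable M"
    and A: "0 < A" and B: "0 \<le> B"
    and f: "Lq_norm M (ereal p) f \<le> ennreal A"
    and g: "Lq_norm M (ereal (2 * p) / ereal (p - 2)) g \<le> ennreal B"
  shows "(\<integral>\<^sup>+ z. ennreal ((f z * g z)\<^sup>2) \<partial>M) \<le> ennreal ((A * B)\<^sup>2)"
proof (cases "p = 2")
  case True
  have "esssup M (\<lambda>z. ennreal \<bar>g z\<bar>) \<le> ennreal B"
    using g True by (simp add: Lq_norm_def)
  moreover have "AE z in M. ennreal \<bar>g z\<bar> \<le> esssup M (\<lambda>z. ennreal \<bar>g z\<bar>)" by (rule esssup_AE)
  ultimately have "AE z in M. \<bar>g z\<bar> \<le> B"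
    by (auto elim!: eventually_mono intro: order_trans simp: B simp flip: ennreal_le_iff)
  then have "AE z in M. ennreal ((f z * g z)\<^sup>2) \<le> ennreal (B\<^sup>2) * ennreal (\<bar>f z\<bar> powr p)"
  proof eventually_elim
    case (elim z)
    have "(g z)\<^sup>2 \<le> B\<^sup>2" using elim by (simp add: abs_le_square_iff[symmetric] B)
    then have "(f z * g z)\<^sup>2 \<le> B\<^sup>2 * (f z)\<^sup>2"
      by (simp add: power_mult_distrib mult.commute[of "B\<^sup>2"] mult_left_mono)
    also have "(f z)\<^sup>2 = \<bar>f z\<bar> powr p" using True by (simp add: powr_numeral)
    finally show ?case by (simp add: ennreal_mult[symmetric] ennreal_leI)
  qed
  then have "(\<integral>\<^sup>+ z. ennreal ((f z * g z)\<^sup>2) \<partial>M) \<le> (\<integral>\<^sup>+ z. ennreal (B\<^sup>2) * ennreal (\<bar>f z\<bar> powr p) \<partial>M)"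
    by (rule nn_integral_mono_AE)
  also have "\<dots> = ennreal (B\<^sup>2) * (\<integral>\<^sup>+ z. ennreal (\<bar>f z\<bar> powr p) \<partial>M)"
    by (rule nn_integral_cmult) simp
  also have "\<dots> \<le> ennreal (B\<^sup>2) * ennreal (A powr p)"
    using nn_integral_powr_le_Lq_norm[OF _ _ f] p A by (intro mult_left_mono) auto
  also have "\<dots> = ennreal ((A * B)\<^sup>2)"
    using A True by (simp add: ennreal_mult[symmetric] powr_numeral power_mult_distrib mult.commute)
  finally show ?thesis .
next
  case False
  with p have p2: "2 < p" by simp
  define q where "q = 2 * p / (p - 2)"
  have q: "0 < q" using p2 by (simp add: q_def)
  have If: "(\<integral>\<^sup>+ z. ennreal (\<bar>f z\<bar> powr p) \<partial>M) \<le> ennreal (A powr p)"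
    using nn_integral_powr_le_Lq_norm[OF _ _ f] p A by simp
  have Ig: "(\<integral>\<^sup>+ z. ennreal (\<bar>g z\<bar> powr q) \<partial>M) \<le> ennreal (B powr q)"
    using nn_integral_powr_le_Lq_norm[OF q B, of M g] g p2 by (simp add: q_def)
  show ?thesis
  \<comment> \<open>Scaling by B is impossible here, but then g vanishes almost everywhere.\<close>
  proof (cases "B = 0")
    case True
    then have "(\<integral>\<^sup>+ z. ennreal (\<bar>g z\<bar> powr q) \<partial>M) = 0" using Ig by simp
    then have "AE z in M. ennreal (\<bar>g z\<bar> powr q) = 0" by (subst (asm) nn_integral_0_iff_AE) auto
    then have "AE z in M. ennreal ((f z * g z)\<^sup>2) = 0"
      by eventually_elim (simp add: ennreal_eq_0_iff)
    then have "(\<integral>\<^sup>+ z. ennreal ((f z * g z)\<^sup>2) \<partial>M) = 0"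
      by (subst nn_integral_0_iff_AE) auto
    then show ?thesis by simp
  next
    case False
    with B have B: "0 < B" by simp
    define r where "r = p / 2"
    define s where "s = p / (p - 2)"
    have rs: "1 < r" "1 < s" "1 / r + 1 / s = 1"
      using p2 by (simp_all add: r_def s_def field_simps)
    have young: "(f z * g z)\<^sup>2 \<le> (A * B)\<^sup>2 / (r * A powr p) * \<bar>f z\<bar> powr p + (A * B)\<^sup>2 / (s * B powr q) * \<bar>g z\<bar> powr q" for z
    proof -
      define x where "x = \<bar>f z\<bar> / A"
      define y where "y = \<bar>g z\<bar> / B"
      have xy: "0 \<le> x" "0 \<le> y" using A B by (auto simp: x_def y_def)
      have "x\<^sup>2 * y\<^sup>2 \<le> (x\<^sup>2) powr r / r + (y\<^sup>2) powr s / s"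
        by (rule Youngs_inequality[OF rs]) auto
      also have "(x\<^sup>2) powr r = x powr p"
        using xy p2 by (simp add: powr_numeral[symmetric] powr_powr r_def del: powr_numeral)
      also have "(y\<^sup>2) powr s = y powr q"
        using xy p2 by (simp add: powr_numeral[symmetric] powr_powr s_def q_def del: powr_numeral)
      finally have le: "x\<^sup>2 * y\<^sup>2 \<le> x powr p / r + y powr q / s" .
      have "(f z * g z)\<^sup>2 = (A * B)\<^sup>2 * (x\<^sup>2 * y\<^sup>2)"
        using A B by (simp add: x_def y_def power_divide power_mult_distrib)
      also have "\<dots> \<le> (A * B)\<^sup>2 * (x powr p / r + y powr q / s)"
        by (rule mult_left_mono[OF le]) simp
      also have "x powr p = \<bar>f z\<bar> powr p / A powr p" using A by (simp add: x_def powr_divide)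
      also have "y powr q = \<bar>g z\<bar> powr q / B powr q" using B by (simp add: y_def powr_divide)
      finally show ?thesis by (simp add: field_simps)
    qed
    have nn: "0 \<le> (A * B)\<^sup>2 / (r * A powr p)" "0 \<le> (A * B)\<^sup>2 / (s * B powr q)"
      using rs by auto
    have "(\<integral>\<^sup>+ z. ennreal ((f z * g z)\<^sup>2) \<partial>M)
        \<le> (\<integral>\<^sup>+ z. ennreal ((A * B)\<^sup>2 / (r * A powr p)) * ennreal (\<bar>f z\<bar> powr p)
                + ennreal ((A * B)\<^sup>2 / (s * B powr q)) * ennreal (\<bar>g z\<bar> powr q) \<partial>M)"
    proof (rule nn_integral_mono)
      fix z
      show "ennreal ((f z * g z)\<^sup>2) \<le> ennreal ((A * B)\<^sup>2 / (r * A powr p)) * ennreal (\<bar>f z\<bar> powr p)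
                + ennreal ((A * B)\<^sup>2 / (s * B powr q)) * ennreal (\<bar>g z\<bar> powr q)"
        using young[of z] nn by (simp only: ennreal_mult[symmetric] powr_ge_zero ennreal_plus[symmetric] mult_nonneg_nonneg ennreal_leI)
    qed
    also have "\<dots> = ennreal ((A * B)\<^sup>2 / (r * A powr p)) * (\<integral>\<^sup>+ z. ennreal (\<bar>f z\<bar> powr p) \<partial>M)
        + ennreal ((A * B)\<^sup>2 / (s * B powr q)) * (\<integral>\<^sup>+ z. ennreal (\<bar>g z\<bar> powr q) \<partial>M)"
      by (simp add: nn_integral_add nn_integral_cmult)
    also have "\<dots> \<le> ennreal ((A * B)\<^sup>2 / (r * A powr p)) * ennreal (A powr p)
        + ennreal ((A * B)\<^sup>2 / (s * B powr q)) * ennreal (B powr q)"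
      by (intro add_mono mult_left_mono If Ig) auto
    also have "\<dots> = ennreal ((A * B)\<^sup>2 / (r * A powr p) * A powr p + (A * B)\<^sup>2 / (s * B powr q) * B powr q)"
      using nn by (simp only: ennreal_mult[symmetric] powr_ge_zero ennreal_plus[symmetric] mult_nonneg_nonneg)
    also have "(A * B)\<^sup>2 / (r * A powr p) * A powr p + (A * B)\<^sup>2 / (s * B powr q) * B powr q
        = (A * B)\<^sup>2 * (1 / r + 1 / s)"
      using A B rs by (simp add: field_simps)
    finally show ?thesis using rs by simp
  qed
qed

text \<open>With y = w/2, the bounds 1 + y \<le> exp y and 1 - y \<le> exp (-y) squeeze exp y - 1 -
  y between 0 and (exp y - 1) y, a product of two factors of equal sign. The estimate is global in
  w, so large log-ratios are covered without truncation.\<close>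

lemma abs_diff_two_expm1_half_le:
  fixes w :: real
  shows "\<bar>w - 2 * (exp (w / 2) - 1)\<bar> \<le> \<bar>exp (w / 2) - 1\<bar> * \<bar>w\<bar>"
proof -
  define y where "y = w / 2"
  have "exp y * (1 - y) \<le> exp y * exp (- y)"
    using exp_ge_add_one_self[of "- y"] by (intro mult_left_mono) auto
  also have "\<dots> = 1" by (simp add: exp_minus)
  finally have "exp y - 1 - y \<le> (exp y - 1) * y" by (simp add: algebra_simps)
  moreover have "0 \<le> exp y - 1 - y" using exp_ge_add_one_self[of y] by linarith
  moreover have "(exp y - 1) * y = \<bar>exp y - 1\<bar> * \<bar>y\<bar>"
    by (cases "0 \<le> y") (auto simp: algebra_simps)
  ultimately have "\<bar>y - (exp y - 1)\<bar> \<le> \<bar>exp y - 1\<bar> * \<bar>y\<bar>" by linarith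
  then show ?thesis by (simp add: y_def abs_if split: if_splits)
qed

lemma power2_sum3_le: "(x + y + z)\<^sup>2 \<le> 3 * (x\<^sup>2 + y\<^sup>2 + z\<^sup>2)" for x y z :: real
proof -
  have "0 \<le> (x - y)\<^sup>2 + (y - z)\<^sup>2 + (x - z)\<^sup>2" by simp
  then show ?thesis by (simp add: power2_eq_square algebra_simps)
qed

text \<open>Since R = X/2 + Q, the error W - X splits into terms of size |X W|/2, |Q W| and 2|Q|.
  The two products go to Hoelder's inequality, the last one to the quadratic mean bound. Squaring
  three terms costs a factor 3, giving 3/4, 3 and 12; the first two are merged and rounded up to
  4.\<close>

lemma log_linear_L2_close:
  fixes W X Q :: "'a \<Rightarrow> real"
  assumes p: "2 \<le> p"
    and [measurable]: "W \<in> borel_measurable M" "X \<in> borel_measurable M" "Q \<in> borel_measurable M"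
    and root: "AE z in M. exp (W z / 2) - 1 = X z / 2 + Q z"
    and A: "0 < A" and B: "0 \<le> B" and D: "0 \<le> D"
    and X: "Lq_norm M (ereal p) X \<le> ennreal A"
    and Q: "Lq_norm M (ereal p) Q \<le> ennreal A"
    and W: "Lq_norm M (ereal (2 * p) / ereal (p - 2)) W \<le> ennreal B"
    and Q2: "(\<integral>\<^sup>+ z. ennreal ((Q z)\<^sup>2) \<partial>M) \<le> ennreal D"
  shows "(\<integral>\<^sup>+ z. ennreal ((W z - X z)\<^sup>2) \<partial>M) \<le> ennreal (4 * (A * B)\<^sup>2 + 12 * D)"
proof -
  have "AE z in M. ennreal ((W z - X z)\<^sup>2)
      \<le> ennreal (3 / 4) * ennreal ((X z * W z)\<^sup>2) + 3 * ennreal ((Q z * W z)\<^sup>2) + 12 * ennreal ((Q z)\<^sup>2)"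
    using root
  proof eventually_elim
    case (elim z)
    define R where "R = exp (W z / 2) - 1"
    have "\<bar>W z - X z\<bar> \<le> \<bar>W z - 2 * R\<bar> + 2 * \<bar>Q z\<bar>" using elim unfolding R_def[symmetric] by linarith
    also have "\<bar>W z - 2 * R\<bar> \<le> \<bar>R\<bar> * \<bar>W z\<bar>" unfolding R_def by (rule abs_diff_two_expm1_half_le)
    also have "\<dots> \<le> (\<bar>X z\<bar> / 2 + \<bar>Q z\<bar>) * \<bar>W z\<bar>"
      using elim unfolding R_def[symmetric] by (intro mult_right_mono) linarith+
    finally have "\<bar>W z - X z\<bar> \<le> \<bar>X z * W z\<bar> / 2 + \<bar>Q z * W z\<bar> + 2 * \<bar>Q z\<bar>"
      by (simp add: algebra_simps abs_mult)
    then have "\<bar>W z - X z\<bar>\<^sup>2 \<le> (\<bar>X z * W z\<bar> / 2 + \<bar>Q z * W z\<bar> + 2 * \<bar>Q z\<bar>)\<^sup>2"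
      by (rule power_mono) simp
    also have "\<dots> \<le> 3 * ((\<bar>X z * W z\<bar> / 2)\<^sup>2 + \<bar>Q z * W z\<bar>\<^sup>2 + (2 * \<bar>Q z\<bar>)\<^sup>2)"
      by (rule power2_sum3_le)
    also have "\<dots> = 3 / 4 * (X z * W z)\<^sup>2 + 3 * (Q z * W z)\<^sup>2 + 12 * (Q z)\<^sup>2"
      by (simp add: power_divide power_mult_distrib)
    finally have "ennreal ((W z - X z)\<^sup>2) \<le> ennreal (3 / 4 * (X z * W z)\<^sup>2 + 3 * (Q z * W z)\<^sup>2 + 12 * (Q z)\<^sup>2)"
      by (intro ennreal_leI) simp
    then show ?case by (simp add: ennreal_mult[symmetric] ennreal_plus[symmetric] ennreal_numeral[symmetric] del: ennreal_plus ennreal_numeral)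
  qed
  then have "(\<integral>\<^sup>+ z. ennreal ((W z - X z)\<^sup>2) \<partial>M)
      \<le> (\<integral>\<^sup>+ z. ennreal (3 / 4) * ennreal ((X z * W z)\<^sup>2) + 3 * ennreal ((Q z * W z)\<^sup>2) + 12 * ennreal ((Q z)\<^sup>2) \<partial>M)"
    by (rule nn_integral_mono_AE)
  also have "\<dots> = ennreal (3 / 4) * (\<integral>\<^sup>+ z. ennreal ((X z * W z)\<^sup>2) \<partial>M)
      + 3 * (\<integral>\<^sup>+ z. ennreal ((Q z * W z)\<^sup>2) \<partial>M) + 12 * (\<integral>\<^sup>+ z. ennreal ((Q z)\<^sup>2) \<partial>M)"
    by (simp add: nn_integral_add nn_integral_cmult)
  also have "\<dots> \<le> ennreal (3 / 4) * ennreal ((A * B)\<^sup>2) + 3 * ennreal ((A * B)\<^sup>2) + 12 * ennreal D"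
    using nn_integral_power2_mult_le_Lq_norm[OF p _ _ A B X W] nn_integral_power2_mult_le_Lq_norm[OF p _ _ A B Q W]
    by (intro add_mono mult_left_mono Q2) auto
  also have "\<dots> = ennreal (3 / 4 * (A * B)\<^sup>2 + 3 * (A * B)\<^sup>2 + 12 * D)"
    using D by (simp add: ennreal_mult[symmetric] ennreal_plus[symmetric] ennreal_numeral[symmetric] del: ennreal_plus ennreal_numeral)
  also have "\<dots> \<le> ennreal (4 * (A * B)\<^sup>2 + 12 * D)" by (intro ennreal_leI) simp
  finally show ?thesis .
qed

text \<open>Both E and d are relative to a. The cross term 2X(W - X) contributes 2E to the relative
  error of the second moment, the square of W - X at most E^2 \<le> E, and the squared mean
  d^2.\<close>

lemma (in prob_space)
  fixes W X :: "'a \<Rightarrow> real"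
  assumes [measurable]: "W \<in> borel_measurable M" "X \<in> borel_measurable M"
    and X2: "integrable M (\<lambda>z. (X z)\<^sup>2)" "(\<integral>z. (X z)\<^sup>2 \<partial>M) = a\<^sup>2" and a: "0 < a"
    and close: "(\<integral>\<^sup>+ z. ennreal ((W z - X z)\<^sup>2) \<partial>M) \<le> ennreal ((a * E)\<^sup>2)" and E: "0 < E" "E \<le> 1"
    and mean: "\<bar>\<integral>z. W z \<partial>M\<bar> \<le> d * a"
  shows integrable_power2_of_close: "integrable M (\<lambda>z. (W z)\<^sup>2)"
    and integral_diff_power2_of_close: "integrable M (\<lambda>z. (W z - X z)\<^sup>2)" "(\<integral>z. (W z - X z)\<^sup>2 \<partial>M) \<le> (a * E)\<^sup>2"
    and sd_ratio_of_close: "\<bar>sqrt (variance W) / a - 1\<bar> \<le> 3 * E + d\<^sup>2"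
proof -
  have iD: "integrable M (\<lambda>z. (W z - X z)\<^sup>2)"
    by (rule integrableI_nonneg) (use le_less_trans[OF close ennreal_less_top] in auto)
  then show "integrable M (\<lambda>z. (W z - X z)\<^sup>2)" .
  have D: "(\<integral>z. (W z - X z)\<^sup>2 \<partial>M) \<le> (a * E)\<^sup>2"
    using close iD by (simp add: nn_integral_eq_integral)
  then show "(\<integral>z. (W z - X z)\<^sup>2 \<partial>M) \<le> (a * E)\<^sup>2" .
  \<comment> \<open>The weight E balances the two sides: after integration each is at most E
    a^2.\<close>
  have amgm: "\<bar>2 * (X z * (W z - X z))\<bar> \<le> E * (X z)\<^sup>2 + (W z - X z)\<^sup>2 / E" for z
  proof -
    define x y where "x = sqrt E * \<bar>X z\<bar>" and "y = \<bar>W z - X z\<bar> / sqrt E"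
    have "0 \<le> (x - y)\<^sup>2" by simp
    then have "2 * (x * y) \<le> x\<^sup>2 + y\<^sup>2" by (simp add: power2_eq_square algebra_simps)
    then show ?thesis using E by (simp add: x_def y_def power_mult_distrib power_divide abs_mult)
  qed
  have ib: "integrable M (\<lambda>z. E * (X z)\<^sup>2 + (W z - X z)\<^sup>2 / E)" using X2 iD by simp
  have iXD: "integrable M (\<lambda>z. 2 * (X z * (W z - X z)))"
    by (rule Bochner_Integration.integrable_bound[OF ib]) (use amgm E in \<open>auto intro: order_trans[OF _ abs_ge_self]\<close>)
  have W2: "(W z)\<^sup>2 = (X z)\<^sup>2 + (W z - X z)\<^sup>2 + 2 * (X z * (W z - X z))" for z
    by (simp add: power2_eq_square algebra_simps)
  show iW: "integrable M (\<lambda>z. (W z)\<^sup>2)"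
    unfolding W2 using X2 iD iXD by simp
  have "\<bar>\<integral>z. 2 * (X z * (W z - X z)) \<partial>M\<bar> \<le> (\<integral>z. E * (X z)\<^sup>2 + (W z - X z)\<^sup>2 / E \<partial>M)"
    by (rule order_trans[OF integral_abs_bound]) (intro integral_mono integrable_abs iXD ib amgm)
  also have "\<dots> = E * a\<^sup>2 + (\<integral>z. (W z - X z)\<^sup>2 \<partial>M) / E" using X2 iD by simp
  also have "\<dots> \<le> E * a\<^sup>2 + (a * E)\<^sup>2 / E" using D E by (intro add_left_mono divide_right_mono) auto
  also have "\<dots> = 2 * E * a\<^sup>2" using E by (simp add: power2_eq_square)
  finally have cross: "\<bar>\<integral>z. 2 * (X z * (W z - X z)) \<partial>M\<bar> \<le> 2 * E * a\<^sup>2" .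
  have "(\<integral>z. (W z)\<^sup>2 \<partial>M) = a\<^sup>2 + (\<integral>z. (W z - X z)\<^sup>2 \<partial>M) + (\<integral>z. 2 * (X z * (W z - X z)) \<partial>M)"
    unfolding W2 using X2 iD iXD by simp
  moreover have "0 \<le> (\<integral>z. (W z - X z)\<^sup>2 \<partial>M)" by simp
  moreover have "(a * E)\<^sup>2 \<le> E * a\<^sup>2"
  proof -
    have "(a * E)\<^sup>2 = E * E * a\<^sup>2" by (simp add: power2_eq_square)
    also have "\<dots> \<le> E * 1 * a\<^sup>2" using E by (intro mult_right_mono mult_left_mono) auto
    finally show ?thesis by simp
  qed
  ultimately have second: "\<bar>(\<integral>z. (W z)\<^sup>2 \<partial>M) - a\<^sup>2\<bar> \<le> 3 * E * a\<^sup>2"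
    using D cross by linarith
  have iW1: "integrable M W" by (rule square_integrable_imp_integrable) (use iW in auto)
  have "(\<integral>z. W z \<partial>M)\<^sup>2 \<le> (d * a)\<^sup>2" using mean by (metis abs_le_square_iff abs_of_nonneg order_trans abs_ge_zero)
  moreover have "variance W = (\<integral>z. (W z)\<^sup>2 \<partial>M) - (\<integral>z. W z \<partial>M)\<^sup>2"
    by (rule variance_eq[OF iW1 iW])
  moreover have "0 \<le> (\<integral>z. W z \<partial>M)\<^sup>2" by simp
  ultimately have "\<bar>variance W - a\<^sup>2\<bar> \<le> (3 * E + d\<^sup>2) * a\<^sup>2"
  proof -
    assume *: "(\<integral>z. W z \<partial>M)\<^sup>2 \<le> (d * a)\<^sup>2" "variance W = (\<integral>z. (W z)\<^sup>2 \<partial>M) - (\<integral>z. W z \<partial>M)\<^sup>2"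
      "0 \<le> (\<integral>z. W z \<partial>M)\<^sup>2"
    have "(3 * E + d\<^sup>2) * a\<^sup>2 = 3 * E * a\<^sup>2 + (d * a)\<^sup>2"
      by (simp add: power_mult_distrib algebra_simps)
    then show ?thesis using second * by linarith
  qed
  then have "\<bar>variance W - a\<^sup>2\<bar> / a\<^sup>2 \<le> 3 * E + d\<^sup>2" using a by (simp add: pos_divide_le_eq)
  moreover define s where "s = sqrt (variance W) / a"
  have s: "0 \<le> s" "s\<^sup>2 = variance W / a\<^sup>2" using a by (auto simp: s_def power_divide)
  have "s\<^sup>2 - 1 = (variance W - a\<^sup>2) / a\<^sup>2" using a s by (simp add: diff_divide_distrib)
  \<comment> \<open>For s \<ge> 0 the factor s + 1 is at least 1, so passing from variance to
    standard deviation does not worsen the rate.\<close>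
  moreover have "\<bar>s - 1\<bar> \<le> \<bar>s\<^sup>2 - 1\<bar>"
  proof -
    have "\<bar>s\<^sup>2 - 1\<bar> = \<bar>s - 1\<bar> * \<bar>s + 1\<bar>" by (simp add: abs_mult[symmetric] power2_eq_square algebra_simps)
    moreover have "\<bar>s - 1\<bar> * 1 \<le> \<bar>s - 1\<bar> * \<bar>s + 1\<bar>" using s by (intro mult_left_mono) auto
    ultimately show ?thesis by simp
  qed
  ultimately show "\<bar>sqrt (variance W) / a - 1\<bar> \<le> 3 * E + d\<^sup>2"
    by (simp add: s_def abs_divide)
qed

section \<open>Normal approximation and standardisation\<close>

text \<open>The Gaussian factor at T/2 is exp(-T^2/8), and exp(T^2/8) \<ge> 1 + T^2/8 \<ge> T/2. The
  remaining factor 1/2 comes from sqrt(2 pi) \<ge> 2.\<close>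

lemma std_normal_density_le_inverse:
  assumes T: "0 < T" and x: "T / 2 \<le> x"
  shows "std_normal_density x \<le> 1 / T"
proof -
  have "T\<^sup>2 / 8 \<le> x\<^sup>2 / 2"
    using power_mono[OF x, of 2] T by (simp add: power_divide)
  then have "exp (- (x\<^sup>2) / 2) \<le> exp (- (T\<^sup>2 / 8))" by simp
  also have "\<dots> \<le> 2 / T"
  proof -
    have "0 \<le> (T - 2)\<^sup>2" by simp
    then have "T / 2 \<le> 1 + T\<^sup>2 / 8" by (simp add: power2_eq_square algebra_simps)
    also have "\<dots> \<le> exp (T\<^sup>2 / 8)" by (rule exp_ge_add_one_self)
    finally have "T / 2 \<le> exp (T\<^sup>2 / 8)" .
    then have "inverse (exp (T\<^sup>2 / 8)) \<le> inverse (T / 2)" using T by (intro le_imp_inverse_le) auto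
    then show ?thesis by (simp add: exp_minus)
  qed
  finally have e: "exp (- (x\<^sup>2) / 2) \<le> 2 / T" .
  have "2 \<le> sqrt (2 * pi)" using pi_gt3 by (simp add: real_le_rsqrt)
  then have "1 / sqrt (2 * pi) * exp (- (x\<^sup>2) / 2) \<le> 1 / 2 * (2 / T)"
    using e by (intro mult_mono) (auto simp: field_simps)
  then show ?thesis by (simp add: std_normal_density_def)
qed

text \<open>Since \<eta> \<le> 1/2, the interval between t and T stays to the right of T/2, where
  the density is at most 1/T. Its length is at most \<eta> T, so T cancels and thresholds of every
  size are treated alike.\<close>

lemma cdf_std_normal_relative_error:
  assumes T: "0 < T" and t: "\<bar>t - T\<bar> \<le> \<eta> * T" and \<eta>: "\<eta> \<le> 1 / 2"
  shows "\<bar>cdf std_normal_distribution t - cdf std_normal_distribution T\<bar> \<le> \<eta>"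
proof -
  interpret real_distribution std_normal_distribution by (rule real_dist_normal_dist)
  have half: "T / 2 \<le> min t T"
  proof -
    have "\<eta> * T \<le> 1 / 2 * T" using T \<eta> by (intro mult_right_mono) auto
    then have "T / 2 \<le> t" using t by linarith
    then show ?thesis using T by simp
  qed
  have "cdf std_normal_distribution (max t T) - cdf std_normal_distribution (min t T)
      \<le> 1 / T * (max t T - min t T)"
    using half by (intro cdf_std_normal_diff_le std_normal_density_le_inverse T) auto
  also have "max t T - min t T = \<bar>t - T\<bar>" by auto
  also have "1 / T * \<bar>t - T\<bar> \<le> 1 / T * (\<eta> * T)" using T t by (intro mult_left_mono) auto
  also have "\<dots> = \<eta>" using T by simp
  finally show ?thesis
    using cdf_nondecreasing[of t T] cdf_nondecreasing[of T t] by (auto simp: max_def min_def split: if_splits)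
qed

text \<open>To be read with L = log(1/\<alpha>), k = sqrt n, q = v^2, and m, \<sigma> the mean and
  standard deviation of W. For s = \<sigma>/a the exact cut-off t satisfies s t = T + e, where e is
  the Hessian error. Both summands of T are nonnegative and e is at most 2\<epsilon> times the
  second one, so the error is relative to T. The outer factor 2 undoes s \<ge> 1/2.\<close>

lemma threshold_relative_error:
  fixes L k a \<sigma> q m \<epsilon> \<rho> :: real
  defines "T \<equiv> L / (k * a) + k * q / (2 * a)"
  assumes pos: "0 < L" "0 < k" "0 < a" "0 \<le> q" and m: "\<bar>m + q / 2\<bar> \<le> q * \<epsilon>" and \<epsilon>: "0 \<le> \<epsilon>"
    and \<sigma>: "\<bar>\<sigma> / a - 1\<bar> \<le> \<rho>" and \<rho>: "\<rho> \<le> 1 / 2"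
  shows "0 < T" "\<bar>(L - k\<^sup>2 * m) / (k * \<sigma>) - T\<bar> \<le> 2 * (2 * \<epsilon> + \<rho>) * T"
proof -
  have kq: "0 \<le> k * q / (2 * a)" using pos by simp
  show T: "0 < T" unfolding T_def using pos kq by (intro add_pos_nonneg) auto
  define s where "s = \<sigma> / a"
  define t where "t = (L - k\<^sup>2 * m) / (k * \<sigma>)"
  define e where "e = - (k / a) * (m + q / 2)"
  have s: "1 / 2 \<le> s" "\<bar>1 - s\<bar> \<le> \<rho>" using \<sigma> \<rho> unfolding s_def by linarith+
  have \<sigma>0: "0 < \<sigma>" using s pos by (simp add: s_def field_simps)
  have ts: "s * t = T + e"
    using pos \<sigma>0 by (simp add: s_def t_def e_def T_def field_simps power2_eq_square)
  have "\<bar>e\<bar> = k / a * \<bar>m + q / 2\<bar>" using pos by (simp add: e_def abs_mult)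
  also have "\<dots> \<le> k / a * (q * \<epsilon>)" using pos by (intro mult_left_mono m) auto
  also have "\<dots> = 2 * \<epsilon> * (k * q / (2 * a))" by simp
  also have "\<dots> \<le> 2 * \<epsilon> * T"
    using \<epsilon> pos unfolding T_def by (intro mult_left_mono) auto
  finally have e: "\<bar>e\<bar> \<le> 2 * \<epsilon> * T" .
  have "s * (t - T) = e + (1 - s) * T" using ts by (simp add: algebra_simps)
  moreover have "s * \<bar>t - T\<bar> = \<bar>s * (t - T)\<bar>" using s by (simp add: abs_mult)
  ultimately have "s * \<bar>t - T\<bar> = \<bar>e + (1 - s) * T\<bar>" by simp
  also have "\<dots> \<le> \<bar>e\<bar> + \<bar>1 - s\<bar> * T" using T abs_triangle_ineq[of e "(1 - s) * T"] by (simp add: abs_mult)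
  also have "\<dots> \<le> 2 * \<epsilon> * T + \<rho> * T" using e s T by (intro add_mono mult_right_mono) auto
  finally have "s * \<bar>t - T\<bar> \<le> (2 * \<epsilon> + \<rho>) * T" by (simp add: algebra_simps)
  moreover have "1 / 2 * \<bar>t - T\<bar> \<le> s * \<bar>t - T\<bar>" using s by (intro mult_right_mono) auto
  ultimately have "1 / 2 * \<bar>t - T\<bar> \<le> (2 * \<epsilon> + \<rho>) * T" by (rule order_trans[rotated])
  then have "\<bar>t - T\<bar> \<le> 2 * ((2 * \<epsilon> + \<rho>) * T)" by simp
  then show "\<bar>(L - k\<^sup>2 * m) / (k * \<sigma>) - T\<bar> \<le> 2 * (2 * \<epsilon> + \<rho>) * T"
    unfolding t_def[symmetric] by (simp only: mult.assoc)
qed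

text \<open>With s = \<sigma>/a the difference equals ((W - X) + (1 - s) X - m)/(s a). The factor 12
  is 3, from squaring three terms, times 4, from s \<ge> 1/2.\<close>

lemma (in prob_space) standardized_L2_close:
  fixes W X :: "'a \<Rightarrow> real"
  assumes [measurable]: "W \<in> borel_measurable M" "X \<in> borel_measurable M"
    and X2: "integrable M (\<lambda>z. (X z)\<^sup>2)" "(\<integral>z. (X z)\<^sup>2 \<partial>M) = a\<^sup>2" and a: "0 < a"
    and D2: "integrable M (\<lambda>z. (W z - X z)\<^sup>2)" "(\<integral>z. (W z - X z)\<^sup>2 \<partial>M) \<le> (a * E)\<^sup>2"
    and m: "\<bar>m\<bar> \<le> d * a" and \<sigma>: "\<bar>\<sigma> / a - 1\<bar> \<le> \<rho>" and \<rho>: "\<rho> \<le> 1 / 2"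
  shows "integrable M (\<lambda>z. ((W z - m) / \<sigma> - X z / a)\<^sup>2)"
    "(\<integral>z. ((W z - m) / \<sigma> - X z / a)\<^sup>2 \<partial>M) \<le> 12 * (E\<^sup>2 + \<rho>\<^sup>2 + d\<^sup>2)"
proof -
  define s where "s = \<sigma> / a"
  have s: "1 / 2 \<le> s" "\<bar>1 - s\<bar> \<le> \<rho>" using \<sigma> \<rho> unfolding s_def by linarith+
  have \<sigma>_eq: "\<sigma> = s * a" using a by (simp add: s_def)
  define B where "B z = 12 / a\<^sup>2 * ((W z - X z)\<^sup>2 + (1 - s)\<^sup>2 * (X z)\<^sup>2 + m\<^sup>2)" for z
  have B: "((W z - m) / \<sigma> - X z / a)\<^sup>2 \<le> B z" for z
  proof -
    have "(W z - m) / \<sigma> - X z / a = 1 / (s * a) * ((W z - X z) + (1 - s) * X z + - m)"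
      using s a by (simp add: \<sigma>_eq field_simps)
    then have "((W z - m) / \<sigma> - X z / a)\<^sup>2 = 1 / (s\<^sup>2 * a\<^sup>2) * ((W z - X z) + (1 - s) * X z + - m)\<^sup>2"
      by (simp only: power_mult_distrib power_divide power_one)
    also have "\<dots> \<le> 4 / a\<^sup>2 * (3 * ((W z - X z)\<^sup>2 + ((1 - s) * X z)\<^sup>2 + (- m)\<^sup>2))"
    proof (intro mult_mono power2_sum3_le)
      have "(1 / 2)\<^sup>2 \<le> s\<^sup>2" by (rule power_mono[OF s(1)]) simp
      then have "1 \<le> 4 * s\<^sup>2" by (simp add: power_divide)
      then show "1 / (s\<^sup>2 * a\<^sup>2) \<le> 4 / a\<^sup>2" using a s by (simp add: field_simps)
    qed auto
    finally show ?thesis by (simp add: B_def power_mult_distrib)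
  qed
  have iB: "integrable M B" unfolding B_def[abs_def] using X2 D2 by simp
  show int: "integrable M (\<lambda>z. ((W z - m) / \<sigma> - X z / a)\<^sup>2)"
    by (rule Bochner_Integration.integrable_bound[OF iB])
      (use B in \<open>auto intro: order_trans[OF _ abs_ge_self]\<close>)
  have "(\<integral>z. ((W z - m) / \<sigma> - X z / a)\<^sup>2 \<partial>M) \<le> (\<integral>z. B z \<partial>M)"
    by (intro integral_mono int iB B)
  also have "\<dots> = 12 / a\<^sup>2 * ((\<integral>z. (W z - X z)\<^sup>2 \<partial>M) + (1 - s)\<^sup>2 * a\<^sup>2 + m\<^sup>2)"
    unfolding B_def using X2 D2 by (simp add: prob_space)
  also have "\<dots> \<le> 12 / a\<^sup>2 * ((a * E)\<^sup>2 + \<rho>\<^sup>2 * a\<^sup>2 + (d * a)\<^sup>2)"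
  proof (intro mult_left_mono add_mono mult_right_mono)
    show "(1 - s)\<^sup>2 \<le> \<rho>\<^sup>2" using s by (metis abs_le_square_iff abs_of_nonneg order_trans abs_ge_zero)
    show "m\<^sup>2 \<le> (d * a)\<^sup>2" using m by (metis abs_le_square_iff abs_of_nonneg order_trans abs_ge_zero)
  qed (use D2 in auto)
  also have "\<dots> = 12 * (E\<^sup>2 + \<rho>\<^sup>2 + d\<^sup>2)" using a by (simp add: power_mult_distrib field_simps)
  finally show "(\<integral>z. ((W z - m) / \<sigma> - X z / a)\<^sup>2 \<partial>M) \<le> 12 * (E\<^sup>2 + \<rho>\<^sup>2 + d\<^sup>2)" .
qed

text \<open>The Lindeberg integrand survives an L2-perturbation. If |u| \<le> 2|x|, the square grows
  by at most 4 and the truncation by at most 2. Otherwise |u| \<le> 2|u - x|, the perturbation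
  dominates, and the truncation is bounded by 1.\<close>

lemma power2_mult_min_le:
  fixes u x \<kappa> :: real
  assumes \<kappa>: "0 < \<kappa>"
  shows "u\<^sup>2 * min 1 (\<bar>u\<bar> / \<kappa>) \<le> 8 * (x\<^sup>2 * min 1 (\<bar>x\<bar> / \<kappa>)) + 4 * (u - x)\<^sup>2"
proof (cases "\<bar>u\<bar> \<le> 2 * \<bar>x\<bar>")
  case True
  have "u\<^sup>2 \<le> (2 * \<bar>x\<bar>)\<^sup>2" using True power_mono[OF True, of 2] by simp
  then have "u\<^sup>2 \<le> 4 * x\<^sup>2" by (simp add: power_mult_distrib)
  moreover have "min 1 (\<bar>u\<bar> / \<kappa>) \<le> 2 * min 1 (\<bar>x\<bar> / \<kappa>)"
  proof -
    have "\<bar>u\<bar> / \<kappa> \<le> 2 * (\<bar>x\<bar> / \<kappa>)" using divide_right_mono[OF True, of \<kappa>] \<kappa> by simp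
    then show ?thesis by (auto simp: min_def)
  qed
  ultimately have "u\<^sup>2 * min 1 (\<bar>u\<bar> / \<kappa>) \<le> 4 * x\<^sup>2 * (2 * min 1 (\<bar>x\<bar> / \<kappa>))"
    using \<kappa> by (intro mult_mono) auto
  moreover have "0 \<le> (u - x)\<^sup>2" by simp
  ultimately show ?thesis by linarith
next
  case False
  moreover have "\<bar>u\<bar> \<le> \<bar>u - x\<bar> + \<bar>x\<bar>" using abs_triangle_ineq[of "u - x" x] by simp
  ultimately have "\<bar>u\<bar> \<le> 2 * \<bar>u - x\<bar>" by (smt (verit))
  then have "u\<^sup>2 \<le> (2 * \<bar>u - x\<bar>)\<^sup>2" using power_mono[of "\<bar>u\<bar>" "2 * \<bar>u - x\<bar>" 2] by simp
  then have "u\<^sup>2 \<le> 4 * (u - x)\<^sup>2" by (simp add: power_mult_distrib)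
  moreover have "u\<^sup>2 * min 1 (\<bar>u\<bar> / \<kappa>) \<le> u\<^sup>2 * 1" by (intro mult_left_mono) auto
  moreover have "0 \<le> x\<^sup>2 * min 1 (\<bar>x\<bar> / \<kappa>)" using \<kappa> by simp
  ultimately show ?thesis by linarith
qed

lemma lindeberg_perturbation:
  fixes U X :: "'a \<Rightarrow> real"
  assumes [measurable]: "U \<in> borel_measurable M" "X \<in> borel_measurable M" and \<kappa>: "0 < \<kappa>"
    and U2: "integrable M (\<lambda>z. (U z)\<^sup>2)" and X2: "integrable M (\<lambda>z. (X z)\<^sup>2)"
    and D2: "integrable M (\<lambda>z. (U z - X z)\<^sup>2)"
  shows "(\<integral>z. (U z)\<^sup>2 * min 1 (\<bar>U z\<bar> / \<kappa>) \<partial>M)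
     \<le> 8 * (\<integral>z. (X z)\<^sup>2 * min 1 (\<bar>X z\<bar> / \<kappa>) \<partial>M) + 4 * (\<integral>z. (U z - X z)\<^sup>2 \<partial>M)"
proof -
  have int: "integrable M (\<lambda>z. (Y z)\<^sup>2 * min 1 (\<bar>Y z\<bar> / \<kappa>))"
    if [measurable]: "Y \<in> borel_measurable M" and "integrable M (\<lambda>z. (Y z)\<^sup>2)" for Y :: "'a \<Rightarrow> real"
    by (rule Bochner_Integration.integrable_bound[OF that(2)])
      (use \<kappa> in \<open>auto simp: abs_mult mult_left_le\<close>)
  have "(\<integral>z. (U z)\<^sup>2 * min 1 (\<bar>U z\<bar> / \<kappa>) \<partial>M)
      \<le> (\<integral>z. 8 * ((X z)\<^sup>2 * min 1 (\<bar>X z\<bar> / \<kappa>)) + 4 * (U z - X z)\<^sup>2 \<partial>M)"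
    using int[of U] int[of X] U2 X2 D2
    by (intro integral_mono power2_mult_min_le \<kappa>) auto
  also have "\<dots> = 8 * (\<integral>z. (X z)\<^sup>2 * min 1 (\<bar>X z\<bar> / \<kappa>) \<partial>M) + 4 * (\<integral>z. (U z - X z)\<^sup>2 \<partial>M)"
    using int[of X] X2 D2 by simp
  finally show ?thesis .
qed

section \<open>The split sample\<close>

lemma nn_integral_le_add:
  assumes [measurable]: "f \<in> borel_measurable M" "g \<in> borel_measurable M"
    and le: "\<And>x. x \<in> space M \<Longrightarrow> f x \<le> h x + g x" and fin: "\<And>x. x \<in> space M \<Longrightarrow> g x < \<infinity>"
  shows "(\<integral>\<^sup>+ x. f x \<partial>M) \<le> (\<integral>\<^sup>+ x. h x \<partial>M) + (\<integral>\<^sup>+ x. g x \<partial>M)"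
proof -
  \<comment> \<open>The truncated difference f - g is measurable and lies below h, so additivity is
    applied to measurable functions only.\<close>
  have "(\<integral>\<^sup>+ x. f x \<partial>M) \<le> (\<integral>\<^sup>+ x. (f x - g x) + g x \<partial>M)"
    by (intro nn_integral_mono) (auto simp: diff_add_self_ennreal not_le less_imp_le)
  also have "\<dots> = (\<integral>\<^sup>+ x. f x - g x \<partial>M) + (\<integral>\<^sup>+ x. g x \<partial>M)" by (rule nn_integral_add) auto
  also have "\<dots> \<le> (\<integral>\<^sup>+ x. h x \<partial>M) + (\<integral>\<^sup>+ x. g x \<partial>M)"
    using le fin by (intro add_right_mono nn_integral_mono)
      (simp add: ennreal_minus_le_iff add.commute less_top[symmetric])
  finally show ?thesis .
qed

text \<open>Tonelli's theorem on the product of the two blocks: the section at x of the pulled-back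
  event is the event whose probability \<open>cond_prob_given\<close> takes, and the measure of a
  section depends measurably on x.\<close>

lemma
  fixes G :: "'z measure" and I J :: "nat set" and P :: "(nat \<Rightarrow> 'z) \<Rightarrow> bool"
  defines "M \<equiv> PiM (I \<union> J) (\<lambda>_. G)"
  assumes G: "prob_space G" and fin: "finite I" "finite J" and disj: "I \<inter> J = {}"
    and Q: "{\<omega> \<in> space M. P \<omega>} \<in> sets M"
  shows cond_prob_given_measurable:
      "(\<lambda>\<omega>. cond_prob_given I J G P (restrict \<omega> I)) \<in> borel_measurable M" (is ?meas)
    and prob_eq_integral_cond_prob_given:
      "measure M {\<omega> \<in> space M. P \<omega>} = (\<integral>\<omega>. cond_prob_given I J G P (restrict \<omega> I) \<partial>M)" (is ?eq)
proof -
  interpret G: prob_space G by (rule G)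
  interpret P: product_sigma_finite "\<lambda>_::nat. G" by unfold_locales
  interpret M: prob_space M unfolding M_def by (intro prob_space_PiM G)
  define A1 where "A1 = PiM I (\<lambda>_. G)"
  define A2 where "A2 = PiM J (\<lambda>_. G)"
  interpret A1: prob_space A1 unfolding A1_def by (intro prob_space_PiM G)
  interpret A2: prob_space A2 unfolding A2_def by (intro prob_space_PiM G)
  interpret PM: product_prob_space "\<lambda>_::nat. G" "I \<union> J" by unfold_locales
  let ?Q = "{\<omega> \<in> space M. P \<omega>}"
  have restr [measurable]: "(\<lambda>\<omega>. restrict \<omega> I) \<in> measurable M A1"
    unfolding M_def A1_def by (rule measurable_restrict_subset) auto
  have merge [measurable]: "merge I J \<in> measurable (A1 \<Otimes>\<^sub>M A2) M"
    unfolding M_def A1_def A2_def by (rule measurable_merge)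
  have distr: "distr (A1 \<Otimes>\<^sub>M A2) M (merge I J) = M"
    unfolding M_def A1_def A2_def by (rule P.distr_merge[OF disj fin])
  have A1_eq: "distr M A1 (\<lambda>\<omega>. restrict \<omega> I) = A1"
    using PM.distr_restrict[of I "I \<union> J"] fin unfolding M_def A1_def by simp
  define Q' where "Q' = merge I J -` ?Q \<inter> space (A1 \<Otimes>\<^sub>M A2)"
  have Q' [measurable]: "Q' \<in> sets (A1 \<Otimes>\<^sub>M A2)" unfolding Q'_def by (rule measurable_sets[OF merge Q])
  define c where "c x = cond_prob_given I J G P x" for x
  have c: "emeasure A2 (Pair x -` Q') = ennreal (c x)" if x: "x \<in> space A1" for x
  proof -
    have "Pair x -` Q' = {y \<in> space A2. P (merge I J (x, y))}"
      using x measurable_space[OF merge] by (auto simp: Q'_def space_pair_measure)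
    then show ?thesis by (simp add: c_def cond_prob_given_def A2_def[symmetric] A2.emeasure_eq_measure)
  qed
  have "(\<lambda>x. enn2real (emeasure A2 (Pair x -` Q'))) \<in> borel_measurable A1"
    using A2.measurable_emeasure_Pair[OF Q'] by measurable
  then have cm [measurable]: "c \<in> borel_measurable A1"
    by (rule measurable_cong[THEN iffD1, rotated]) (simp add: c c_def cond_prob_given_def)
  show m: ?meas unfolding c_def[symmetric] by measurable
  have "emeasure M ?Q = emeasure (distr (A1 \<Otimes>\<^sub>M A2) M (merge I J)) ?Q" by (simp add: distr)
  also have "\<dots> = emeasure (A1 \<Otimes>\<^sub>M A2) Q'" unfolding Q'_def by (rule emeasure_distr[OF merge Q])
  also have "\<dots> = (\<integral>\<^sup>+ x. emeasure A2 (Pair x -` Q') \<partial>A1)" by (rule A2.emeasure_pair_measure_alt[OF Q'])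
  also have "\<dots> = (\<integral>\<^sup>+ x. ennreal (c x) \<partial>A1)" by (intro nn_integral_cong c)
  also have "\<dots> = (\<integral>\<^sup>+ x. ennreal (c x) \<partial>distr M A1 (\<lambda>\<omega>. restrict \<omega> I))" by (simp only: A1_eq)
  also have "\<dots> = (\<integral>\<^sup>+ \<omega>. ennreal (c (restrict \<omega> I)) \<partial>M)" by (rule nn_integral_distr) measurable
  finally have "measure M ?Q = enn2real (\<integral>\<^sup>+ \<omega>. ennreal (c (restrict \<omega> I)) \<partial>M)" by (simp add: measure_def)
  then show ?eq unfolding c_def[symmetric]
    by (subst integral_eq_nn_integral) (use m in \<open>auto simp: c_def cond_prob_given_def\<close>)
qed

section \<open>Quadratic forms of the information and Hessian matrices\<close>

lemma quadratic_form_eq_sum: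
  assumes "A \<in> carrier_mat d d" "x \<in> carrier_vec d"
  shows "x \<bullet> (A *\<^sub>v x) = (\<Sum>i<d. \<Sum>j<d. x $ i * (A $$ (i, j) * x $ j))"
  using assms by (simp add: scalar_prod_def sum_distrib_left lessThan_atLeast0)

lemma info_mat_carrier [simp]: "info_mat d G l \<in> carrier_mat d d"
  by (simp add: info_mat_def)

lemma
  fixes G :: "'z measure" and l :: "'z \<Rightarrow> real vec"
  assumes l: "\<And>z. z \<in> space G \<Longrightarrow> l z \<in> carrier_vec d"
    and meas: "\<And>i. i < d \<Longrightarrow> (\<lambda>z. l z $ i) \<in> borel_measurable G"
    and sq: "\<And>i. i < d \<Longrightarrow> integrable G (\<lambda>z. (l z $ i)\<^sup>2)" and h: "h \<in> carrier_vec d"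
  shows score_measurable: "(\<lambda>z. h \<bullet> l z) \<in> borel_measurable G"
    and score_square_integrable: "integrable G (\<lambda>z. (h \<bullet> l z)\<^sup>2)"
    and score_second_moment: "(\<integral>z. (h \<bullet> l z)\<^sup>2 \<partial>G) = (mnorm (info_mat d G l) h)\<^sup>2"
    and mnorm_info_nonneg: "0 \<le> mnorm (info_mat d G l) h"
proof -
  have eq: "h \<bullet> l z = (\<Sum>i<d. h $ i * l z $ i)" if "z \<in> space G" for z
    using l[OF that] by (simp add: scalar_prod_def lessThan_atLeast0)
  show m: "(\<lambda>z. h \<bullet> l z) \<in> borel_measurable G"
    by (subst measurable_cong[OF eq]) (use meas in auto)
  have prod: "integrable G (\<lambda>z. l z $ i * l z $ j)" if ij: "i < d" "j < d" for i j
  proof (rule Bochner_Integration.integrable_bound)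
    show "integrable G (\<lambda>z. (l z $ i)\<^sup>2 + (l z $ j)\<^sup>2)" using sq ij by simp
    show "(\<lambda>z. l z $ i * l z $ j) \<in> borel_measurable G" using meas ij by simp
    have "\<bar>x * y\<bar> \<le> x\<^sup>2 + y\<^sup>2" for x y :: real
    proof -
      have "2 * (\<bar>x\<bar> * \<bar>y\<bar>) \<le> x\<^sup>2 + y\<^sup>2" using sum_squares_bound[of "\<bar>x\<bar>" "\<bar>y\<bar>"] by simp
      moreover have "0 \<le> \<bar>x\<bar> * \<bar>y\<bar>" by simp
      ultimately show ?thesis unfolding abs_mult by linarith
    qed
    then show "AE z in G. norm (l z $ i * l z $ j) \<le> norm ((l z $ i)\<^sup>2 + (l z $ j)\<^sup>2)" by simp
  qed
  have int: "integrable G (\<lambda>z. h $ i * (l z $ i * l z $ j) * h $ j)" if "i < d" "j < d" for i j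
    by (intro integrable_mult_left integrable_mult_right prod that)
  have sqeq: "(h \<bullet> l z)\<^sup>2 = (\<Sum>i<d. \<Sum>j<d. h $ i * (l z $ i * l z $ j) * h $ j)" if "z \<in> space G" for z
    unfolding eq[OF that] power2_eq_square sum_product by (simp add: ac_simps)
  show "integrable G (\<lambda>z. (h \<bullet> l z)\<^sup>2)"
    by (subst Bochner_Integration.integrable_cong[OF refl sqeq], assumption)
      (intro Bochner_Integration.integrable_sum int; simp)
  have "(\<integral>z. (h \<bullet> l z)\<^sup>2 \<partial>G) = (\<integral>z. (\<Sum>i<d. \<Sum>j<d. h $ i * (l z $ i * l z $ j) * h $ j) \<partial>G)"
    by (intro Bochner_Integration.integral_cong refl sqeq)
  also have "\<dots> = (\<Sum>i<d. \<integral>z. (\<Sum>j<d. h $ i * (l z $ i * l z $ j) * h $ j) \<partial>G)"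
    by (rule Bochner_Integration.integral_sum) (intro Bochner_Integration.integrable_sum int; simp)
  also have "\<dots> = (\<Sum>i<d. \<Sum>j<d. \<integral>z. h $ i * (l z $ i * l z $ j) * h $ j \<partial>G)"
    by (intro sum.cong refl Bochner_Integration.integral_sum int; simp)
  also have "\<dots> = (\<Sum>i<d. \<Sum>j<d. h $ i * (\<integral>z. l z $ i * l z $ j \<partial>G) * h $ j)"
    by simp
  also have "\<dots> = (\<Sum>i<d. \<Sum>j<d. h $ i * ((\<integral>z. l z $ i * l z $ j \<partial>G) * h $ j))"
    by (simp only: mult.assoc)
  also have "\<dots> = (\<Sum>i<d. \<Sum>j<d. h $ i * (info_mat d G l $$ (i, j) * h $ j))"
    by (intro sum.cong refl) (simp add: info_mat_def)
  also have "\<dots> = h \<bullet> (info_mat d G l *\<^sub>v h)"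
    by (rule quadratic_form_eq_sum[symmetric, OF info_mat_carrier h])
  finally have q: "(\<integral>z. (h \<bullet> l z)\<^sup>2 \<partial>G) = h \<bullet> (info_mat d G l *\<^sub>v h)" .
  \<comment> \<open>The real \<open>sqrt\<close> is odd, hence negative on negative numbers;
    nonnegativity of the form must come first, and it is inherited from the second moment.\<close>
  then have q0: "0 \<le> h \<bullet> (info_mat d G l *\<^sub>v h)" by (metis Bochner_Integration.integral_nonneg zero_le_power2)
  then show "0 \<le> mnorm (info_mat d G l) h" by (simp add: mnorm_def)
  show "(\<integral>z. (h \<bullet> l z)\<^sup>2 \<partial>G) = (mnorm (info_mat d G l) h)\<^sup>2"
    using q0 by (simp add: q mnorm_def)
qed

lemma
  assumes V: "positive_definite_mat d V" and h: "h \<in> carrier_vec d"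
  shows mnorm_pd_nonneg: "0 \<le> mnorm V h" and mnorm_pd_power2: "(mnorm V h)\<^sup>2 = h \<bullet> (V *\<^sub>v h)"
    and mnorm_pd_pos: "h \<noteq> 0\<^sub>v d \<Longrightarrow> 0 < mnorm V h" and mnorm_pd_zero: "mnorm V (0\<^sub>v d) = 0"
proof -
  have c: "V \<in> carrier_mat d d" using V by (simp add: positive_definite_mat_def)
  have z: "0\<^sub>v d \<bullet> (V *\<^sub>v 0\<^sub>v d) = (0::real)" using c by (simp add: quadratic_form_eq_sum)
  have q: "0 \<le> h \<bullet> (V *\<^sub>v h)"
    using V h z by (cases "h = 0\<^sub>v d") (auto simp: positive_definite_mat_def intro: less_imp_le)
  show "0 \<le> mnorm V h" "(mnorm V h)\<^sup>2 = h \<bullet> (V *\<^sub>v h)" using q by (auto simp: mnorm_def)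
  show "mnorm V (0\<^sub>v d) = 0" using z by (simp add: mnorm_def)
  show "h \<noteq> 0\<^sub>v d \<Longrightarrow> 0 < mnorm V h" using V h by (simp add: mnorm_def positive_definite_mat_def)
qed

lemma eln_measurable [measurable]: "eln \<in> borel_measurable borel"
  unfolding eln_def[abs_def] by measurable

section \<open>Analysis at a fixed stage n and a fixed law G\<close>

locale ui_stage =
  fixes S :: "'z ui_problem" and n :: nat and G :: "'z measure"
  assumes valid: "valid_problem S" and n: "1 \<le> n" and G_dists: "G \<in> dists S"
begin

sublocale G: prob_space G
  using valid G_dists by (simp add: valid_problem_def are_distributions_def)

lemma prob_G: "prob_space G" by unfold_locales

lemma sets_G: "sets G = sets (base S)"
  using valid G_dists by (simp add: valid_problem_def are_distributions_def)

lemma target_in_Theta: "target S G \<in> Theta S"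
  using valid G_dists by (auto simp: valid_problem_def are_distributions_def is_arg_min_def)

lemma Theta_carrier: "\<theta> \<in> Theta S \<Longrightarrow> \<theta> \<in> carrier_vec (pdim S)"
  using valid by (auto simp: valid_problem_def is_model_def)

lemma target_carrier: "target S G \<in> carrier_vec (pdim S)"
  by (rule Theta_carrier[OF target_in_Theta])

lemma dens_measurable [measurable]: "\<theta> \<in> Theta S \<Longrightarrow> dens S \<theta> \<in> borel_measurable G"
  using valid measurable_cong_sets[OF sets_G refl] by (auto simp: valid_problem_def is_model_def)

lemma folds: "fold1 S n \<inter> fold2 S n = {}" "fold1 S n \<union> fold2 S n = {1..nobs S n}"
    "card (fold2 S n) = n" "finite (fold1 S n)" "finite (fold2 S n)"
proof -
  show *: "fold1 S n \<inter> fold2 S n = {}" "fold1 S n \<union> fold2 S n = {1..nobs S n}" "card (fold2 S n) = n"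
    using valid n by (auto simp: valid_problem_def)
  have "finite (fold1 S n \<union> fold2 S n)" by (simp add: *)
  then show "finite (fold1 S n)" "finite (fold2 S n)" by auto
qed

lemma sample_eq: "sample S n G = PiM (fold1 S n \<union> fold2 S n) (\<lambda>_. G)"
  by (simp add: sample_def folds)

lemma prob_sample: "prob_space (sample S n G)"
  unfolding sample_def by (intro prob_space_PiM prob_G)

abbreviation "D1 \<equiv> PiM (fold1 S n) (\<lambda>_. G)"
abbreviation "D2 \<equiv> PiM (fold2 S n) (\<lambda>_. G)"

lemma prob_D2: "prob_space D2"
  by (intro prob_space_PiM prob_G)

lemma sets_D1: "sets (PiM (fold1 S n) (\<lambda>_. base S)) = sets D1"
  by (intro sets_PiM_cong refl) (simp add: sets_G)

lemma data1_measurable [measurable]: "data1 S n \<in> measurable (sample S n G) D1"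
  unfolding sample_eq by (rule measurable_restrict_subset) auto

lemma data1_space: "\<omega> \<in> space (sample S n G) \<Longrightarrow> data1 S n \<omega> \<in> space D1"
  using measurable_space[OF data1_measurable] .

lemma
  shows est1_in_Theta: "x \<in> space D1 \<Longrightarrow> est1 S n x \<in> Theta S"
    and est1_component_measurable: "i < pdim S \<Longrightarrow> (\<lambda>x. est1 S n x $ i) \<in> borel_measurable D1"
    and dens_est1_measurable: "(\<lambda>(x, z). dens S (est1 S n x) z) \<in> borel_measurable (D1 \<Otimes>\<^sub>M G)"
proof -
  have "is_estimator S n" using valid n by (simp add: valid_problem_def)
  moreover have "space (PiM (fold1 S n) (\<lambda>_. base S)) = space D1" by (rule sets_eq_imp_space_eq[OF sets_D1])
  ultimately show "x \<in> space D1 \<Longrightarrow> est1 S n x \<in> Theta S"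
    and "i < pdim S \<Longrightarrow> (\<lambda>x. est1 S n x $ i) \<in> borel_measurable D1"
    and "(\<lambda>(x, z). dens S (est1 S n x) z) \<in> borel_measurable (D1 \<Otimes>\<^sub>M G)"
    by (simp_all add: is_estimator_def Let_def measurable_cong_sets[OF sets_D1 refl]
        measurable_cong_sets[OF sets_pair_measure_cong[OF sets_D1 sets_G[symmetric]] refl])
qed

lemma CI_UI_miss_iff:
  "target S G \<notin> CI_UI S n \<alpha> \<omega> \<longleftrightarrow>
    \<not> (\<Sum>i\<in>fold2 S n. eln (dens S (est1 S n (data1 S n \<omega>)) (\<omega> i)) - eln (dens S (target S G) (\<omega> i)))
        \<le> ereal (ln (1 / \<alpha>))"
  using target_in_Theta by (simp add: CI_UI_def)

lemma miss_sets: "{\<omega> \<in> space (sample S n G). target S G \<notin> CI_UI S n \<alpha> \<omega>} \<in> sets (sample S n G)"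
proof -
  have comp [measurable]: "(\<lambda>\<omega>. \<omega> i) \<in> measurable (sample S n G) G" if "i \<in> fold2 S n" for i
    unfolding sample_eq by (rule measurable_component_singleton) (use that in simp)
  have [measurable]: "(\<lambda>\<omega>. dens S (est1 S n (data1 S n \<omega>)) (\<omega> i)) \<in> borel_measurable (sample S n G)"
    if "i \<in> fold2 S n" for i
    using measurable_compose[OF measurable_Pair[OF data1_measurable comp[OF that]] dens_est1_measurable]
    by simp
  have [measurable]: "(\<lambda>\<omega>. dens S (target S G) (\<omega> i)) \<in> borel_measurable (sample S n G)"
    if "i \<in> fold2 S n" for i
    using measurable_compose[OF comp[OF that] dens_measurable[OF target_in_Theta]] .
  show ?thesis unfolding CI_UI_miss_iff by measurable
qed

lemma merge_D1: "x \<in> space D1 \<Longrightarrow> data1 S n (merge (fold1 S n) (fold2 S n) (x, y)) = x"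
  by (auto simp: merge_def space_PiM PiE_def extensional_def fun_eq_iff)

lemma merge_D2: "i \<in> fold2 S n \<Longrightarrow> merge (fold1 S n) (fold2 S n) (x, y) i = y i"
  using folds by (auto simp: merge_def)

lemma log_lik_ratio_measurable [measurable]:
  "\<theta> \<in> Theta S \<Longrightarrow> log_lik_ratio S G \<theta> \<in> borel_measurable G"
  unfolding log_lik_ratio_def[abs_def] using target_in_Theta by measurable

text \<open>Almost surely both densities are positive at all points of the second block, so the
  extended logarithms are real and no ambiguous difference of infinities remains.\<close>

lemma cond_miss_eq:
  assumes x: "x \<in> space D1" and def: "llr_defined S G (est1 S n x)"
  shows "cond_prob_given (fold1 S n) (fold2 S n) G (\<lambda>\<omega>. target S G \<notin> CI_UI S n \<alpha> \<omega>) x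
    = measure D2 {y \<in> space D2. ln (1 / \<alpha>) < (\<Sum>i\<in>fold2 S n. log_lik_ratio S G (est1 S n x) (y i))}"
proof -
  interpret D2: prob_space D2 by (rule prob_D2)
  note [measurable] = dens_measurable[OF est1_in_Theta[OF x]] dens_measurable[OF target_in_Theta]
    log_lik_ratio_measurable[OF est1_in_Theta[OF x]]
  have "\<forall>i\<in>fold2 S n. AE y in D2. 0 < dens S (est1 S n x) (y i) \<and> 0 < dens S (target S G) (y i)"
    using def unfolding llr_defined_def by (intro ballI AE_PiM_component prob_G) auto
  then have "AE y in D2. \<forall>i\<in>fold2 S n. 0 < dens S (est1 S n x) (y i) \<and> 0 < dens S (target S G) (y i)"
    using folds by (subst AE_finite_all) auto
  then have ae: "AE y in D2.
      (y \<in> {y \<in> space D2. \<not> (\<Sum>i\<in>fold2 S n. eln (dens S (est1 S n x) (y i)) - eln (dens S (target S G) (y i)))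
        \<le> ereal (ln (1 / \<alpha>))}) \<longleftrightarrow>
      (y \<in> {y \<in> space D2. ln (1 / \<alpha>) < (\<Sum>i\<in>fold2 S n. log_lik_ratio S G (est1 S n x) (y i))})"
  proof eventually_elim
    case (elim y)
    then have "(\<Sum>i\<in>fold2 S n. eln (dens S (est1 S n x) (y i)) - eln (dens S (target S G) (y i)))
        = (\<Sum>i\<in>fold2 S n. ereal (log_lik_ratio S G (est1 S n x) (y i)))"
      by (intro sum.cong refl) (simp add: eln_def log_lik_ratio_def)
    also have "\<dots> = ereal (\<Sum>i\<in>fold2 S n. log_lik_ratio S G (est1 S n x) (y i))" by simp
    finally show ?case by (auto simp: not_le)
  qed
  have "cond_prob_given (fold1 S n) (fold2 S n) G (\<lambda>\<omega>. target S G \<notin> CI_UI S n \<alpha> \<omega>) x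
      = measure D2 {y \<in> space D2. \<not> (\<Sum>i\<in>fold2 S n. eln (dens S (est1 S n x) (y i)) - eln (dens S (target S G) (y i)))
        \<le> ereal (ln (1 / \<alpha>))}"
    unfolding cond_prob_given_def CI_UI_miss_iff by (simp only: merge_D1[OF x] merge_D2 cong: sum.cong)
  also have "\<dots> = measure D2 {y \<in> space D2. ln (1 / \<alpha>) < (\<Sum>i\<in>fold2 S n. log_lik_ratio S G (est1 S n x) (y i))}"
    by (rule D2.finite_measure_eq_AE[OF ae]) measurable
  finally show ?thesis .
qed

lemma Delta_BE_eq:
  fixes x
  defines "W \<equiv> log_lik_ratio S G (est1 S n x)" and "\<sigma> \<equiv> llr_sd S G (est1 S n x)"
  assumes x: "x \<in> space D1"
  shows "Delta_BE S n G x = (SUP t. ennreal \<bar>measure D2 {y \<in> space D2.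
       (\<Sum>i\<in>fold2 S n. (W (y i) - (\<integral>z. W z \<partial>G)) / \<sigma>) / sqrt n \<le> t} - cdf std_normal_distribution t\<bar>)"
proof -
  have "inverse \<sigma> * W z - (\<integral>z. inverse \<sigma> * W z \<partial>G) = (W z - (\<integral>z. W z \<partial>G)) / \<sigma>" for z
    by (simp add: divide_inverse algebra_simps)
  then show ?thesis
    unfolding Delta_BE_def cond_prob_given_def Let_def emp_cross_def
    by (simp only: merge_D1[OF x] merge_D2 W_def[symmetric] \<sigma>_def[symmetric] cong: sum.cong)
qed

text \<open>A miss is a sum of log-ratios above log(1/\<alpha>). Centring and scaling turn it into
  the complement of the event inside \<open>Delta_BE\<close> at a single t, so the supremum
  dominates its error.\<close>

lemma cond_miss_normal_approx:
  fixes x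
  defines "W \<equiv> log_lik_ratio S G (est1 S n x)" and "\<sigma> \<equiv> llr_sd S G (est1 S n x)"
  assumes x: "x \<in> space D1" and def: "llr_defined S G (est1 S n x)" and \<sigma>: "0 < \<sigma>"
  shows "ennreal \<bar>cond_prob_given (fold1 S n) (fold2 S n) G (\<lambda>\<omega>. target S G \<notin> CI_UI S n \<alpha> \<omega>) x
      - (1 - cdf std_normal_distribution ((ln (1 / \<alpha>) - (sqrt n)\<^sup>2 * (\<integral>z. W z \<partial>G)) / (sqrt n * \<sigma>)))\<bar>
    \<le> Delta_BE S n G x"
proof -
  interpret D2: prob_space D2 by (rule prob_D2)
  define t where "t = (ln (1 / \<alpha>) - (sqrt n)\<^sup>2 * (\<integral>z. W z \<partial>G)) / (sqrt n * \<sigma>)"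
  define B where "B = {y \<in> space D2. (\<Sum>i\<in>fold2 S n. (W (y i) - (\<integral>z. W z \<partial>G)) / \<sigma>) / sqrt n \<le> t}"
  have [measurable]: "W \<in> borel_measurable G"
    unfolding W_def by (rule log_lik_ratio_measurable[OF est1_in_Theta[OF x]])
  have B_sets: "B \<in> sets D2" unfolding B_def by measurable
  have sn: "0 < sqrt n" using n by simp
  have iff: "(\<Sum>i\<in>fold2 S n. (W (y i) - (\<integral>z. W z \<partial>G)) / \<sigma>) / sqrt n \<le> t
      \<longleftrightarrow> (\<Sum>i\<in>fold2 S n. W (y i)) \<le> ln (1 / \<alpha>)" for y
  proof -
    have "(\<Sum>i\<in>fold2 S n. (W (y i) - (\<integral>z. W z \<partial>G)) / \<sigma>) / sqrt n
        = ((\<Sum>i\<in>fold2 S n. W (y i)) - (sqrt n)\<^sup>2 * (\<integral>z. W z \<partial>G)) / (sqrt n * \<sigma>)"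
      using \<sigma> by (simp add: sum_divide_distrib[symmetric] sum_subtractf folds mult.commute)
    moreover have "0 < sqrt n * \<sigma>" using sn \<sigma> by simp
    ultimately show ?thesis unfolding t_def by (simp only: divide_le_cancel) auto
  qed
  have "cond_prob_given (fold1 S n) (fold2 S n) G (\<lambda>\<omega>. target S G \<notin> CI_UI S n \<alpha> \<omega>) x
      = measure D2 (space D2 - B)"
    unfolding cond_miss_eq[OF x def] W_def[symmetric]
    by (intro arg_cong[where f="measure D2"]) (auto simp: B_def iff)
  also have "\<dots> = 1 - measure D2 B" by (rule D2.prob_compl[OF B_sets])
  finally have "\<bar>cond_prob_given (fold1 S n) (fold2 S n) G (\<lambda>\<omega>. target S G \<notin> CI_UI S n \<alpha> \<omega>) x
      - (1 - cdf std_normal_distribution t)\<bar> = \<bar>measure D2 B - cdf std_normal_distribution t\<bar>" by simp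
  then show ?thesis
    unfolding Delta_BE_eq[OF x] t_def[symmetric] W_def[symmetric] \<sigma>_def[symmetric]
    by (auto simp: B_def intro!: SUP_upper)
qed

text \<open>All log-ratios vanish while log(1/\<alpha>) > 0. This is the degenerate case that the
  convention r = \<infinity> has to match.\<close>

lemma cond_miss_at_target:
  assumes x: "x \<in> space D1" and eq: "est1 S n x = target S G" and def: "llr_defined S G (target S G)"
    and \<alpha>: "0 < \<alpha>" "\<alpha> < 1"
  shows "cond_prob_given (fold1 S n) (fold2 S n) G (\<lambda>\<omega>. target S G \<notin> CI_UI S n \<alpha> \<omega>) x = 0"
  using cond_miss_eq[OF x, of \<alpha>] def \<alpha> by (simp add: eq log_lik_ratio_def ln_div)

lemma est_err_eq:
  assumes "\<omega> \<in> space (sample S n G)"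
  shows "est_err S n G \<omega> \<in> carrier_vec (pdim S)"
    and "target S G + est_err S n G \<omega> = est1 S n (data1 S n \<omega>)"
    and "est_err S n G \<omega> = 0\<^sub>v (pdim S) \<Longrightarrow> est1 S n (data1 S n \<omega>) = target S G"
proof -
  have c: "est1 S n (data1 S n \<omega>) \<in> carrier_vec (pdim S)"
    by (intro Theta_carrier est1_in_Theta data1_space assms)
  show c2: "est_err S n G \<omega> \<in> carrier_vec (pdim S)"
    using c target_carrier by (simp add: est_err_def)
  show eq: "target S G + est_err S n G \<omega> = est1 S n (data1 S n \<omega>)"
    using c target_carrier by (intro eq_vecI) (auto simp: est_err_def)
  show "est_err S n G \<omega> = 0\<^sub>v (pdim S) \<Longrightarrow> est1 S n (data1 S n \<omega>) = target S G"
    using eq target_carrier by simp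
qed

lemma mnorm_est_err_measurable:
  assumes A: "A \<in> carrier_mat (pdim S) (pdim S)"
  shows "(\<lambda>\<omega>. mnorm A (est_err S n G \<omega>)) \<in> borel_measurable (sample S n G)"
proof -
  have comp [measurable]: "(\<lambda>\<omega>. est_err S n G \<omega> $ i) \<in> borel_measurable (sample S n G)" if i: "i < pdim S" for i
  proof -
    have "(\<lambda>\<omega>. est1 S n (data1 S n \<omega>) $ i - target S G $ i) \<in> borel_measurable (sample S n G)"
      using measurable_compose[OF data1_measurable est1_component_measurable[OF i]] by simp
    then show ?thesis
      by (rule measurable_cong[THEN iffD1, rotated]) (use i target_carrier in \<open>simp add: est_err_def\<close>)
  qed
  have "(\<lambda>\<omega>. sqrt (\<Sum>i<pdim S. \<Sum>j<pdim S. est_err S n G \<omega> $ i * (A $$ (i, j) * est_err S n G \<omega> $ j)))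
      \<in> borel_measurable (sample S n G)"
    by measurable
  then show ?thesis
    by (rule measurable_cong[THEN iffD1, rotated])
      (simp add: mnorm_def quadratic_form_eq_sum[OF A est_err_eq(1)])
qed

text \<open>The QMD and moment bounds are taken at the radius a = \<open>mnorm I h\<close>, the
  smallest one whose shifts contain h, so the resulting L2 bound scales with a rather than with
  \<open>rad\<close>.\<close>

lemma L2_close_of_conditions:
  fixes l :: "'z measure \<Rightarrow> 'z \<Rightarrow> real vec"
  defines "I \<equiv> info_mat (pdim S) G (l G)"
  assumes p: "2 \<le> p" and K: "G \<in> K" and Q: "QMD S K l \<phi>" and M: "Moment S p K l L \<nu>"
    and Sc: "Score_moment S p K l L"
    and h: "h \<in> carrier_vec (pdim S)" "target S G + h \<in> Theta S"
    and a: "0 < mnorm I h" "mnorm I h \<le> rad S n"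
  shows "(\<integral>\<^sup>+ z. ennreal ((log_lik_ratio S G (target S G + h) z - h \<bullet> l G z)\<^sup>2) \<partial>G)
     \<le> ennreal (4 * (max (L n G) 1 * mnorm I h * \<nu> G (mnorm I h))\<^sup>2 + 12 * \<phi> G (mnorm I h))"
proof -
  define a where "a = mnorm I h"
  have a': "0 < a" "0 \<le> a" "a \<le> rad S n" using a by (auto simp: a_def)
  have sh: "h \<in> shifts S G I a" "h \<in> shifts S G I (rad S n)"
    using h a by (auto simp: shifts_def a_def)
  have l: "\<And>z. z \<in> space G \<Longrightarrow> l G z \<in> carrier_vec (pdim S)"
    "\<And>i. i < pdim S \<Longrightarrow> (\<lambda>z. l G z $ i) \<in> borel_measurable G"
    "\<And>i. i < pdim S \<Longrightarrow> integrable G (\<lambda>z. (l G z $ i)\<^sup>2)"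
    using Q K by (auto simp: QMD_def)
  have X [measurable]: "(\<lambda>z. h \<bullet> l G z) \<in> borel_measurable G"
    by (rule score_measurable[OF l h(1)])
  have [measurable]: "dens S (target S G + h) \<in> borel_measurable G" "dens S (target S G) \<in> borel_measurable G"
    using dens_measurable h(2) target_in_Theta by auto
  have R [measurable]: "root_remainder S G (l G) h \<in> borel_measurable G"
    unfolding root_remainder_def[abs_def] by measurable
  have phi0: "0 \<le> \<phi> G a" and nu0: "0 \<le> \<nu> G a"
    using Q M K a' by (auto simp: QMD_def Moment_def is_modulus_def)
  have QG: "(SUP h\<in>shifts S G I a. \<integral>\<^sup>+ z. ennreal ((root_remainder S G (l G) h z)\<^sup>2) \<partial>G) \<le> ennreal (\<phi> G a)"
    using Q K a' n unfolding QMD_def I_def by blast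
  have MG: "(SUP h\<in>shifts S G I a. Lq_norm G (ereal p) (root_remainder S G (l G) h)) \<le> ennreal (L n G * a)"
    "\<forall>h\<in>shifts S G I a. llr_defined S G (target S G + h)"
    "(SUP h\<in>shifts S G I a. Lq_norm G (ereal (2 * p) / ereal (p - 2)) (log_lik_ratio S G (target S G + h))) \<le> ennreal (\<nu> G a)"
    using M K a' n unfolding Moment_def I_def by blast+
  have SG: "Lq_norm G (ereal p) (\<lambda>z. h \<bullet> l G z) \<le> ennreal (max (L n G) 1 * a)"
    using Sc K n sh(2) unfolding Score_moment_def I_def a_def by blast
  \<comment> \<open>Where both densities are positive, exp (W/2) is the ratio of their roots, so
    \<open>root_remainder\<close> is exactly what R leaves beyond the linear term.\<close>
  have "AE z in G. exp (log_lik_ratio S G (target S G + h) z / 2) - 1 = (h \<bullet> l G z) / 2 + root_remainder S G (l G) h z"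
  proof -
    have "AE z in G. 0 < dens S (target S G + h) z \<and> 0 < dens S (target S G) z"
      using MG(2) sh(1) by (simp add: llr_defined_def)
    then show ?thesis
    proof eventually_elim
      case (elim z)
      have eq: "log_lik_ratio S G (target S G + h) z / 2
          = ln (sqrt (dens S (target S G + h) z)) - ln (sqrt (dens S (target S G) z))"
        using elim by (simp add: log_lik_ratio_def ln_sqrt diff_divide_distrib)
      show ?case unfolding eq root_remainder_def using elim by (simp add: exp_diff)
    qed
  qed
  moreover have "Lq_norm G (ereal p) (root_remainder S G (l G) h) \<le> ennreal (max (L n G) 1 * a)"
  proof -
    have "Lq_norm G (ereal p) (root_remainder S G (l G) h) \<le> ennreal (L n G * a)"
      by (rule order_trans[OF SUP_upper[OF sh(1)] MG(1)])
    also have "\<dots> \<le> ennreal (max (L n G) 1 * a)"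
      using a' by (intro ennreal_leI mult_right_mono) auto
    finally show ?thesis .
  qed
  moreover have "Lq_norm G (ereal (2 * p) / ereal (p - 2)) (log_lik_ratio S G (target S G + h)) \<le> ennreal (\<nu> G a)"
    by (rule order_trans[OF SUP_upper[OF sh(1)] MG(3)])
  moreover have "(\<integral>\<^sup>+ z. ennreal ((root_remainder S G (l G) h z)\<^sup>2) \<partial>G) \<le> ennreal (\<phi> G a)"
    by (rule order_trans[OF SUP_upper[OF sh(1)] QG])
  ultimately show ?thesis unfolding a_def[symmetric]
    using a' phi0 nu0 SG
    by (intro log_linear_L2_close[OF p log_lik_ratio_measurable[OF h(2)] X R]) auto
qed

text \<open>Taking the radius equal to the V-norm of h puts the error at that norm, where it can be
  compared with the quadratic term.\<close>

lemma Hessian_at: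
  assumes H: "Hessian S K V w" and K: "G \<in> K" and h: "h \<in> carrier_vec (pdim S)" "target S G + h \<in> Theta S"
    and v: "mnorm (V G) h \<le> rad S n"
  shows "llr_defined S G (target S G + h)" "integrable G (log_lik_ratio S G (target S G + h))"
    "\<bar>(\<integral>z. log_lik_ratio S G (target S G + h) z \<partial>G) + (mnorm (V G) h)\<^sup>2 / 2\<bar> \<le> w G (mnorm (V G) h)"
proof -
  define v where "v = mnorm (V G) h"
  have V: "positive_definite_mat (pdim S) (V G)" using H K by (simp add: Hessian_def)
  have v': "0 \<le> v" "v \<le> rad S n" using mnorm_pd_nonneg[OF V h(1)] v by (auto simp: v_def)
  have sh: "h \<in> shifts S G (V G) v" using h by (auto simp: shifts_def v_def)
  have w0: "0 \<le> w G v" using H K v' by (auto simp: Hessian_def is_modulus_def)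
  have *: "(\<forall>h\<in>shifts S G (V G) v. llr_defined S G (target S G + h) \<and>
              integrable G (log_lik_ratio S G (target S G + h))) \<and>
           (SUP h\<in>shifts S G (V G) v.
              ennreal \<bar>(\<integral>z. log_lik_ratio S G (target S G + h) z \<partial>G) + (h \<bullet> (V G *\<^sub>v h)) / 2\<bar>)
             \<le> ennreal (w G v)"
    using H K v' n unfolding Hessian_def by blast
  show "llr_defined S G (target S G + h)" "integrable G (log_lik_ratio S G (target S G + h))"
    using * sh by auto
  have "ennreal \<bar>(\<integral>z. log_lik_ratio S G (target S G + h) z \<partial>G) + (h \<bullet> (V G *\<^sub>v h)) / 2\<bar> \<le> ennreal (w G v)"
    by (rule order_trans[OF SUP_upper[OF sh]]) (use * in auto)
  then show "\<bar>(\<integral>z. log_lik_ratio S G (target S G + h) z \<partial>G) + (mnorm (V G) h)\<^sup>2 / 2\<bar> \<le> w G (mnorm (V G) h)"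
    using w0 by (simp add: mnorm_pd_power2[OF V h(1)] v_def)
qed

text \<open>\<open>T\<close> is \<open>z\<^sub>\<alpha> + r\<close> of the theorem; the cut-off that the studentised sum really has to exceed differs
  from it by a factor close to \<open>1\<close>, and the normal distribution function is insensitive to such
  factors uniformly in \<open>T\<close>.\<close>

lemma cond_miss_bound:
  fixes x
  defines "\<theta> \<equiv> est1 S n x"
  defines "W \<equiv> log_lik_ratio S G \<theta>"
  assumes x: "x \<in> space D1" and \<alpha>: "0 < \<alpha>" "\<alpha> < 1"
    and [measurable]: "X \<in> borel_measurable G"
    and X2: "integrable G (\<lambda>z. (X z)\<^sup>2)" "(\<integral>z. (X z)\<^sup>2 \<partial>G) = a\<^sup>2" and a: "0 < a"
    and close: "(\<integral>\<^sup>+ z. ennreal ((W z - X z)\<^sup>2) \<partial>G) \<le> ennreal ((a * E)\<^sup>2)" and E: "0 < E" "E \<le> 1"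
    and def: "llr_defined S G \<theta>"
    and mean: "\<bar>(\<integral>z. W z \<partial>G) + q / 2\<bar> \<le> q * \<epsilon>" and q: "0 \<le> q" "q \<le> d * a" and \<epsilon>: "0 \<le> \<epsilon>"
    and small: "2 * \<epsilon> + (3 * E + d\<^sup>2) \<le> 1 / 4"
  shows "\<bar>llr_sd S G \<theta> / a - 1\<bar> \<le> 3 * E + d\<^sup>2"
    and "ennreal \<bar>cond_prob_given (fold1 S n) (fold2 S n) G (\<lambda>\<omega>. target S G \<notin> CI_UI S n \<alpha> \<omega>) x
          - (1 - cdf std_normal_distribution (ln (1 / \<alpha>) / (sqrt n * a) + sqrt n * q / (2 * a)))\<bar>
        \<le> Delta_BE S n G x + ennreal (2 * (2 * \<epsilon> + (3 * E + d\<^sup>2)))"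
    and "\<bar>\<integral>z. W z \<partial>G\<bar> \<le> d * a"
proof -
  have \<theta>: "\<theta> \<in> Theta S" unfolding \<theta>_def by (rule est1_in_Theta[OF x])
  have [measurable]: "W \<in> borel_measurable G" unfolding W_def by (rule log_lik_ratio_measurable[OF \<theta>])
  define \<rho> where "\<rho> = 3 * E + d\<^sup>2"
  have \<rho>: "0 \<le> \<rho>" "\<rho> \<le> 1 / 4" "\<epsilon> \<le> 1 / 2" using E \<epsilon> small zero_le_power2[of d] unfolding \<rho>_def by linarith+
  \<comment> \<open>Since \<epsilon> \<le> 1/2, the mean of W is at most q/2 + q/2 = q in absolute
    value, hence at most d a.\<close>
  have "q * \<epsilon> \<le> q * (1 / 2)" using q \<rho> by (intro mult_left_mono) auto
  then show m: "\<bar>\<integral>z. W z \<partial>G\<bar> \<le> d * a" using mean q by linarith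
  have "llr_sd S G \<theta> = sqrt (G.variance W)" by (simp add: llr_sd_def W_def)
  then show sd: "\<bar>llr_sd S G \<theta> / a - 1\<bar> \<le> 3 * E + d\<^sup>2"
    using G.sd_ratio_of_close[OF _ _ X2 a close E m] by simp
  then have sd': "\<bar>llr_sd S G \<theta> / a - 1\<bar> \<le> \<rho>" by (simp add: \<rho>_def)
  then have "1 / 2 \<le> llr_sd S G \<theta> / a" using \<rho> by linarith
  then have sd0: "0 < llr_sd S G \<theta>" using a by (simp add: field_simps)
  have L: "0 < ln (1 / \<alpha>)" using \<alpha> by simp
  have sn: "0 < sqrt n" using n by simp
  define T where "T = ln (1 / \<alpha>) / (sqrt n * a) + sqrt n * q / (2 * a)"
  define t where "t = (ln (1 / \<alpha>) - (sqrt n)\<^sup>2 * (\<integral>z. W z \<partial>G)) / (sqrt n * llr_sd S G \<theta>)"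
  have T: "0 < T" "\<bar>t - T\<bar> \<le> 2 * (2 * \<epsilon> + \<rho>) * T"
    using threshold_relative_error[OF L sn a q(1) mean \<epsilon> sd'] \<rho> by (auto simp: T_def t_def)
  have rel: "\<bar>cdf std_normal_distribution t - cdf std_normal_distribution T\<bar> \<le> 2 * (2 * \<epsilon> + \<rho>)"
    by (rule cdf_std_normal_relative_error[OF T]) (use small in \<open>simp add: \<rho>_def\<close>)
  define c where "c = cond_prob_given (fold1 S n) (fold2 S n) G (\<lambda>\<omega>. target S G \<notin> CI_UI S n \<alpha> \<omega>) x"
  have "ennreal \<bar>c - (1 - cdf std_normal_distribution t)\<bar> \<le> Delta_BE S n G x"
    unfolding c_def t_def W_def \<theta>_def
    by (rule cond_miss_normal_approx[OF x]) (use def sd0 in \<open>auto simp: \<theta>_def\<close>)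
  moreover have "\<bar>c - (1 - cdf std_normal_distribution T)\<bar>
      \<le> \<bar>c - (1 - cdf std_normal_distribution t)\<bar> + 2 * (2 * \<epsilon> + \<rho>)" using rel by linarith
  then have "ennreal \<bar>c - (1 - cdf std_normal_distribution T)\<bar>
      \<le> ennreal \<bar>c - (1 - cdf std_normal_distribution t)\<bar> + ennreal (2 * (2 * \<epsilon> + \<rho>))"
    using \<epsilon> \<rho> by (subst ennreal_plus[symmetric]) (auto intro!: ennreal_leI simp del: ennreal_plus)
  ultimately have "ennreal \<bar>c - (1 - cdf std_normal_distribution T)\<bar> \<le> Delta_BE S n G x + ennreal (2 * (2 * \<epsilon> + \<rho>))"
    by (meson add_right_mono order_trans)
  then show "ennreal \<bar>cond_prob_given (fold1 S n) (fold2 S n) G (\<lambda>\<omega>. target S G \<notin> CI_UI S n \<alpha> \<omega>) x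
          - (1 - cdf std_normal_distribution (ln (1 / \<alpha>) / (sqrt n * a) + sqrt n * q / (2 * a)))\<bar>
        \<le> Delta_BE S n G x + ennreal (2 * (2 * \<epsilon> + (3 * E + d\<^sup>2)))"
    by (simp add: c_def T_def \<rho>_def)
qed

text \<open>The standardised W has mean exactly 0 and variance exactly 1, so the central limit bound
  holds at every t simultaneously. That bound enters as a hypothesis because \<eta> has to be chosen
  before n and G.\<close>

lemma Delta_BE_le:
  fixes x
  defines "\<theta> \<equiv> est1 S n x"
  defines "W \<equiv> log_lik_ratio S G \<theta>"
  assumes clt: "\<forall>(G :: 'z measure) X (J :: nat set) u.
     prob_space G \<longrightarrow> X \<in> borel_measurable G \<longrightarrow> integrable G (\<lambda>z. (X z)\<^sup>2) \<longrightarrow>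
     (\<integral>z. X z \<partial>G) = 0 \<longrightarrow> (\<integral>z. (X z)\<^sup>2 \<partial>G) = 1 \<longrightarrow> finite J \<longrightarrow> 1 / \<eta> \<le> real (card J) \<longrightarrow>
     (\<integral>z. (X z)\<^sup>2 * min 1 (\<bar>X z\<bar> / (\<eta> * sqrt (card J))) \<partial>G) \<le> \<eta> \<longrightarrow>
     \<bar>measure (PiM J (\<lambda>_. G)) {y \<in> space (PiM J (\<lambda>_. G)). (\<Sum>i\<in>J. X (y i)) / sqrt (card J) \<le> u}
        - cdf std_normal_distribution u\<bar> \<le> e"
    and x: "x \<in> space D1" and \<sigma>: "0 < llr_sd S G \<theta>" and W2: "integrable G (\<lambda>z. (W z)\<^sup>2)"
    and n\<eta>: "1 / \<eta> \<le> real n"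
    and lind: "(\<integral>z. ((W z - (\<integral>z. W z \<partial>G)) / llr_sd S G \<theta>)\<^sup>2
       * min 1 (\<bar>(W z - (\<integral>z. W z \<partial>G)) / llr_sd S G \<theta>\<bar> / (\<eta> * sqrt n)) \<partial>G) \<le> \<eta>"
  shows "Delta_BE S n G x \<le> ennreal e"
proof -
  define m where "m = (\<integral>z. W z \<partial>G)"
  define U where "U z = (W z - m) / llr_sd S G \<theta>" for z
  have \<theta>: "\<theta> \<in> Theta S" unfolding \<theta>_def by (rule est1_in_Theta[OF x])
  have [measurable]: "W \<in> borel_measurable G" unfolding W_def by (rule log_lik_ratio_measurable[OF \<theta>])
  have W1: "integrable G W" by (rule G.square_integrable_imp_integrable) (use W2 in auto)
  have Wm2: "integrable G (\<lambda>z. (W z - m)\<^sup>2)"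
    unfolding power2_diff using W1 W2 by simp
  have U: "U \<in> borel_measurable G" unfolding U_def[abs_def] by measurable
  have U2: "integrable G (\<lambda>z. (U z)\<^sup>2)" using Wm2 by (simp add: U_def power_divide)
  have U0: "(\<integral>z. U z \<partial>G) = 0" using W1 by (simp add: U_def m_def G.prob_space)
  have var: "(\<integral>z. (W z - m)\<^sup>2 \<partial>G) = (llr_sd S G \<theta>)\<^sup>2"
    by (simp add: llr_sd_def W_def m_def)
  have U1: "(\<integral>z. (U z)\<^sup>2 \<partial>G) = 1" using \<sigma> by (simp add: U_def power_divide var)
  have "\<bar>measure D2 {y \<in> space D2. (\<Sum>i\<in>fold2 S n. U (y i)) / sqrt n \<le> t} - cdf std_normal_distribution t\<bar> \<le> e" for t
    using clt[rule_format, OF prob_G U U2 U0 U1, of "fold2 S n" t] folds n\<eta> lind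
    by (simp add: U_def m_def)
  then show ?thesis
    unfolding Delta_BE_eq[OF x] \<theta>_def[symmetric] W_def[symmetric] m_def[symmetric] U_def[symmetric]
    by (intro SUP_least ennreal_leI)
qed

text \<open>The quantile cancels. For a = 0 the first quotient is \<infinity>, because
  log(1/\<alpha>) > 0, and the second is not -\<infinity>, so the argument of \<open>Phi\<close> is
  \<infinity>.\<close>

lemma Phi_r_UI:
  assumes a: "mnorm I (est_err S n G \<omega>) = a" "0 \<le> a" and \<alpha>: "0 < \<alpha>" "\<alpha> < 1"
  shows "Phi (ereal (z_quantile \<alpha>) + r_UI S n \<alpha> G I V \<omega>)
    = (if a = 0 then 1 else cdf std_normal_distribution
         (ln (1 / \<alpha>) / (sqrt n * a) + sqrt n * (mnorm V (est_err S n G \<omega>))\<^sup>2 / (2 * a)))"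
proof (cases "a = 0")
  case True
  interpret N: real_distribution std_normal_distribution by (rule real_dist_normal_dist)
  have "ereal (ln (1 / \<alpha>)) / ereal 0 = \<infinity>" using \<alpha> by (simp add: divide_ereal_def)
  moreover have "ereal (sqrt n * (mnorm V (est_err S n G \<omega>))\<^sup>2) / ereal 0 \<noteq> - \<infinity>"
    by (simp add: divide_ereal_def)
  ultimately have "ereal (z_quantile \<alpha>) + r_UI S n \<alpha> G I V \<omega> = \<infinity>"
    using True a by (simp add: r_UI_def Let_def)
  then show ?thesis using True N.prob_space by (simp add: Phi_def)
next
  case False
  with a have "0 < sqrt n * a" "0 < 2 * a" using n by auto
  then show ?thesis using False a n by (simp add: r_UI_def Let_def)
qed

text \<open>The conditional error is at most 1 on the bad event, whose probability is
  \<open>tau_C\<close>, and at most H + c off it. H is left open so that both parts can use the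
  bound: part (i) takes \<open>Delta_BE\<close>, part (ii) takes 0 and absorbs the central limit
  error into c.\<close>

lemma miscoverage_bound:
  assumes I: "I \<in> carrier_mat (pdim S) (pdim S)" and I0: "\<And>h. h \<in> carrier_vec (pdim S) \<Longrightarrow> 0 \<le> mnorm I h"
    and V: "positive_definite_mat (pdim S) V" and \<alpha>: "0 < \<alpha>" "\<alpha> < 1" and \<delta>: "0 \<le> \<delta>"
    and def: "llr_defined S G (target S G)"
    and good: "\<And>\<omega> h. \<omega> \<in> space (sample S n G) \<Longrightarrow> h = est_err S n G \<omega> \<Longrightarrow>
       0 < mnorm I h \<Longrightarrow> mnorm I h \<le> \<delta> \<Longrightarrow> mnorm V h \<le> \<delta> \<Longrightarrow> (mnorm V h)\<^sup>2 \<le> \<delta> * mnorm I h \<Longrightarrow>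
       ennreal \<bar>cond_prob_given (fold1 S n) (fold2 S n) G (\<lambda>\<omega>. target S G \<notin> CI_UI S n \<alpha> \<omega>) (data1 S n \<omega>)
          - (1 - cdf std_normal_distribution
               (ln (1 / \<alpha>) / (sqrt n * mnorm I h) + sqrt n * (mnorm V h)\<^sup>2 / (2 * mnorm I h)))\<bar>
         \<le> H \<omega> + ennreal c"
  shows "ennreal \<bar>miscoverage S n \<alpha> G - miscoverage_approx S n \<alpha> G I V\<bar>
      \<le> (\<integral>\<^sup>+ \<omega>. H \<omega> \<partial>sample S n G) + (ennreal c + ennreal (tau_C S n G I V \<delta>))"
    and "\<bar>miscoverage S n \<alpha> G - miscoverage_approx S n \<alpha> G I V\<bar> \<le> 1"
proof -
  interpret P: prob_space "sample S n G" by (rule prob_sample)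
  interpret N: real_distribution std_normal_distribution by (rule real_dist_normal_dist)
  have Vc: "V \<in> carrier_mat (pdim S) (pdim S)" using V by (simp add: positive_definite_mat_def)
  define M where "M = sample S n G"
  define h where "h \<omega> = est_err S n G \<omega>" for \<omega>
  define a where "a \<omega> = mnorm I (h \<omega>)" for \<omega>
  define v where "v \<omega> = mnorm V (h \<omega>)" for \<omega>
  have hc: "h \<omega> \<in> carrier_vec (pdim S)" if "\<omega> \<in> space M" for \<omega>
    using est_err_eq(1) that by (simp add: h_def M_def)
  have a0: "0 \<le> a \<omega>" if "\<omega> \<in> space M" for \<omega> unfolding a_def by (rule I0[OF hc[OF that]])
  have [measurable]: "a \<in> borel_measurable M" "v \<in> borel_measurable M"
    unfolding a_def[abs_def] v_def[abs_def] h_def M_def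
    by (intro mnorm_est_err_measurable I Vc)+
  have [measurable]: "cdf std_normal_distribution \<in> borel_measurable borel"
    by (intro borel_measurable_mono monoI N.cdf_nondecreasing)
  define F where "F \<omega> = (if a \<omega> = 0 then 1 else cdf std_normal_distribution
         (ln (1 / \<alpha>) / (sqrt n * a \<omega>) + sqrt n * (v \<omega>)\<^sup>2 / (2 * a \<omega>)))" for \<omega>
  have F: "Phi (ereal (z_quantile \<alpha>) + r_UI S n \<alpha> G I V \<omega>) = F \<omega>" if "\<omega> \<in> space M" for \<omega>
    unfolding F_def v_def h_def
    by (rule Phi_r_UI[OF _ a0[OF that] \<alpha>]) (simp add: a_def h_def)
  have Fm [measurable]: "F \<in> borel_measurable M" unfolding F_def[abs_def] by measurable
  have F01: "0 \<le> F \<omega>" "F \<omega> \<le> 1" for \<omega> by (auto simp: F_def N.cdf_nonneg N.cdf_bounded_prob)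
  define q where "q \<omega> = cond_prob_given (fold1 S n) (fold2 S n) G (\<lambda>\<omega>. target S G \<notin> CI_UI S n \<alpha> \<omega>) (data1 S n \<omega>)" for \<omega>
  have q01: "0 \<le> q \<omega>" "q \<omega> \<le> 1" for \<omega>
    using prob_space.prob_le_1[OF prob_D2] by (auto simp: q_def cond_prob_given_def)
  have qm [measurable]: "q \<in> borel_measurable M"
    using cond_prob_given_measurable[OF prob_G folds(4,5,1), folded sample_eq, OF miss_sets]
    by (simp add: q_def[abs_def] M_def)
  have misc: "miscoverage S n \<alpha> G = (\<integral>\<omega>. q \<omega> \<partial>M)"
    using prob_eq_integral_cond_prob_given[OF prob_G folds(4,5,1), folded sample_eq, OF miss_sets]
    by (simp add: q_def[abs_def] M_def miscoverage_def)
  have approx: "miscoverage_approx S n \<alpha> G I V = 1 - (\<integral>\<omega>. F \<omega> \<partial>M)"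
    using F by (simp add: miscoverage_approx_def M_def cong: Bochner_Integration.integral_cong)
  have PM: "prob_space M" by (simp add: M_def P.prob_space_axioms)
  interpret PM: prob_space M by (rule PM)
  have iq: "integrable M q" by (rule PM.integrable_const_bound[of _ 1]) (use q01 in auto)
  have iF: "integrable M F" by (rule PM.integrable_const_bound[of _ 1]) (use F01 in auto)
  have diff: "miscoverage S n \<alpha> G - miscoverage_approx S n \<alpha> G I V = (\<integral>\<omega>. q \<omega> - (1 - F \<omega>) \<partial>M)"
    using iq iF by (simp add: misc approx PM.prob_space)
  have f1: "\<bar>q \<omega> - (1 - F \<omega>)\<bar> \<le> 1" for \<omega> using q01[of \<omega>] F01[of \<omega>] by linarith
  have if1: "integrable M (\<lambda>\<omega>. \<bar>q \<omega> - (1 - F \<omega>)\<bar>)" using iq iF by simp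
  have absle: "\<bar>miscoverage S n \<alpha> G - miscoverage_approx S n \<alpha> G I V\<bar> \<le> (\<integral>\<omega>. \<bar>q \<omega> - (1 - F \<omega>)\<bar> \<partial>M)"
    unfolding diff by (rule integral_abs_bound)
  also have "\<dots> \<le> (\<integral>\<omega>. 1 \<partial>M)" by (intro integral_mono if1 f1) simp
  finally show "\<bar>miscoverage S n \<alpha> G - miscoverage_approx S n \<alpha> G I V\<bar> \<le> 1" by (simp add: PM.prob_space)
  \<comment> \<open>The real-valued form of the event in \<open>tau_C\<close>. The branch a = 0
    spells out the extended quotient: v^2/0 is \<infinity> for v \<noteq> 0 and 0 for v = 0.\<close>
  define bad where "bad = {\<omega> \<in> space M. \<delta> < a \<omega> \<or> \<delta> < v \<omega> \<or> (if a \<omega> = 0 then v \<omega> \<noteq> 0 else \<delta> < (v \<omega>)\<^sup>2 / a \<omega>)}"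
  have bad_sets [measurable]: "bad \<in> sets M" unfolding bad_def by measurable
  have bad_iff: "ereal \<delta> < Max {ereal (a \<omega>), ereal (v \<omega>), ereal ((v \<omega>)\<^sup>2) / ereal (a \<omega>)}
      \<longleftrightarrow> \<delta> < a \<omega> \<or> \<delta> < v \<omega> \<or> (if a \<omega> = 0 then v \<omega> \<noteq> 0 else \<delta> < (v \<omega>)\<^sup>2 / a \<omega>)" if "\<omega> \<in> space M" for \<omega>
  proof -
    have "ereal \<delta> < ereal ((v \<omega>)\<^sup>2) / ereal (a \<omega>) \<longleftrightarrow> (if a \<omega> = 0 then v \<omega> \<noteq> 0 else \<delta> < (v \<omega>)\<^sup>2 / a \<omega>)"
      using \<delta> by (auto simp: divide_ereal_def divide_inverse)
    then show ?thesis by (subst Max_gr_iff) auto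
  qed
  have tau: "tau_C S n G I V \<delta> = measure M bad"
    unfolding tau_C_def Let_def M_def[symmetric] h_def[symmetric] a_def[symmetric] v_def[symmetric] bad_def
    by (intro arg_cong[where f="measure M"] Collect_cong) (simp only: bad_iff cong: conj_cong)
  have le: "ennreal \<bar>q \<omega> - (1 - F \<omega>)\<bar> \<le> H \<omega> + (ennreal c + indicator bad \<omega>)" if \<omega>: "\<omega> \<in> space M" for \<omega>
  proof (cases "\<omega> \<in> bad")
    case True
    have "ennreal \<bar>q \<omega> - (1 - F \<omega>)\<bar> \<le> 1" using f1[of \<omega>] by simp
    also have "\<dots> \<le> H \<omega> + (ennreal c + indicator bad \<omega>)" using True by (simp add: add_increasing)
    finally show ?thesis .
  next
    case nb: False
    show ?thesis
    proof (cases "h \<omega> = 0\<^sub>v (pdim S)")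
      case True
      then have "est1 S n (data1 S n \<omega>) = target S G"
        using est_err_eq(3) \<omega> by (simp add: h_def M_def)
      then have "q \<omega> = 0" unfolding q_def
        using \<omega> by (intro cond_miss_at_target[OF data1_space _ def \<alpha>]) (auto simp: M_def)
      moreover have "a \<omega> = 0" using True I by (simp add: a_def mnorm_def quadratic_form_eq_sum)
      ultimately show ?thesis by (simp add: F_def)
    next
      case False
      \<comment> \<open>Positive definiteness excludes a = 0 here: a nonzero h of vanishing I-norm
        would make the third term of the maximum infinite and put the sample into the bad
        event.\<close>
      then have v0: "0 < v \<omega>" unfolding v_def by (intro mnorm_pd_pos[OF V hc[OF \<omega>]])
      then have *: "a \<omega> \<noteq> 0" "a \<omega> \<le> \<delta>" "v \<omega> \<le> \<delta>" "(v \<omega>)\<^sup>2 / a \<omega> \<le> \<delta>"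
        using nb \<omega> by (auto simp: bad_def not_less split: if_splits)
      then have "0 < a \<omega>" using a0[OF \<omega>] by simp
      with * have "(v \<omega>)\<^sup>2 \<le> \<delta> * a \<omega>" by (simp add: field_simps)
      from good[OF _ h_def, of \<omega>] this \<open>0 < a \<omega>\<close> * \<omega>
      show ?thesis using nb by (simp add: a_def v_def q_def F_def M_def h_def)
    qed
  qed
  have "ennreal \<bar>miscoverage S n \<alpha> G - miscoverage_approx S n \<alpha> G I V\<bar>
      \<le> ennreal (\<integral>\<omega>. \<bar>q \<omega> - (1 - F \<omega>)\<bar> \<partial>M)" by (rule ennreal_leI[OF absle])
  also have "\<dots> = (\<integral>\<^sup>+ \<omega>. ennreal \<bar>q \<omega> - (1 - F \<omega>)\<bar> \<partial>M)"
    by (rule nn_integral_eq_integral[symmetric, OF if1]) simp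
  also have "\<dots> \<le> (\<integral>\<^sup>+ \<omega>. H \<omega> \<partial>M) + (\<integral>\<^sup>+ \<omega>. ennreal c + indicator bad \<omega> \<partial>M)"
    by (rule nn_integral_le_add[OF _ _ le]) (auto simp: ennreal_add_eq_top less_top[symmetric] indicator_def)
  also have "(\<integral>\<^sup>+ \<omega>. ennreal c + indicator bad \<omega> \<partial>M) = ennreal c + ennreal (tau_C S n G I V \<delta>)"
    by (simp add: nn_integral_add tau PM.emeasure_eq_measure PM.prob_space)
  finally show "ennreal \<bar>miscoverage S n \<alpha> G - miscoverage_approx S n \<alpha> G I V\<bar>
      \<le> (\<integral>\<^sup>+ \<omega>. H \<omega> \<partial>sample S n G) + (ennreal c + ennreal (tau_C S n G I V \<delta>))" by (simp add: M_def)
qed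

lemma QMD_score:
  assumes "QMD S K l \<phi>" "G \<in> K"
  shows "\<And>z. z \<in> space G \<Longrightarrow> l G z \<in> carrier_vec (pdim S)"
    "\<And>i. i < pdim S \<Longrightarrow> (\<lambda>z. l G z $ i) \<in> borel_measurable G"
    "\<And>i. i < pdim S \<Longrightarrow> integrable G (\<lambda>z. (l G z $ i)\<^sup>2)"
  using assms by (auto simp: QMD_def)

text \<open>The zero shift is admissible at every nonnegative radius.\<close>

lemma target_llr_defined:
  assumes H: "Hessian S K V w" and K: "G \<in> K"
  shows "llr_defined S G (target S G)"
proof -
  have V: "positive_definite_mat (pdim S) (V G)" using H K by (simp add: Hessian_def)
  have "0 \<le> rad S n" using valid n by (simp add: valid_problem_def)
  then have "llr_defined S G (target S G + 0\<^sub>v (pdim S))"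
    using target_carrier target_in_Theta mnorm_pd_zero[OF V]
    by (intro Hessian_at(1)[OF H K]) auto
  then show ?thesis using target_carrier by simp
qed

lemma miscoverage_nonasymptotic:
  fixes l :: "'z measure \<Rightarrow> 'z \<Rightarrow> real vec"
  defines "I \<equiv> info_mat (pdim S) G (l G)"
  assumes p: "2 \<le> p" and \<alpha>: "0 < \<alpha>" "\<alpha> < 1"
    and Q: "QMD S {G} l \<phi>" and He: "Hessian S {G} V w" and M: "Moment S p {G} l L \<nu>"
    and Sc: "Score_moment S p {G} l L"
    and mono_phi: "mono_on {0<..rad S n} (\<lambda>\<delta>. \<phi> G \<delta> / \<delta>\<^sup>2)"
    and mono_w: "mono_on {0<..rad S n} (\<lambda>\<delta>. w G \<delta> / \<delta>\<^sup>2)"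
  shows "ennreal \<bar>miscoverage S n \<alpha> G - miscoverage_approx S n \<alpha> G I (V G)\<bar>
     \<le> min 1 ((\<integral>\<^sup>+ \<omega>. Delta_BE S n G (data1 S n \<omega>) \<partial>sample S n G) +
              (INF \<delta>\<in>{0<..rad S n}. ennreal (remainder_UI 100 (L n G) (\<phi> G) (w G) (\<nu> G) \<delta>) +
                 ennreal (tau_C S n G I (V G) \<delta>)))"
proof -
  have GK: "G \<in> {G}" by simp
  note l = QMD_score[OF Q GK]
  have I: "I \<in> carrier_mat (pdim S) (pdim S)" by (simp add: I_def)
  have I0: "0 \<le> mnorm I h" if "h \<in> carrier_vec (pdim S)" for h
    unfolding I_def by (rule mnorm_info_nonneg[OF l that])
  have V: "positive_definite_mat (pdim S) (V G)" using He by (simp add: Hessian_def)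
  define X where "X = ennreal \<bar>miscoverage S n \<alpha> G - miscoverage_approx S n \<alpha> G I (V G)\<bar>"
  define D where "D = (\<integral>\<^sup>+ \<omega>. Delta_BE S n G (data1 S n \<omega>) \<partial>sample S n G)"
  define R where "R \<delta> = remainder_UI 100 (L n G) (\<phi> G) (w G) (\<nu> G) \<delta>" for \<delta>
  define t where "t \<delta> = tau_C S n G I (V G) \<delta>" for \<delta>
  \<comment> \<open>Only the second conclusion is wanted, so H = \<infinity> discharges the premise
    on good samples.\<close>
  have X1: "X \<le> 1"
    using miscoverage_bound(2)[OF I I0 V \<alpha> order_refl target_llr_defined[OF He GK], of "\<lambda>_. \<infinity>" 0]
    by (simp add: X_def)
  have le: "X \<le> D + (ennreal (R \<delta>) + ennreal (t \<delta>))" if \<delta>: "\<delta> \<in> {0<..rad S n}" for \<delta>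
  proof -
    have \<delta>0: "0 < \<delta>" "0 \<le> \<delta>" "\<delta> \<le> rad S n" using \<delta> by auto
    define \<epsilon>\<phi> where "\<epsilon>\<phi> = \<phi> G \<delta> / \<delta>\<^sup>2"
    define \<epsilon> where "\<epsilon> = w G \<delta> / \<delta>\<^sup>2"
    define m where "m = max (L n G) 1"
    define s where "s = m * \<nu> G \<delta>"
    have nn: "0 \<le> \<phi> G \<delta>" "0 \<le> w G \<delta>" "0 \<le> \<nu> G \<delta>"
      using Q He M \<delta>0 by (auto simp: QMD_def Hessian_def Moment_def is_modulus_def)
    have m: "1 \<le> m" by (simp add: m_def)
    have pos: "0 \<le> \<epsilon>\<phi>" "0 \<le> \<epsilon>" "0 \<le> s" using nn m by (auto simp: \<epsilon>\<phi>_def \<epsilon>_def s_def)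
    have R: "R \<delta> = 100 * (\<delta>\<^sup>2 + sqrt \<epsilon>\<phi> + \<epsilon> + sqrt s)"
      by (simp add: R_def remainder_UI_def \<epsilon>\<phi>_def \<epsilon>_def s_def m_def)
    have pos': "0 < \<delta>\<^sup>2" "0 \<le> sqrt \<epsilon>\<phi>" "0 \<le> sqrt s" using \<delta>0 pos by auto
    show ?thesis
    \<comment> \<open>If R is at least 1, the trivial bound suffices. Otherwise its terms add up to
      less than 1/100, the smallness that the approximation lemmas require.\<close>
    proof (cases "1 \<le> R \<delta>")
      case True
      then have "X \<le> ennreal (R \<delta>)" using X1 by (metis ennreal_1 ennreal_leI order_trans)
      then show ?thesis by (simp add: add_increasing add_increasing2)
    next
      case False
      then have sm: "\<delta>\<^sup>2 + sqrt \<epsilon>\<phi> + \<epsilon> + sqrt s < 1 / 100" by (simp add: R)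
      then have "sqrt s < 1" using pos pos' by linarith
      then have "sqrt s * sqrt s \<le> sqrt s * 1" using pos' by (intro mult_left_mono) auto
      then have ss: "s \<le> sqrt s" using pos by simp
      \<comment> \<open>Dominates the relative L2 error, whose square is at most 4 s^2 + 12
        \<epsilon>\<phi>; the summand \<delta>^2 keeps E strictly positive when the other two
        vanish.\<close>
      define E where "E = 4 * s + 4 * sqrt \<epsilon>\<phi> + \<delta>\<^sup>2"
      \<comment> \<open>The origin of the constant: the error c equals 8 \<delta>^2 + 24 sqrt
        \<epsilon>\<phi> + 4 \<epsilon> + 24 s, and s \<le> sqrt s. The value 100 leaves room and
        also yields the smallness conditions.\<close>
      have arith: "0 < 4 * s' + 4 * r + b \<and> 4 * s' + 4 * r + b \<le> 1
          \<and> 2 * x + (3 * (4 * s' + 4 * r + b) + b) \<le> 1 / 4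
          \<and> 2 * (2 * x + (3 * (4 * s' + 4 * r + b) + b)) \<le> 100 * (b + r + x + y)"
        if "b + r + x + y < 1 / 100" "s' \<le> y" "0 < b" "0 \<le> r" "0 \<le> x" "0 \<le> s'" for b r x y s' :: real
        using that by (intro conjI) (simp_all add: algebra_simps)
      note ar = arith[OF sm ss pos'(1,2) pos(2,3), folded E_def]
      have E: "0 < E" "E \<le> 1" using ar by auto
      have E2: "16 * s\<^sup>2 + 16 * \<epsilon>\<phi> \<le> E\<^sup>2"
      proof -
        have "(4 * s)\<^sup>2 + (4 * sqrt \<epsilon>\<phi>)\<^sup>2 \<le> (4 * s + 4 * sqrt \<epsilon>\<phi>)\<^sup>2"
          using pos by (simp add: power2_sum)
        also have "\<dots> \<le> E\<^sup>2" using pos pos' by (intro power_mono) (auto simp: E_def)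
        finally show ?thesis using pos by (simp add: power_mult_distrib)
      qed
      define c where "c = 2 * (2 * \<epsilon> + (3 * E + \<delta>\<^sup>2))"
      have small: "2 * \<epsilon> + (3 * E + \<delta>\<^sup>2) \<le> 1 / 4" using ar by auto
      have cR: "c \<le> R \<delta>" using ar unfolding c_def R by auto
      have "X \<le> D + (ennreal c + ennreal (t \<delta>))"
        unfolding X_def D_def t_def
      proof (rule miscoverage_bound(1)[OF I I0 V \<alpha> \<delta>0(2) target_llr_defined[OF He GK]])
        fix \<omega> h
        assume \<omega>: "\<omega> \<in> space (sample S n G)" and h: "h = est_err S n G \<omega>"
          and a: "0 < mnorm I h" "mnorm I h \<le> \<delta>" and v: "mnorm (V G) h \<le> \<delta>"
          and va: "(mnorm (V G) h)\<^sup>2 \<le> \<delta> * mnorm I h"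
        define a where "a = mnorm I h"
        define v where "v = mnorm (V G) h"
        note * = est_err_eq[OF \<omega>, folded h]
        have x: "data1 S n \<omega> \<in> space D1" by (rule data1_space[OF \<omega>])
        have hT: "target S G + h \<in> Theta S" using *(2) est1_in_Theta[OF x] by simp
        have a': "0 < a" "a \<le> \<delta>" "a \<in> {0<..rad S n}" using a \<delta>0 by (auto simp: a_def)
        have "h \<noteq> 0\<^sub>v (pdim S)" using a I by (auto simp: mnorm_def quadratic_form_eq_sum)
        then have v': "0 < v" "v \<le> \<delta>" "v \<in> {0<..rad S n}"
          using mnorm_pd_pos[OF V *(1)] v \<delta>0 by (auto simp: v_def)
        \<comment> \<open>The ratio at the random radius a is moved up to \<delta> by monotonicity;
          the same happens below for w at v.\<close>
        have "\<phi> G a / a\<^sup>2 \<le> \<epsilon>\<phi>"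
          unfolding \<epsilon>\<phi>_def using mono_onD[OF mono_phi a'(3) \<delta> a'(2)] by simp
        then have phi_a: "\<phi> G a \<le> a\<^sup>2 * \<epsilon>\<phi>" using a' by (simp add: field_simps)
        have "w G v / v\<^sup>2 \<le> \<epsilon>"
          unfolding \<epsilon>_def using mono_onD[OF mono_w v'(3) \<delta> v'(2)] by simp
        then have w_v: "w G v \<le> v\<^sup>2 * \<epsilon>" using v' by (simp add: field_simps)
        have "mono_on {0..} (\<nu> G)" "0 \<le> \<nu> G a"
          using M a' by (auto simp: Moment_def is_modulus_def)
        then have nu_a: "0 \<le> \<nu> G a" "\<nu> G a \<le> \<nu> G \<delta>"
          using a' \<delta>0 by (auto elim!: mono_onD)
        have "(\<integral>\<^sup>+ z. ennreal ((log_lik_ratio S G (target S G + h) z - h \<bullet> l G z)\<^sup>2) \<partial>G)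
            \<le> ennreal (4 * (m * a * \<nu> G a)\<^sup>2 + 12 * \<phi> G a)"
          unfolding m_def a_def I_def
          by (rule L2_close_of_conditions[OF p GK Q M Sc *(1) hT]) (use a \<delta>0 in \<open>auto simp: I_def\<close>)
        also have "\<dots> \<le> ennreal ((a * E)\<^sup>2)"
        proof (rule ennreal_leI)
          have "(m * a * \<nu> G a)\<^sup>2 \<le> (m * a * \<nu> G \<delta>)\<^sup>2"
            using m a' nu_a by (intro power_mono mult_left_mono) auto
          also have "\<dots> = a\<^sup>2 * s\<^sup>2" by (simp add: s_def power_mult_distrib)
          finally have "4 * (m * a * \<nu> G a)\<^sup>2 + 12 * \<phi> G a \<le> 4 * (a\<^sup>2 * s\<^sup>2) + 12 * (a\<^sup>2 * \<epsilon>\<phi>)"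
            using phi_a by linarith
          also have "\<dots> = a\<^sup>2 * (4 * s\<^sup>2 + 12 * \<epsilon>\<phi>)" by (simp add: algebra_simps)
          also have "\<dots> \<le> a\<^sup>2 * (16 * s\<^sup>2 + 16 * \<epsilon>\<phi>)" using pos by (intro mult_left_mono) auto
          also have "\<dots> \<le> a\<^sup>2 * E\<^sup>2" by (intro mult_left_mono E2) auto
          finally show "4 * (m * a * \<nu> G a)\<^sup>2 + 12 * \<phi> G a \<le> (a * E)\<^sup>2" by (simp add: power_mult_distrib)
        qed
        finally have close: "(\<integral>\<^sup>+ z. ennreal ((log_lik_ratio S G (est1 S n (data1 S n \<omega>)) z - h \<bullet> l G z)\<^sup>2) \<partial>G)
            \<le> ennreal ((a * E)\<^sup>2)" by (simp add: *(2))
        note H = Hessian_at[OF He GK *(1) hT order_trans[OF v \<delta>0(3)], unfolded *(2)]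
        have mean: "\<bar>(\<integral>z. log_lik_ratio S G (est1 S n (data1 S n \<omega>)) z \<partial>G) + v\<^sup>2 / 2\<bar> \<le> v\<^sup>2 * \<epsilon>"
          using H(3) w_v by (simp add: v_def)
        show "ennreal \<bar>cond_prob_given (fold1 S n) (fold2 S n) G (\<lambda>\<omega>. target S G \<notin> CI_UI S n \<alpha> \<omega>) (data1 S n \<omega>)
          - (1 - cdf std_normal_distribution
               (ln (1 / \<alpha>) / (sqrt n * mnorm I h) + sqrt n * (mnorm (V G) h)\<^sup>2 / (2 * mnorm I h)))\<bar>
         \<le> Delta_BE S n G (data1 S n \<omega>) + ennreal c"
          unfolding c_def a_def[symmetric] v_def[symmetric]
          by (rule cond_miss_bound(2)[OF x \<alpha> score_measurable[OF l *(1)] score_square_integrable[OF l *(1)]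
              _ a'(1) close E H(1) mean _ _ pos(2) small])
            (use score_second_moment[OF l *(1)] va in \<open>auto simp: a_def v_def I_def\<close>)
      qed
      also have "\<dots> \<le> D + (ennreal (R \<delta>) + ennreal (t \<delta>))"
        by (intro add_left_mono add_right_mono ennreal_leI cR)
      finally show ?thesis .
    qed
  qed
  \<comment> \<open>A finite D is pulled out of the infimum by subtraction. If \<open>rad\<close> is
    0 the index set is empty and the infimum is \<infinity>.\<close>
  have "X \<le> D + (INF \<delta>\<in>{0<..rad S n}. ennreal (R \<delta>) + ennreal (t \<delta>))"
  proof (cases "D = \<infinity>")
    case False
    then have "X - D \<le> ennreal (R \<delta>) + ennreal (t \<delta>)" if "\<delta> \<in> {0<..rad S n}" for \<delta>
      using le[OF that] by (simp add: ennreal_minus_le_iff)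
    then have "X - D \<le> (INF \<delta>\<in>{0<..rad S n}. ennreal (R \<delta>) + ennreal (t \<delta>))"
      by (intro INF_greatest)
    then show ?thesis using False by (simp add: ennreal_minus_le_iff)
  qed simp
  with X1 show ?thesis unfolding X_def D_def R_def t_def by simp
qed

text \<open>One number \<kappa> bounds all moduli at this stage, and \<eta>, e come from the central
  limit bound. Nothing in the conclusion other than \<open>tau_C\<close> depends on G, so the
  supremum over the class can be taken afterwards.\<close>

lemma miscoverage_uniform:
  fixes l :: "'z measure \<Rightarrow> 'z \<Rightarrow> real vec"
  defines "I \<equiv> info_mat (pdim S) G (l G)"
  assumes p: "2 \<le> p" and \<alpha>: "0 < \<alpha>" "\<alpha> < 1" and K: "G \<in> K"
    and Q: "QMD S K l \<phi>" and He: "Hessian S K V w" and M: "Moment S p K l L \<nu>"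
    and Sc: "Score_moment S p K l L"
    and clt: "\<forall>(G :: 'z measure) X (J :: nat set) u.
     prob_space G \<longrightarrow> X \<in> borel_measurable G \<longrightarrow> integrable G (\<lambda>z. (X z)\<^sup>2) \<longrightarrow>
     (\<integral>z. X z \<partial>G) = 0 \<longrightarrow> (\<integral>z. (X z)\<^sup>2 \<partial>G) = 1 \<longrightarrow> finite J \<longrightarrow> 1 / \<eta> \<le> real (card J) \<longrightarrow>
     (\<integral>z. (X z)\<^sup>2 * min 1 (\<bar>X z\<bar> / (\<eta> * sqrt (card J))) \<partial>G) \<le> \<eta> \<longrightarrow>
     \<bar>measure (PiM J (\<lambda>_. G)) {y \<in> space (PiM J (\<lambda>_. G)). (\<Sum>i\<in>J. X (y i)) / sqrt (card J) \<le> u}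
        - cdf std_normal_distribution u\<bar> \<le> e"
    and \<eta>: "0 < \<eta>" "1 / \<eta> \<le> real n" and e: "0 \<le> e"
    and \<kappa>: "0 < \<kappa>" "\<kappa> \<le> 1 / 100" and rad: "rad S n \<le> \<kappa>"
    and phi: "\<And>\<delta>. 0 < \<delta> \<Longrightarrow> \<delta> \<le> rad S n \<Longrightarrow> \<bar>\<phi> G \<delta> / \<delta>\<^sup>2\<bar> < \<kappa>\<^sup>2"
    and w: "\<And>\<delta>. 0 < \<delta> \<Longrightarrow> \<delta> \<le> rad S n \<Longrightarrow> \<bar>w G \<delta> / \<delta>\<^sup>2\<bar> < \<kappa>"
    and nu: "\<And>\<delta>. 0 < \<delta> \<Longrightarrow> \<delta> \<le> rad S n \<Longrightarrow> \<bar>max (L n G) 1 * \<nu> G \<delta>\<bar> < \<kappa>"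
    and ulc: "\<And>t. t \<in> carrier_vec (pdim S) \<Longrightarrow>
        (let s = sqrt (\<integral>z. (t \<bullet> l G z)\<^sup>2 \<partial>G) in
            \<integral>\<^sup>+ z. ennreal ((t \<bullet> l G z)\<^sup>2 / s\<^sup>2 * min 1 (\<bar>t \<bullet> l G z\<bar> / (\<eta> * sqrt n * s))) \<partial>G) \<le> ennreal u"
    and u: "0 \<le> u" "8 * u + 9000 * \<kappa> \<le> \<eta>"
  shows "ennreal \<bar>miscoverage S n \<alpha> G - miscoverage_approx S n \<alpha> G I (V G)\<bar>
     \<le> ennreal (e + 30 * \<kappa> + tau_C S n G I (V G) (rad S n))"
proof -
  note l = QMD_score[OF Q K]
  have I: "I \<in> carrier_mat (pdim S) (pdim S)" by (simp add: I_def)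
  have I0: "0 \<le> mnorm I h" if "h \<in> carrier_vec (pdim S)" for h
    unfolding I_def by (rule mnorm_info_nonneg[OF l that])
  have V: "positive_definite_mat (pdim S) (V G)" using He K by (simp add: Hessian_def)
  have rad0: "0 \<le> rad S n" using valid n by (simp add: valid_problem_def)
  have "ennreal \<bar>miscoverage S n \<alpha> G - miscoverage_approx S n \<alpha> G I (V G)\<bar>
     \<le> (\<integral>\<^sup>+ \<omega>. 0 \<partial>sample S n G) + (ennreal (e + 30 * \<kappa>) + ennreal (tau_C S n G I (V G) (rad S n)))"
  proof (rule miscoverage_bound(1)[OF I I0 V \<alpha> rad0 target_llr_defined[OF He K]])
    fix \<omega> h
    assume \<omega>: "\<omega> \<in> space (sample S n G)" and h: "h = est_err S n G \<omega>"
      and a: "0 < mnorm I h" "mnorm I h \<le> rad S n" and v: "mnorm (V G) h \<le> rad S n"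
      and va: "(mnorm (V G) h)\<^sup>2 \<le> rad S n * mnorm I h"
    define a where "a = mnorm I h"
    define v where "v = mnorm (V G) h"
    define \<theta> where "\<theta> = est1 S n (data1 S n \<omega>)"
    define W where "W = log_lik_ratio S G \<theta>"
    define X where "X z = h \<bullet> l G z" for z
    \<comment> \<open>Chosen so that E^2 = 4 \<kappa>^2 + 12 \<kappa>^2, the two contributions in
      \<open>L2_close_of_conditions\<close>.\<close>
    define E where "E = 4 * \<kappa>"
    define \<rho> where "\<rho> = 3 * E + \<kappa>\<^sup>2"
    note * = est_err_eq[OF \<omega>, folded h \<theta>_def]
    have x: "data1 S n \<omega> \<in> space D1" by (rule data1_space[OF \<omega>])
    have \<theta>T: "\<theta> \<in> Theta S" unfolding \<theta>_def by (rule est1_in_Theta[OF x])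
    then have hT: "target S G + h \<in> Theta S" using *(2) by simp
    have a': "0 < a" "a \<le> rad S n" using a by (auto simp: a_def)
    have "h \<noteq> 0\<^sub>v (pdim S)" using a I by (auto simp: mnorm_def quadratic_form_eq_sum)
    then have v': "0 < v" "v \<le> rad S n" using mnorm_pd_pos[OF V *(1)] v by (auto simp: v_def)
    have \<kappa>2: "\<kappa>\<^sup>2 \<le> \<kappa>" using \<kappa> by (simp add: power2_eq_square mult_left_le)
    have E: "0 < E" "E \<le> 1" using \<kappa> by (auto simp: E_def)
    have \<rho>: "0 \<le> \<rho>" "\<rho> \<le> 13 * \<kappa>" "\<rho> \<le> 1 / 2" using \<kappa> \<kappa>2 by (auto simp: \<rho>_def E_def)
    have small: "2 * \<kappa> + (3 * E + \<kappa>\<^sup>2) \<le> 1 / 4" using \<rho> \<kappa> unfolding \<rho>_def[symmetric] by linarith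
    have phi_a: "\<phi> G a \<le> a\<^sup>2 * \<kappa>\<^sup>2" using phi[OF a'] a' by (simp add: abs_less_iff field_simps)
    have w_v: "w G v \<le> v\<^sup>2 * \<kappa>" using w[OF v'] v' by (simp add: abs_less_iff field_simps)
    have nu_a: "max (L n G) 1 * \<nu> G a \<le> \<kappa>" "0 \<le> \<nu> G a"
      using nu[OF a'] M K a' by (auto simp: abs_less_iff Moment_def is_modulus_def)
    have Xm [measurable]: "X \<in> borel_measurable G"
      unfolding X_def[abs_def] by (rule score_measurable[OF l *(1)])
    have X2: "integrable G (\<lambda>z. (X z)\<^sup>2)" "(\<integral>z. (X z)\<^sup>2 \<partial>G) = a\<^sup>2"
      using score_square_integrable[OF l *(1)] score_second_moment[OF l *(1)]
      by (simp_all add: X_def a_def I_def)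
    have Wm [measurable]: "W \<in> borel_measurable G" unfolding W_def by (rule log_lik_ratio_measurable[OF \<theta>T])
    have "(\<integral>\<^sup>+ z. ennreal ((W z - X z)\<^sup>2) \<partial>G) \<le> ennreal (4 * (max (L n G) 1 * a * \<nu> G a)\<^sup>2 + 12 * \<phi> G a)"
      using L2_close_of_conditions[OF p K Q M Sc *(1) hT] a
      by (simp add: W_def X_def a_def I_def *(2))
    also have "\<dots> \<le> ennreal ((a * E)\<^sup>2)"
    proof (rule ennreal_leI)
      have "max (L n G) 1 * a * \<nu> G a = a * (max (L n G) 1 * \<nu> G a)" by simp
      also have "\<dots> \<le> a * \<kappa>" using nu_a a' by (intro mult_left_mono) auto
      finally have "(max (L n G) 1 * a * \<nu> G a)\<^sup>2 \<le> (a * \<kappa>)\<^sup>2"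
        using a' nu_a by (intro power_mono) auto
      then have "4 * (max (L n G) 1 * a * \<nu> G a)\<^sup>2 + 12 * \<phi> G a \<le> 4 * (a * \<kappa>)\<^sup>2 + 12 * (a\<^sup>2 * \<kappa>\<^sup>2)"
        using phi_a by linarith
      also have "\<dots> = (a * E)\<^sup>2" by (simp add: E_def power_mult_distrib)
      finally show "4 * (max (L n G) 1 * a * \<nu> G a)\<^sup>2 + 12 * \<phi> G a \<le> (a * E)\<^sup>2" .
    qed
    finally have close: "(\<integral>\<^sup>+ z. ennreal ((W z - X z)\<^sup>2) \<partial>G) \<le> ennreal ((a * E)\<^sup>2)" .
    note H = Hessian_at[OF He K *(1) hT v, unfolded *(2)]
    have mean: "\<bar>(\<integral>z. W z \<partial>G) + v\<^sup>2 / 2\<bar> \<le> v\<^sup>2 * \<kappa>" using H(3) w_v by (simp add: v_def W_def)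
    have q: "v\<^sup>2 \<le> \<kappa> * a"
    proof -
      have "v\<^sup>2 \<le> rad S n * a" using va by (simp add: v_def a_def)
      also have "\<dots> \<le> \<kappa> * a" using rad a' by (intro mult_right_mono) auto
      finally show ?thesis .
    qed
    have \<kappa>0: "0 \<le> \<kappa>" using \<kappa> by simp
    note cm = cond_miss_bound[OF x \<alpha> Xm X2 a'(1) close[unfolded W_def \<theta>_def] E H(1)[unfolded \<theta>_def]
        mean[unfolded W_def \<theta>_def] zero_le_power2 q \<kappa>0 small, folded \<theta>_def, folded W_def]
    have sd: "\<bar>llr_sd S G \<theta> / a - 1\<bar> \<le> \<rho>" using cm(1) by (simp add: \<rho>_def)
    then have "1 / 2 \<le> llr_sd S G \<theta> / a" using \<rho> by linarith
    then have sd0: "0 < llr_sd S G \<theta>" using a' by (simp add: field_simps)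
    define m where "m = (\<integral>z. W z \<partial>G)"
    have m: "\<bar>m\<bar> \<le> \<kappa> * a" using cm(3) by (simp add: m_def)
    note cl = m[unfolded m_def]
    have W2: "integrable G (\<lambda>z. (W z)\<^sup>2)"
      by (rule G.integrable_power2_of_close[OF Wm Xm X2 a'(1) close E cl])
    have D2: "integrable G (\<lambda>z. (W z - X z)\<^sup>2)" "(\<integral>z. (W z - X z)\<^sup>2 \<partial>G) \<le> (a * E)\<^sup>2"
      using G.integral_diff_power2_of_close[OF Wm Xm X2 a'(1) close E cl] by auto
    note SC = G.standardized_L2_close[OF Wm Xm X2 a'(1) D2 m sd \<rho>(3)]
    define U where "U z = (W z - m) / llr_sd S G \<theta>" for z
    define Y where "Y z = X z / a" for z
    define c where "c = \<eta> * sqrt n"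
    have c: "0 < c" using \<eta> n by (simp add: c_def)
    have W1: "integrable G W" by (rule G.square_integrable_imp_integrable) (use W2 in auto)
    have U2: "integrable G (\<lambda>z. (U z)\<^sup>2)"
      unfolding U_def power_divide power2_diff using W1 W2 by simp
    have Y2: "integrable G (\<lambda>z. (Y z)\<^sup>2)" unfolding Y_def power_divide using X2 by simp
    have Um: "U \<in> borel_measurable G" and Ym [measurable]: "Y \<in> borel_measurable G"
      unfolding U_def[abs_def] Y_def[abs_def] by measurable
    have "sqrt (\<integral>z. (X z)\<^sup>2 \<partial>G) = a" using X2 a' by simp
    \<comment> \<open>Dividing by a = \<open>mnorm I h\<close> is exactly the normalisation inside
      \<open>ULC\<close>, taken in the direction h at truncation level \<eta> sqrt n.\<close>
    then have ulc': "(\<integral>\<^sup>+ z. ennreal ((Y z)\<^sup>2 * min 1 (\<bar>Y z\<bar> / c)) \<partial>G) \<le> ennreal u"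
      using ulc[OF *(1)] a'(1) by (simp add: Let_def X_def[symmetric] Y_def c_def power_divide abs_divide mult.commute)
    have "(\<integral>z. (Y z)\<^sup>2 * min 1 (\<bar>Y z\<bar> / c) \<partial>G) \<le> u"
      using enn2real_mono[OF ulc'] c u by (subst integral_eq_nn_integral) auto
    \<comment> \<open>Here 2232 = 12 (16 + 169 + 1), from E = 4\<kappa> and \<rho> \<le> 13\<kappa>.
      Four times this is 8928, which explains the 9000 in the assumption on \<eta>.\<close>
    moreover have "(\<integral>z. (U z - Y z)\<^sup>2 \<partial>G) \<le> 2232 * \<kappa>"
    proof -
      have "(\<integral>z. (U z - Y z)\<^sup>2 \<partial>G) \<le> 12 * (E\<^sup>2 + \<rho>\<^sup>2 + \<kappa>\<^sup>2)" using SC(2) by (simp add: U_def Y_def)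
      also have "\<rho>\<^sup>2 \<le> (13 * \<kappa>)\<^sup>2" using \<rho> by (intro power_mono) auto
      also have "12 * (E\<^sup>2 + (13 * \<kappa>)\<^sup>2 + \<kappa>\<^sup>2) = 2232 * \<kappa>\<^sup>2" by (simp add: E_def power_mult_distrib)
      also have "\<dots> \<le> 2232 * \<kappa>" using \<kappa>2 by simp
      finally show ?thesis by simp
    qed
    moreover have "(\<integral>z. (U z)\<^sup>2 * min 1 (\<bar>U z\<bar> / c) \<partial>G)
        \<le> 8 * (\<integral>z. (Y z)\<^sup>2 * min 1 (\<bar>Y z\<bar> / c) \<partial>G) + 4 * (\<integral>z. (U z - Y z)\<^sup>2 \<partial>G)"
      by (rule lindeberg_perturbation[OF Um Ym c U2 Y2]) (use SC(1) in \<open>simp add: U_def Y_def\<close>)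
    ultimately have lind: "(\<integral>z. (U z)\<^sup>2 * min 1 (\<bar>U z\<bar> / c) \<partial>G) \<le> \<eta>" using u(2) \<kappa> by linarith
    have "Delta_BE S n G (data1 S n \<omega>) \<le> ennreal e"
      by (rule Delta_BE_le[OF clt x _ _ \<eta>(2)])
        (use sd0 W2 lind in \<open>simp_all add: U_def c_def m_def W_def \<theta>_def\<close>)
    \<comment> \<open>The factor 30 is 2 (2 + 13), again by \<rho> \<le> 13\<kappa>.\<close>
    moreover have "ennreal (2 * (2 * \<kappa> + (3 * E + \<kappa>\<^sup>2))) \<le> ennreal (30 * \<kappa>)"
      using \<rho> by (intro ennreal_leI) (simp add: \<rho>_def[symmetric])
    ultimately have "Delta_BE S n G (data1 S n \<omega>) + ennreal (2 * (2 * \<kappa> + (3 * E + \<kappa>\<^sup>2))) \<le> ennreal e + ennreal (30 * \<kappa>)"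
      by (rule add_mono)
    also have "\<dots> = 0 + ennreal (e + 30 * \<kappa>)" using e \<kappa> by simp
    finally show "ennreal \<bar>cond_prob_given (fold1 S n) (fold2 S n) G (\<lambda>\<omega>. target S G \<notin> CI_UI S n \<alpha> \<omega>) (data1 S n \<omega>)
        - (1 - cdf std_normal_distribution
             (ln (1 / \<alpha>) / (sqrt n * mnorm I h) + sqrt n * (mnorm (V G) h)\<^sup>2 / (2 * mnorm I h)))\<bar>
       \<le> 0 + ennreal (e + 30 * \<kappa>)"
      using order_trans[OF cm(2)] unfolding a_def v_def by blast
  qed
  also have "\<dots> = ennreal (e + 30 * \<kappa> + tau_C S n G I (V G) (rad S n))"
    using e \<kappa> by (simp add: tau_C_def)
  finally show ?thesis .
qed

end

section \<open>Asymptotics and main theorem\<close>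

lemma ennreal_limsup_zeroD:
  fixes f :: "nat \<Rightarrow> ennreal"
  assumes "limsup f = 0" "0 < \<epsilon>"
  shows "\<forall>\<^sub>F n in sequentially. f n < \<epsilon>"
  using assms by (intro Limsup_lessD) auto

lemma ennreal_limsup_zeroI:
  fixes f :: "nat \<Rightarrow> ennreal"
  assumes "\<And>\<epsilon>::real. 0 < \<epsilon> \<Longrightarrow> \<forall>\<^sub>F n in sequentially. f n \<le> ennreal \<epsilon>"
  shows "limsup f = 0"
proof -
  have "limsup f \<le> 0"
  proof (rule ennreal_le_epsilon)
    fix \<epsilon> :: real assume "0 < \<epsilon>"
    from assms[OF this] show "limsup f \<le> 0 + ennreal \<epsilon>" by (simp add: Limsup_bounded)
  qed
  then show ?thesis by simp
qed

text \<open>The order of choices gives uniformity: \<eta> depends on \<epsilon> only, \<kappa> on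
  \<epsilon> and \<eta>, and then n is taken so large that every condition holds for all G at
  once.\<close>

lemma miscoverage_asymptotic:
  fixes S :: "'z ui_problem" and l :: "'z measure \<Rightarrow> 'z \<Rightarrow> real vec"
  assumes valid: "valid_problem S" and p: "2 \<le> p" and \<alpha>: "0 < \<alpha>" "\<alpha> < 1"
    and Q: "QMD S (dists S) l \<phi>" and He: "Hessian S (dists S) V w" and M: "Moment S p (dists S) l L \<nu>"
    and Sc: "Score_moment S p (dists S) l L" and Co: "Consistency S l V" and U: "ULC S l"
  shows "limsup (\<lambda>n. SUP G\<in>dists S.
     ennreal \<bar>miscoverage S n \<alpha> G - miscoverage_approx S n \<alpha> G (info_mat (pdim S) G (l G)) (V G)\<bar>) = 0"
proof (rule ennreal_limsup_zeroI)
  fix \<epsilon> :: real assume \<epsilon>: "0 < \<epsilon>"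
  obtain \<eta> where \<eta>: "0 < \<eta>" and clt: "\<forall>(G :: 'z measure) X (J :: nat set) u.
     prob_space G \<longrightarrow> X \<in> borel_measurable G \<longrightarrow> integrable G (\<lambda>z. (X z)\<^sup>2) \<longrightarrow>
     (\<integral>z. X z \<partial>G) = 0 \<longrightarrow> (\<integral>z. (X z)\<^sup>2 \<partial>G) = 1 \<longrightarrow> finite J \<longrightarrow> 1 / \<eta> \<le> real (card J) \<longrightarrow>
     (\<integral>z. (X z)\<^sup>2 * min 1 (\<bar>X z\<bar> / (\<eta> * sqrt (card J))) \<partial>G) \<le> \<eta> \<longrightarrow>
     \<bar>measure (PiM J (\<lambda>_. G)) {y \<in> space (PiM J (\<lambda>_. G)). (\<Sum>i\<in>J. X (y i)) / sqrt (card J) \<le> u}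
        - cdf std_normal_distribution u\<bar> \<le> \<epsilon> / 4"
    using uniform_central_limit[of "\<epsilon> / 4"] \<epsilon> by auto
  \<comment> \<open>The second bound makes 30 \<kappa> at most \<epsilon>/4. The third makes 9000
    \<kappa> at most \<eta>/2, the other half of \<eta> being 8 u.\<close>
  define \<kappa> where "\<kappa> = min (1 / 100) (min (\<epsilon> / 120) (\<eta> / 18000))"
  have \<kappa>: "0 < \<kappa>" "\<kappa> \<le> 1 / 100" "\<kappa> \<le> \<epsilon> / 120" "\<kappa> \<le> \<eta> / 18000"
    using \<epsilon> \<eta> by (auto simp: \<kappa>_def)
  define u where "u = \<eta> / 16"
  have u: "0 \<le> u" "0 < u" "8 * u + 9000 * \<kappa> \<le> \<eta>" using \<eta> \<kappa> by (auto simp: u_def)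
  let ?ulc = "\<lambda>\<kappa>::real. SUP G\<in>dists S. SUP t\<in>carrier_vec (pdim S).
         (let s = sqrt (\<integral>z. (t \<bullet> l G z)\<^sup>2 \<partial>G) in
            \<integral>\<^sup>+ z. ennreal ((t \<bullet> l G z)\<^sup>2 / s\<^sup>2 * min 1 (\<bar>t \<bullet> l G z\<bar> / (\<kappa> * s))) \<partial>G)"
  have "(?ulc \<longlongrightarrow> 0) at_top" using U by (simp add: ULC_def)
  moreover have lim: "filterlim (\<lambda>n. \<eta> * sqrt (real n)) at_top sequentially"
    by (intro filterlim_tendsto_pos_mult_at_top[OF tendsto_const \<eta>]
        filterlim_compose[OF sqrt_at_top filterlim_real_sequentially])
  \<comment> \<open>The truncation level of \<open>ULC\<close> is sent to infinity along \<eta> sqrt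
    n, the level at which the central limit bound tests the summands.\<close>
  ultimately have "((\<lambda>n. ?ulc (\<eta> * sqrt (real n))) \<longlongrightarrow> 0) sequentially"
    by (rule filterlim_compose)
  then have ev1: "\<forall>\<^sub>F n in sequentially. ?ulc (\<eta> * sqrt (real n)) < ennreal u"
    by (rule order_tendstoD) (use u in simp)
  have ev2: "\<forall>\<^sub>F n in sequentially. (SUP G\<in>dists S.
       ennreal (tau_C S n G (info_mat (pdim S) G (l G)) (V G) (rad S n))) < ennreal (\<epsilon> / 4)"
    using Co \<epsilon> unfolding Consistency_def by (intro ennreal_limsup_zeroD) auto
  have "rad S \<longlonglongrightarrow> 0" using valid by (simp add: valid_problem_def)
  then have ev3: "\<forall>\<^sub>F n in sequentially. rad S n < \<kappa>" by (rule order_tendstoD) (rule \<kappa>)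
  have ev4: "\<forall>\<^sub>F n in sequentially. 1 / \<eta> \<le> real n"
    using filterlim_real_sequentially by (simp add: filterlim_at_top)
  have ev5: "\<forall>\<^sub>F n in sequentially. \<forall>G\<in>dists S. \<forall>\<delta>. 0 < \<delta> \<and> \<delta> \<le> rad S n \<longrightarrow> \<bar>\<phi> G \<delta> / \<delta>\<^sup>2\<bar> < \<kappa>\<^sup>2"
    using Q \<kappa> by (auto simp: QMD_def vanishes_below_def)
  have ev6: "\<forall>\<^sub>F n in sequentially. \<forall>G\<in>dists S. \<forall>\<delta>. 0 < \<delta> \<and> \<delta> \<le> rad S n \<longrightarrow> \<bar>w G \<delta> / \<delta>\<^sup>2\<bar> < \<kappa>"
    using He \<kappa> by (auto simp: Hessian_def vanishes_below_def)
  have ev7: "\<forall>\<^sub>F n in sequentially. \<forall>G\<in>dists S. \<forall>\<delta>. 0 < \<delta> \<and> \<delta> \<le> rad S n \<longrightarrow> \<bar>max (L n G) 1 * \<nu> G \<delta>\<bar> < \<kappa>"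
    using M \<kappa> by (auto simp: Moment_def vanishes_below_def)
  show "\<forall>\<^sub>F n in sequentially. (SUP G\<in>dists S.
     ennreal \<bar>miscoverage S n \<alpha> G - miscoverage_approx S n \<alpha> G (info_mat (pdim S) G (l G)) (V G)\<bar>) \<le> ennreal \<epsilon>"
    using ev1 ev2 ev3 ev4 ev5 ev6 ev7 eventually_ge_at_top[of 1]
  proof eventually_elim
    case (elim n)
    show ?case
    proof (rule SUP_least)
      fix G assume G: "G \<in> dists S"
      interpret ui_stage S n G by unfold_locales (use valid elim G in auto)
      let ?tau = "tau_C S n G (info_mat (pdim S) G (l G)) (V G) (rad S n)"
      have "ennreal ?tau < ennreal (\<epsilon> / 4)"
        using elim(2) by (rule le_less_trans[rotated]) (rule SUP_upper[OF G])
      then have tau: "?tau < \<epsilon> / 4" using \<epsilon> by (simp add: ennreal_less_iff tau_C_def)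
      have ulc: "(let s = sqrt (\<integral>z. (t \<bullet> l G z)\<^sup>2 \<partial>G) in
            \<integral>\<^sup>+ z. ennreal ((t \<bullet> l G z)\<^sup>2 / s\<^sup>2 * min 1 (\<bar>t \<bullet> l G z\<bar> / (\<eta> * sqrt n * s))) \<partial>G) \<le> ennreal u"
        if "t \<in> carrier_vec (pdim S)" for t
        by (rule order_trans[OF _ less_imp_le[OF elim(1)]]) (intro SUP_upper2[OF G] SUP_upper2[OF that] order_refl)
      have "ennreal \<bar>miscoverage S n \<alpha> G - miscoverage_approx S n \<alpha> G (info_mat (pdim S) G (l G)) (V G)\<bar>
          \<le> ennreal (\<epsilon> / 4 + 30 * \<kappa> + ?tau)"
        by (rule miscoverage_uniform[OF p \<alpha> G Q He M Sc clt \<eta> elim(4) _ \<kappa>(1,2) _ _ _ _ ulc u(1,3)])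
          (use \<epsilon> elim G in auto)
      also have "\<dots> \<le> ennreal \<epsilon>" using tau \<kappa> by (intro ennreal_leI) auto
      finally show "ennreal \<bar>miscoverage S n \<alpha> G - miscoverage_approx S n \<alpha> G (info_mat (pdim S) G (l G)) (V G)\<bar> \<le> ennreal \<epsilon>" .
    qed
  qed
qed

theorem theorem1:
  fixes p :: real
  assumes p: "2 \<le> p"
  shows
    "\<exists>C>0. \<forall>(S :: 'z ui_problem) l \<phi> V w L \<nu> \<alpha>.
       valid_problem S \<longrightarrow> 0 < \<alpha> \<longrightarrow> \<alpha> < 1 \<longrightarrow>
       (let I = (\<lambda>G. info_mat (pdim S) G (l G)) in
         (\<forall>G\<in>dists S.
            QMD S {G} l \<phi> \<longrightarrow> Hessian S {G} V w \<longrightarrow>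
            Moment S p {G} l L \<nu> \<longrightarrow> Score_moment S p {G} l L \<longrightarrow>
            (\<forall>n\<ge>1.
               mono_on {0<..rad S n} (\<lambda>\<delta>. \<phi> G \<delta> / \<delta>\<^sup>2) \<longrightarrow>
               mono_on {0<..rad S n} (\<lambda>\<delta>. w G \<delta> / \<delta>\<^sup>2) \<longrightarrow>
               ennreal \<bar>miscoverage S n \<alpha> G - miscoverage_approx S n \<alpha> G (I G) (V G)\<bar>
                 \<le> min 1
                     ((\<integral>\<^sup>+ \<omega>. Delta_BE S n G (data1 S n \<omega>) \<partial>sample S n G) +
                      (INF \<delta>\<in>{0<..rad S n}.
                         ennreal (remainder_UI C (L n G) (\<phi> G) (w G) (\<nu> G) \<delta>) +
                         ennreal (tau_C S n G (I G) (V G) \<delta>)))))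
       \<and>
         (QMD S (dists S) l \<phi> \<longrightarrow> Hessian S (dists S) V w \<longrightarrow>
          Moment S p (dists S) l L \<nu> \<longrightarrow> Score_moment S p (dists S) l L \<longrightarrow>
          Consistency S l V \<longrightarrow> ULC S l \<longrightarrow>
          limsup (\<lambda>n. SUP G\<in>dists S.
            ennreal \<bar>miscoverage S n \<alpha> G - miscoverage_approx S n \<alpha> G (I G) (V G)\<bar>) = 0))"
  \<comment> \<open>The exponent p acts only through Hoelder's inequality, whose constant is 1, so
    the same witness 100 serves every p.\<close>
  unfolding Let_def
  by (intro exI[of _ 100] conjI allI impI ballI ui_stage.miscoverage_nonasymptotic[OF _ p]
      miscoverage_asymptotic[OF _ p])
    (auto simp: ui_stage_def)

end
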